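(* Let $0<\varepsilon<1/6$. If $k$ and $\ell$ are positive integers with $k\geq 1/\varepsilon$ and $\ell\geq 16k/\varepsilon$, then $\mathrm{ex}(n,H_{k,\ell})=O(n^{4/3+\varepsilon})$ (the implied constant depending on $\varepsilon,k,\ell$).
   Context: $\mathrm{ex}(n,H)$ is the maximum number of edges in an $n$-vertex graph with no subgraph isomorphic to $H$. For integers $k\geq 1$ and $\ell\geq 2$, $H_{k,\ell}$ is the graph with vertex set $\{x_{i,j}:1\leq i\leq 4k,\ 1\leq j\leq 2\ell\}$ (all distinct) and edge set consisting of: $x_{2i-1,j}x_{2i,j}$ for $1\leq i\leq 2k$, $1\leq j\leq 2\ell$; $x_{1,j}x_{1,j+1}$ and $x_{4k,j}x_{4k,j+1}$ for $1\leq j\leq 2\ell$; $x_{2i,j}x_{2i+1,j+1}$ and $x_{2i+1,j}x_{2i,j+1}$ for $1\leq i\leq 2k-1$, $1\leq j\leq 2\ell$; where $x_{i,2\ell+1}:=x_{i,1}$. This graph is $3$-regular and bipartite. *)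

theory Defs
  imports Complex_Main "HOL-Library.Landau_Symbols"
begin

text \<open>Simple graphs are given by a vertex set and a set of edges, each edge being a
  2-element subset of the vertex set.\<close>

definition contains_copy :: "'a set \<Rightarrow> 'a set set \<Rightarrow> 'b set \<Rightarrow> 'b set set \<Rightarrow> bool" where
  "contains_copy VH EH VG EG \<longleftrightarrow>
     (\<exists>f. inj_on f VH \<and> f ` VH \<subseteq> VG \<and> (\<forall>e\<in>EH. f ` e \<in> EG))"

definition all_edges :: "nat \<Rightarrow> nat set set" where
  "all_edges n = {{u, v} | u v. u < n \<and> v < n \<and> u \<noteq> v}"

definition ex_num :: "nat \<Rightarrow> 'a set \<Rightarrow> 'a set set \<Rightarrow> nat" where
  "ex_num n VH EH = Max {card E | E. E \<subseteq> all_edges n \<and> \<not> contains_copy VH EH {0..<n} E}"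

definition Hkl_succ :: "nat \<Rightarrow> nat \<Rightarrow> nat" where
  "Hkl_succ l j = (if j = 2 * l then 1 else j + 1)"

definition H_verts :: "nat \<Rightarrow> nat \<Rightarrow> (nat \<times> nat) set" where
  "H_verts k l = {1..4*k} \<times> {1..2*l}"

definition H_edges :: "nat \<Rightarrow> nat \<Rightarrow> (nat \<times> nat) set set" where
  "H_edges k l =
     {{(2*i-1, j), (2*i, j)} | i j. 1 \<le> i \<and> i \<le> 2*k \<and> 1 \<le> j \<and> j \<le> 2*l}
   \<union> {{(1, j), (1, Hkl_succ l j)} | j. 1 \<le> j \<and> j \<le> 2*l}
   \<union> {{(4*k, j), (4*k, Hkl_succ l j)} | j. 1 \<le> j \<and> j \<le> 2*l}
   \<union> {{(2*i, j), (2*i+1, Hkl_succ l j)} | i j. 1 \<le> i \<and> i \<le> 2*k-1 \<and> 1 \<le> j \<and> j \<le> 2*l}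
   \<union> {{(2*i+1, j), (2*i, Hkl_succ l j)} | i j. 1 \<le> i \<and> i \<le> 2*k-1 \<and> 1 \<le> j \<and> j \<le> 2*l}"

end

theory Submission
  imports Defs "HOL-Analysis.Convex"
begin

text \<open>Call the \<open>2k\<close> edges \<open>x\<^bsub>2i-1,j\<^esub> x\<^bsub>2i,j\<^esub>\<close> the \<open>j\<close>-th column of the target graph. Two consecutive columns span a
  closed walk of length \<open>8k\<close>, so a copy is a closed walk of length \<open>2l\<close>, without repeated vertices, in
  the auxiliary graph whose vertices are columns and whose edges are closed \<open>8k\<close>-walks of the host
  graph. A Cauchy-Schwarz argument shows that closed walks with repetitions are a minority as soon as,
  for most auxiliary edges, a fixed vertex lies in only a small share of the possible neighbouring
  columns.

  This share is controlled by the number of 3-walks between two vertices, compared with codegrees. After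
  passing to an almost regular subgraph with \<open>n\<close> vertices and degrees about \<open>\<delta> = n powr (1/3 + \<epsilon>)\<close>, most closed
  \<open>8k\<close>-walks only use pairs joined by at least about \<open>\<delta>\<^sup>3 / n\<close> many 3-walks. If codegrees along them are mostly
  much smaller than that, the host graph itself works. Otherwise some vertex \<open>v\<close> has many pairs of
  neighbours with codegree about some large \<open>t\<close>, and then one uses closed walks that return to the
  neighbourhood of \<open>v\<close> in every second step.\<close>

section \<open>Powers of symmetric kernels\<close>

text \<open>Traces of even powers of a symmetric kernel are log-convex, so the ratio of the last two
  is at least the \<open>n\<close>-th root of the last trace divided by the number of vertices.
  Passing from closed walks of length \<open>2 * n - 2\<close> to length \<open>2 * n\<close> thus
  gains the squared Rayleigh quotient, up to the \<open>n\<close>-th root of the vertex count. This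
  loss decides how large \<open>k\<close> and \<open>l\<close> must be. In the host graph with N
  vertices the length is \<open>8 * k\<close>, and the loss is at most y = N powr (\<epsilon>/4)
  once k >= 1/\<epsilon>. The graph of columns has up to about N powr (4k) vertices and a vertex
  spoils only a share of about 1/y^2 of the neighbouring columns, so \<open>l\<close> has to exceed
  a multiple of k/\<epsilon>. The remaining quantities are powers of y too: codegrees are confined
  to a window of ratio y, and the rich case pays further powers for the number of pairs and for the
  size of the neighbourhood. In total Delta^3 >= N y^12 = N powr (1 + 3\<epsilon>) is required,
  hence degrees of order N powr (1/3 + \<epsilon>).\<close>

lemma log_convex_growth:
  fixes a :: "nat \<Rightarrow> real"
  assumes lc: "\<And>i. (a (Suc i))\<^sup>2 \<le> a i * a (Suc (Suc i))"
    and pos: "a 0 > 0" "c > 0" and start: "c * a 0 \<le> a 1"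
  shows "c ^ n * a 0 \<le> a n"
proof -
  have "a i > 0 \<and> c * a i \<le> a (Suc i)" for i
  proof (induction i)
    case 0 then show ?case using pos start by simp
  next
    case (Suc i)
    then have p: "a (Suc i) > 0" using pos by (smt (verit) mult_pos_pos)
    have "c * a i * a (Suc i) \<le> a (Suc i) * a (Suc i)" using Suc p by simp
    also have "\<dots> \<le> a i * a (Suc (Suc i))" using lc[of i] by (simp add: power2_eq_square)
    finally have "a i * (c * a (Suc i)) \<le> a i * a (Suc (Suc i))" by (simp add: mult_ac)
    then have "c * a (Suc i) \<le> a (Suc (Suc i))" using Suc mult_le_cancel_left_pos by blast
    with p show ?case by simp
  qed
  note st = this
  show ?thesis
  proof (induction n)
    case (Suc n)
    have "c ^ Suc n * a 0 \<le> c * a n" using Suc pos by (simp add: mult.assoc)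
    with st[of n] show ?case by linarith
  qed simp
qed

text \<open>Successive ratios of a log-convex sequence do not decrease, so a bound on the last ratio
  holds for all earlier ones and multiplies down to \<open>a 0\<close>. The preceding lemma uses the
  same fact upwards from the first ratio.\<close>

lemma log_convex_ratio:
  fixes a :: "nat \<Rightarrow> real"
  assumes lc: "\<And>i. (a (Suc i))\<^sup>2 \<le> a i * a (Suc (Suc i))"
    and pos: "\<And>i. a i > 0" and last: "a (Suc n) \<le> \<mu> * a n"
  shows "a (Suc n) \<le> \<mu> ^ Suc n * a 0"
  using last
proof (induction n)
  case (Suc n)
  have mu: "\<mu> > 0" using Suc.prems pos[of "Suc n"] pos[of "Suc (Suc n)"]
    by (smt (verit) mult_nonpos_nonneg)
  have "a (Suc n) * a (Suc n) \<le> a n * a (Suc (Suc n))" using lc[of n] by (simp add: power2_eq_square)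
  also have "\<dots> \<le> a n * (\<mu> * a (Suc n))" using Suc.prems pos[of n] by simp
  finally have "a (Suc n) * a (Suc n) \<le> (\<mu> * a n) * a (Suc n)" by (simp add: mult_ac)
  then have "a (Suc n) \<le> \<mu> * a n" using pos[of "Suc n"] by simp
  then have "a (Suc n) \<le> \<mu> ^ Suc n * a 0" by (rule Suc.IH)
  then have "\<mu> * a (Suc n) \<le> \<mu> ^ Suc (Suc n) * a 0" using mu by (simp add: mult.assoc)
  with Suc.prems show ?case by linarith
qed simp

text \<open>Matrix powers over the index set \<open>Z\<close>; for a 0/1 kernel the entries count
  walks of length \<open>n\<close>. Entries and Cauchy-Schwarz take the place of eigenvalues
  throughout.\<close>

primrec kpow :: "'a set \<Rightarrow> ('a \<Rightarrow> 'a \<Rightarrow> real) \<Rightarrow> nat \<Rightarrow> 'a \<Rightarrow> 'a \<Rightarrow> real" where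
  "kpow Z B 0 = (\<lambda>x y. if x = y then 1 else 0)"
| "kpow Z B (Suc n) = (\<lambda>x y. \<Sum>z\<in>Z. B x z * kpow Z B n z y)"

lemma kpow_nonneg:
  assumes "\<And>x y. x \<in> Z \<Longrightarrow> y \<in> Z \<Longrightarrow> B x y \<ge> 0" "x \<in> Z" "y \<in> Z"
  shows "kpow Z B n x y \<ge> 0"
  using assms(2) by (induction n arbitrary: x) (auto intro!: sum_nonneg mult_nonneg_nonneg assms)

lemma kpow_add:
  assumes "finite Z" "x \<in> Z"
  shows "kpow Z B (m + n) x y = (\<Sum>z\<in>Z. kpow Z B m x z * kpow Z B n z y)"
  using assms(2)
proof (induction m arbitrary: x)
  case 0
  have "(\<Sum>z\<in>Z. kpow Z B 0 x z * kpow Z B n z y) = (\<Sum>z\<in>Z. if x = z then kpow Z B n z y else 0)"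
    by (intro sum.cong) auto
  then show ?case using 0 assms by simp
next
  case (Suc m)
  have "kpow Z B (Suc m + n) x y = (\<Sum>w\<in>Z. \<Sum>z\<in>Z. B x w * kpow Z B m w z * kpow Z B n z y)"
    by (simp add: Suc.IH sum_distrib_left mult.assoc)
  also have "\<dots> = (\<Sum>z\<in>Z. \<Sum>w\<in>Z. B x w * kpow Z B m w z * kpow Z B n z y)" by (rule sum.swap)
  finally show ?case by (simp add: sum_distrib_right)
qed

lemma kpow_one: "finite Z \<Longrightarrow> y \<in> Z \<Longrightarrow> kpow Z B (Suc 0) x y = B x y"
  by (subst kpow.simps) (simp add: if_distrib[of "\<lambda>t. _ * t"] cong: if_cong)

lemma kpow_Suc_right:
  assumes "finite Z" "x \<in> Z" "y \<in> Z"
  shows "kpow Z B (Suc n) x y = (\<Sum>z\<in>Z. kpow Z B n x z * B z y)"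
  using kpow_add[OF assms(1,2), of B n "Suc 0" y] kpow_one[OF assms(1,3), of B] by simp

lemma kpow_scale:
  "kpow Z (\<lambda>x y. c * B x y) n x y = c ^ n * kpow Z B n x y"
  by (induction n arbitrary: x) (auto simp: sum_distrib_left mult_ac)

definition ktr :: "'a set \<Rightarrow> ('a \<Rightarrow> 'a \<Rightarrow> real) \<Rightarrow> nat \<Rightarrow> real" where
  "ktr Z B n = (\<Sum>x\<in>Z. kpow Z B n x x)"

lemma ktr_scale: "ktr Z (\<lambda>x y. c * B x y) n = c ^ n * ktr Z B n"
  by (simp add: ktr_def kpow_scale sum_distrib_left)

lemma ktr_0: "ktr Z B 0 = card Z"
  by (simp add: ktr_def)

locale sym_kernel =
  fixes Z :: "'a set" and B :: "'a \<Rightarrow> 'a \<Rightarrow> real"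
  assumes finZ: "finite Z"
    and symB: "\<And>x y. x \<in> Z \<Longrightarrow> y \<in> Z \<Longrightarrow> B x y = B y x"
    and nonnegB: "\<And>x y. x \<in> Z \<Longrightarrow> y \<in> Z \<Longrightarrow> B x y \<ge> 0"
begin

lemma kpow_sym: "x \<in> Z \<Longrightarrow> y \<in> Z \<Longrightarrow> kpow Z B n x y = kpow Z B n y x"
proof (induction n arbitrary: x y)
  case (Suc n)
  have "kpow Z B (Suc n) x y = (\<Sum>z\<in>Z. kpow Z B n y z * B z x)"
    using Suc by (auto intro!: sum.cong simp: symB mult.commute)
  then show ?case using Suc.prems kpow_Suc_right[OF finZ] by metis
qed simp

lemma ktr_add: "ktr Z B (i + j) = (\<Sum>x\<in>Z. \<Sum>y\<in>Z. kpow Z B i x y * kpow Z B j x y)"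
  unfolding ktr_def by (intro sum.cong refl) (simp add: kpow_add finZ kpow_sym)

lemma ktr_double: "ktr Z B (2 * i) = (\<Sum>x\<in>Z. \<Sum>y\<in>Z. (kpow Z B i x y)\<^sup>2)"
  using ktr_add[of i i] by (simp add: mult_2 power2_eq_square)

lemma sum2_Cauchy_Schwarz:
  fixes f h :: "'a \<Rightarrow> 'a \<Rightarrow> real"
  shows "(\<Sum>x\<in>Z. \<Sum>y\<in>Z. f x y * h x y)\<^sup>2 \<le> (\<Sum>x\<in>Z. \<Sum>y\<in>Z. (f x y)\<^sup>2) * (\<Sum>x\<in>Z. \<Sum>y\<in>Z. (h x y)\<^sup>2)"
  using Cauchy_Schwarz_ineq_sum[of "\<lambda>(x,y). f x y" "\<lambda>(x,y). h x y" "Z \<times> Z"]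
  by (simp add: sum.cartesian_product case_prod_unfold)

text \<open>The trace of power \<open>2 * Suc i\<close> is the entrywise inner product of the powers
  \<open>i\<close> and \<open>Suc (Suc i)\<close>, whose squared norms are the neighbouring even
  traces.\<close>

lemma ktr_log_convex: "(ktr Z B (2 * Suc i))\<^sup>2 \<le> ktr Z B (2 * i) * ktr Z B (2 * Suc (Suc i))"
proof -
  have "ktr Z B (2 * Suc i) = (\<Sum>x\<in>Z. \<Sum>y\<in>Z. kpow Z B i x y * kpow Z B (Suc (Suc i)) x y)"
    using ktr_add[of i "Suc (Suc i)"] by (simp add: mult_2 del: kpow.simps)
  then show ?thesis
    using sum2_Cauchy_Schwarz[of "kpow Z B i" "kpow Z B (Suc (Suc i))"]
    by (simp only: ktr_double)
qed

section \<open>Iterates of a vector under the kernel, and lower bounds for traces\<close>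

definition kvec :: "('a \<Rightarrow> real) \<Rightarrow> nat \<Rightarrow> 'a \<Rightarrow> real" where
  "kvec v i x = (\<Sum>y\<in>Z. kpow Z B i x y * v y)"

lemma sum_kvec_mult:
  "(\<Sum>x\<in>Z. kvec v i x * kvec v j x) = (\<Sum>y\<in>Z. \<Sum>w\<in>Z. v y * kpow Z B (i + j) y w * v w)"
proof -
  have "(\<Sum>x\<in>Z. kvec v i x * kvec v j x)
      = (\<Sum>x\<in>Z. \<Sum>y\<in>Z. \<Sum>w\<in>Z. kpow Z B i x y * v y * (kpow Z B j x w * v w))"
    by (simp add: kvec_def sum_product)
  also have "\<dots> = (\<Sum>y\<in>Z. \<Sum>w\<in>Z. \<Sum>x\<in>Z. kpow Z B i x y * v y * (kpow Z B j x w * v w))"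
    by (subst sum.swap) (intro sum.cong refl sum.swap)
  also have "\<dots> = (\<Sum>y\<in>Z. \<Sum>w\<in>Z. v y * kpow Z B (i + j) y w * v w)"
    by (intro sum.cong refl)
      (auto simp: kpow_add finZ sum_distrib_left sum_distrib_right kpow_sym mult_ac intro!: sum.cong)
  finally show ?thesis .
qed

text \<open>The squared norms of the iterates of \<open>v\<close> are log-convex. The assumption
  \<open>lam\<close>, a Rayleigh quotient of at least \<open>\<nu>\<close>, makes their first ratio
  at least the square of \<open>\<nu>\<close>.\<close>

lemma kvec_growth:
  assumes v: "(\<Sum>x\<in>Z. (v x)\<^sup>2) > 0" and "\<nu> > 0"
    and lam: "\<nu> * (\<Sum>x\<in>Z. (v x)\<^sup>2) \<le> (\<Sum>x\<in>Z. \<Sum>y\<in>Z. v x * B x y * v y)"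
  shows "\<nu> ^ (2 * n) * (\<Sum>x\<in>Z. (v x)\<^sup>2) \<le> (\<Sum>x\<in>Z. (kvec v n x)\<^sup>2)"
proof -
  define q where "q i = (\<Sum>x\<in>Z. (kvec v i x)\<^sup>2)" for i
  have v0: "kvec v 0 x = v x" if "x \<in> Z" for x
  proof -
    have "kvec v 0 x = (\<Sum>y\<in>Z. if x = y then v y else 0)"
      unfolding kvec_def by (intro sum.cong) auto
    then show ?thesis using that finZ by simp
  qed
  have q0: "q 0 = (\<Sum>x\<in>Z. (v x)\<^sup>2)" unfolding q_def using v0 by simp
  have lc: "(q (Suc i))\<^sup>2 \<le> q i * q (Suc (Suc i))" for i
  proof -
    have "q (Suc i) = (\<Sum>x\<in>Z. kvec v i x * kvec v (Suc (Suc i)) x)"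
      unfolding q_def power2_eq_square sum_kvec_mult by simp
    then show ?thesis using Cauchy_Schwarz_ineq_sum[of "kvec v i" "kvec v (Suc (Suc i))" Z]
      by (simp only: q_def)
  qed
  have "(\<Sum>x\<in>Z. \<Sum>y\<in>Z. v x * B x y * v y) = (\<Sum>x\<in>Z. kvec v 0 x * kvec v 1 x)"
    unfolding sum_kvec_mult using kpow_one[OF finZ, of _ B] by simp
  then have "(\<Sum>x\<in>Z. \<Sum>y\<in>Z. v x * B x y * v y)\<^sup>2 \<le> q 0 * q 1"
    using Cauchy_Schwarz_ineq_sum[of "kvec v 0" "kvec v 1" Z] by (simp only: q_def)
  moreover have "(\<nu> * q 0)\<^sup>2 \<le> (\<Sum>x\<in>Z. \<Sum>y\<in>Z. v x * B x y * v y)\<^sup>2"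
    using lam v \<open>\<nu> > 0\<close> unfolding q0 by (intro power_mono) auto
  ultimately have "q 0 * (\<nu>\<^sup>2 * q 0) \<le> q 0 * q 1" by (simp add: power2_eq_square mult_ac)
  then have "\<nu>\<^sup>2 * q 0 \<le> q 1" using v q0 by simp
  then have "(\<nu>\<^sup>2) ^ n * q 0 \<le> q n"
    using log_convex_growth[of q "\<nu>\<^sup>2" n, OF lc] v q0 \<open>\<nu> > 0\<close> by simp
  then show ?thesis unfolding q0[symmetric] by (simp add: power_mult q_def)
qed

lemma kvec_le_ktr: "(\<Sum>x\<in>Z. (kvec v n x)\<^sup>2) \<le> ktr Z B (2 * n) * (\<Sum>x\<in>Z. (v x)\<^sup>2)"
proof -
  have "(\<Sum>x\<in>Z. (kvec v n x)\<^sup>2) \<le> (\<Sum>x\<in>Z. (\<Sum>y\<in>Z. (kpow Z B n x y)\<^sup>2) * (\<Sum>y\<in>Z. (v y)\<^sup>2))"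
    unfolding kvec_def by (intro sum_mono Cauchy_Schwarz_ineq_sum)
  then show ?thesis unfolding ktr_double by (simp add: sum_distrib_right)
qed

lemma ktr_lower:
  assumes v: "(\<Sum>x\<in>Z. (v x)\<^sup>2) > 0" and "\<nu> > 0"
    and lam: "\<nu> * (\<Sum>x\<in>Z. (v x)\<^sup>2) \<le> (\<Sum>x\<in>Z. \<Sum>y\<in>Z. v x * B x y * v y)"
  shows "\<nu> ^ (2 * n) \<le> ktr Z B (2 * n)"
  using order_trans[OF kvec_growth[OF assms, of n] kvec_le_ktr[of v n]] v by simp

text \<open>If the last ratio were at most \<open>\<mu>\<close>, log-convexity would bound the last
  trace by \<open>\<mu> ^ n\<close> times the zeroth trace, which is \<open>card Z\<close>; but the
  iterates of \<open>v\<close> force it up to \<open>\<nu> ^ (2 * n)\<close>.\<close>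

lemma ktr_ratio:
  fixes \<nu> \<mu> :: real
  assumes v: "(\<Sum>x\<in>Z. (v x)\<^sup>2) > 0" and "\<nu> > 0"
    and lam: "\<nu> * (\<Sum>x\<in>Z. (v x)\<^sup>2) \<le> (\<Sum>x\<in>Z. \<Sum>y\<in>Z. v x * B x y * v y)"
    and n: "n \<ge> 1" and small: "\<mu> ^ n * card Z < \<nu> ^ (2 * n)"
  shows "\<mu> * ktr Z B (2 * (n - 1)) < ktr Z B (2 * n)"
proof (rule ccontr)
  assume neg: "\<not> ?thesis"
  obtain m where m: "n = Suc m" using n by (cases n) auto
  have pos: "ktr Z B (2 * i) > 0" for i
    using ktr_lower[OF v \<open>\<nu> > 0\<close> lam, of i] \<open>\<nu> > 0\<close> by (smt (verit) zero_less_power)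
  have "ktr Z B (2 * Suc m) \<le> \<mu> ^ Suc m * ktr Z B (2 * 0)"
    by (rule log_convex_ratio[of "\<lambda>i. ktr Z B (2 * i)"])
      (use ktr_log_convex pos neg m in \<open>auto simp del: mult_Suc_right\<close>)
  then have "ktr Z B (2 * n) \<le> \<mu> ^ n * card Z" using m by (simp add: ktr_0 del: mult_Suc_right)
  with small ktr_lower[OF v \<open>\<nu> > 0\<close> lam, of n] show False by linarith
qed

text \<open>The sum of all entries of an even power is the squared norm of an iterate of the
  all-ones vector.\<close>

lemma sum_kpow_le: "(\<Sum>x\<in>Z. \<Sum>y\<in>Z. kpow Z B (2 * n) x y) \<le> card Z * ktr Z B (2 * n)"
proof -
  have "(\<Sum>x\<in>Z. \<Sum>y\<in>Z. kpow Z B (2 * n) x y) = (\<Sum>x\<in>Z. (kvec (\<lambda>_. 1) n x)\<^sup>2)"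
    unfolding power2_eq_square sum_kvec_mult by (simp add: mult_2)
  then show ?thesis using kvec_le_ktr[of "\<lambda>_. 1" n] by (simp add: mult.commute)
qed

end

section \<open>Sums over closed walks\<close>

fun lw :: "('a \<Rightarrow> 'a \<Rightarrow> real) \<Rightarrow> 'a list \<Rightarrow> real" where
  "lw B (x # y # ys) = B x y * lw B (y # ys)"
| "lw B _ = 1"

definition wl :: "'a set \<Rightarrow> nat \<Rightarrow> 'a list set" where
  "wl Z m = {xs. set xs \<subseteq> Z \<and> length xs = m}"

definition cw :: "('a \<Rightarrow> 'a \<Rightarrow> real) \<Rightarrow> 'a list \<Rightarrow> real" where
  "cw B xs = lw B (xs @ [hd xs])"

lemma wl_0: "wl Z 0 = {[]}"
  by (auto simp: wl_def)

lemma sum_wl_Suc: "(\<Sum>xs\<in>wl Z (Suc m). f xs) = (\<Sum>x\<in>Z. \<Sum>xs\<in>wl Z m. f (x # xs))"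
proof -
  have "(\<Sum>x\<in>Z. \<Sum>xs\<in>wl Z m. f (x # xs)) = (\<Sum>(x,xs)\<in>Z \<times> wl Z m. f (x # xs))"
    by (rule sum.cartesian_product)
  also have "\<dots> = (\<Sum>xs\<in>wl Z (Suc m). f xs)"
    by (rule sum.reindex_bij_witness[of _ "\<lambda>xs. (hd xs, tl xs)" "\<lambda>(x,xs). x # xs"])
      (auto simp: wl_def length_Suc_conv)
  finally show ?thesis ..
qed

lemma sum_wl_add: "(\<Sum>xs\<in>wl Z (m + n). f xs) = (\<Sum>us\<in>wl Z m. \<Sum>vs\<in>wl Z n. f (us @ vs))"
  by (induction m arbitrary: f) (simp_all add: sum_wl_Suc wl_0)

lemma lw_append: "lw B (us @ y # vs) = lw B (us @ [y]) * lw B (y # vs)"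
proof (induction us)
  case (Cons u us)
  then show ?case by (cases us) auto
qed simp

lemma lw_nonneg:
  assumes "\<And>x y. x \<in> Z \<Longrightarrow> y \<in> Z \<Longrightarrow> B x y \<ge> 0" "set xs \<subseteq> Z"
  shows "lw B xs \<ge> 0"
  using assms by (induction B xs rule: lw.induct) auto

lemma lw_nonzero_nth: "lw B xs \<noteq> 0 \<Longrightarrow> Suc i < length xs \<Longrightarrow> B (xs ! i) (xs ! Suc i) \<noteq> 0"
proof (induction B xs arbitrary: i rule: lw.induct)
  case (1 B x y ys)
  then show ?case by (cases i) auto
qed auto

lemma cw_nonzero_nth:
  assumes "cw B xs \<noteq> 0" "i < length xs"
  shows "B (xs ! i) (xs ! (Suc i mod length xs)) \<noteq> 0"
proof -
  have ne: "xs \<noteq> []" using assms(2) by auto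
  have "B ((xs @ [hd xs]) ! i) ((xs @ [hd xs]) ! Suc i) \<noteq> 0"
    by (rule lw_nonzero_nth) (use assms in \<open>auto simp: cw_def\<close>)
  moreover have "(xs @ [hd xs]) ! Suc i = xs ! (Suc i mod length xs)"
    using assms(2) ne by (cases "Suc i = length xs") (auto simp: nth_append hd_conv_nth)
  ultimately show ?thesis using assms(2) by (simp add: nth_append)
qed

lemma sum_lw:
  assumes "finite Z" "y \<in> Z"
  shows "(\<Sum>xs\<in>wl Z m. lw B (x # xs @ [y])) = kpow Z B (Suc m) x y"
proof (induction m arbitrary: x)
  case 0
  show ?case using kpow_one[OF assms, of B x] by (simp add: wl_0)
next
  case (Suc m)
  then show ?case
    by (simp add: sum_wl_Suc kpow.simps(2)[of Z B "Suc m"] sum_distrib_left[symmetric] del: kpow.simps(2))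
qed

lemma sum_cw:
  assumes "finite Z" "m > 0"
  shows "(\<Sum>xs\<in>wl Z m. cw B xs) = ktr Z B m"
proof -
  obtain n where n: "m = Suc n" using assms(2) by (cases m) auto
  show ?thesis unfolding n sum_wl_Suc ktr_def
    by (intro sum.cong refl) (use sum_lw[OF assms(1)] in \<open>simp add: cw_def del: kpow.simps(2)\<close>)
qed

text \<open>Fixing the entries at positions 0 and \<open>d\<close> cuts a closed walk into two
  independent open walks, of \<open>d\<close> and of \<open>m - d\<close> steps.\<close>

lemma sum_cw_pair_0:
  assumes "finite Z" "0 < d" "d < m"
  shows "(\<Sum>xs\<in>wl Z m. \<psi> (xs ! 0) (xs ! d) * cw B xs)
    = (\<Sum>x\<in>Z. \<Sum>y\<in>Z. \<psi> x y * kpow Z B d x y * kpow Z B (m - d) y x)"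
proof -
  obtain e where d: "d = Suc e" using assms by (cases d) auto
  obtain n where m: "m = Suc (e + Suc n)" using assms d less_natE[of d m] by auto
  have "(\<Sum>xs\<in>wl Z m. \<psi> (xs ! 0) (xs ! d) * cw B xs)
      = (\<Sum>x\<in>Z. \<Sum>us\<in>wl Z e. \<Sum>y\<in>Z. \<Sum>vs\<in>wl Z n. \<psi> x y * (lw B (x # us @ [y]) * lw B (y # vs @ [x])))"
    unfolding m sum_wl_Suc sum_wl_add
  proof (intro sum.cong refl)
    fix x us y vs assume "us \<in> wl Z e" "vs \<in> wl Z n"
    then have "length us = e" by (simp add: wl_def)
    then show "\<psi> ((x # us @ y # vs) ! 0) ((x # us @ y # vs) ! d) * cw B (x # us @ y # vs)
        = \<psi> x y * (lw B (x # us @ [y]) * lw B (y # vs @ [x]))"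
      using lw_append[of B "x # us" y "vs @ [x]"] by (simp add: cw_def d nth_append)
  qed
  also have "\<dots> = (\<Sum>x\<in>Z. \<Sum>y\<in>Z. \<Sum>us\<in>wl Z e. \<Sum>vs\<in>wl Z n. \<psi> x y * (lw B (x # us @ [y]) * lw B (y # vs @ [x])))"
    by (intro sum.cong refl sum.swap)
  also have "\<dots> = (\<Sum>x\<in>Z. \<Sum>y\<in>Z. \<psi> x y * kpow Z B d x y * kpow Z B (m - d) y x)"
  proof (intro sum.cong refl)
    fix x y assume "x \<in> Z" "y \<in> Z"
    have "m - d = Suc n" using m d by simp
    then show "(\<Sum>us\<in>wl Z e. \<Sum>vs\<in>wl Z n. \<psi> x y * (lw B (x # us @ [y]) * lw B (y # vs @ [x])))
        = \<psi> x y * kpow Z B d x y * kpow Z B (m - d) y x"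
      using sum_lw[OF assms(1) \<open>x \<in> Z\<close>, where B = B and m = n and x = y] sum_lw[OF assms(1) \<open>y \<in> Z\<close>, where B = B and m = e and x = x]
      by (simp add: d sum_distrib_left[symmetric] sum_distrib_right[symmetric] mult.assoc del: kpow.simps)
  qed
  finally show ?thesis .
qed

section \<open>Rotating closed walks\<close>

lemma cw_rotate: "cw B (rotate i xs) = cw B xs"
proof -
  have 1: "cw B (rotate1 ys) = cw B ys" for ys
  proof (cases ys)
    case (Cons x zs)
    then show ?thesis
    proof (cases zs)
      case (Cons y ws)
      then show ?thesis using \<open>ys = x # zs\<close> lw_append[of B "y # ws" x "[y]"] by (simp add: cw_def)
    qed auto
  qed simp
  show ?thesis by (induction i) (simp_all add: 1)
qed

lemma rotate_cancel: "i \<le> length xs \<Longrightarrow> rotate (length xs - i) (rotate i xs) = xs"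
  "i \<le> length xs \<Longrightarrow> rotate i (rotate (length xs - i) xs) = xs"
  by (simp_all add: rotate_rotate)

lemma sum_wl_rotate:
  assumes "i \<le> m"
  shows "(\<Sum>xs\<in>wl Z m. f (rotate i xs)) = (\<Sum>xs\<in>wl Z m. f xs)"
  by (rule sum.reindex_bij_witness[of _ "rotate (m - i)" "rotate i"])
    (use assms rotate_cancel in \<open>auto simp: wl_def\<close>)

lemma sum_cw_pair:
  assumes "finite Z" "i < j" "j < m"
  shows "(\<Sum>xs\<in>wl Z m. \<psi> (xs ! i) (xs ! j) * cw B xs)
    = (\<Sum>x\<in>Z. \<Sum>y\<in>Z. \<psi> x y * kpow Z B (j - i) x y * kpow Z B (m - (j - i)) y x)"
proof -
  have "(\<Sum>xs\<in>wl Z m. \<psi> (xs ! i) (xs ! j) * cw B xs)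
      = (\<Sum>xs\<in>wl Z m. \<psi> (rotate i xs ! 0) (rotate i xs ! (j - i)) * cw B (rotate i xs))"
    using assms by (intro sum.cong refl) (auto simp: cw_rotate nth_rotate wl_def)
  also have "\<dots> = (\<Sum>xs\<in>wl Z m. \<psi> (xs ! 0) (xs ! (j - i)) * cw B xs)"
    by (rule sum_wl_rotate) (use assms in auto)
  also have "\<dots> = (\<Sum>x\<in>Z. \<Sum>y\<in>Z. \<psi> x y * kpow Z B (j - i) x y * kpow Z B (m - (j - i)) y x)"
    by (rule sum_cw_pair_0) (use assms in auto)
  finally show ?thesis .
qed

text \<open>Positions are taken modulo \<open>m\<close> because the three consecutive entries may
  straddle the end of the list; rotation brings them to the front and leaves a return walk of
  \<open>m - 2\<close> steps.\<close>

lemma sum_cw_window: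
  assumes "finite Z" "i < m" "m \<ge> 3"
  shows "(\<Sum>xs\<in>wl Z m. \<psi> (xs ! i) (xs ! (Suc i mod m)) (xs ! (Suc (Suc i) mod m)) * cw B xs)
    = (\<Sum>x\<in>Z. \<Sum>y\<in>Z. \<Sum>z\<in>Z. \<psi> x y z * B x y * B y z * kpow Z B (m - 2) z x)"
proof -
  obtain n where m: "m = Suc (Suc (Suc n))" using assms(3) by (metis add_eq_if le_Suc_ex numeral_3_eq_3 plus_nat.simps)
  have "(\<Sum>xs\<in>wl Z m. \<psi> (xs ! i) (xs ! (Suc i mod m)) (xs ! (Suc (Suc i) mod m)) * cw B xs)
      = (\<Sum>xs\<in>wl Z m. \<psi> (rotate i xs ! 0) (rotate i xs ! 1) (rotate i xs ! 2) * cw B (rotate i xs))"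
    using assms by (intro sum.cong refl) (auto simp: cw_rotate nth_rotate wl_def)
  also have "\<dots> = (\<Sum>xs\<in>wl Z m. \<psi> (xs ! 0) (xs ! 1) (xs ! 2) * cw B xs)"
    by (rule sum_wl_rotate) (use assms in auto)
  also have "\<dots> = (\<Sum>x\<in>Z. \<Sum>y\<in>Z. \<Sum>z\<in>Z. \<psi> x y z * B x y * B y z * kpow Z B (m - 2) z x)"
    unfolding m sum_wl_Suc
  proof (intro sum.cong refl)
    fix x y z assume "x \<in> Z" "y \<in> Z" "z \<in> Z"
    show "(\<Sum>xs\<in>wl Z n. \<psi> ((x # y # z # xs) ! 0) ((x # y # z # xs) ! 1) ((x # y # z # xs) ! 2) * cw B (x # y # z # xs))
      = \<psi> x y z * B x y * B y z * kpow Z B (Suc (Suc (Suc n)) - 2) z x"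
      using sum_lw[OF assms(1) \<open>x \<in> Z\<close>, where B = B and m = n and x = z]
      by (simp add: cw_def sum_distrib_left[symmetric] mult.assoc del: kpow.simps)
  qed
  finally show ?thesis .
qed

section \<open>Closed walks without conflicts\<close>

locale weighted_graph =
  fixes Z :: "'a set" and E :: "'a \<Rightarrow> 'a \<Rightarrow> bool" and D :: "'a \<Rightarrow> real"
  assumes finZ: "finite Z"
    and symE: "\<And>x y. x \<in> Z \<Longrightarrow> y \<in> Z \<Longrightarrow> E x y \<Longrightarrow> E y x"
    and degE: "\<And>x. x \<in> Z \<Longrightarrow> real (card {y \<in> Z. E x y}) \<le> D x"
begin

text \<open>Dividing by the degrees replaces a regularity assumption: the quadratic form of \<^term>\<open>W\<close> at the vector
  \<open>sqrt D\<close> counts the edges, whatever the degrees are.\<close>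

definition W :: "'a \<Rightarrow> 'a \<Rightarrow> real" where
  "W x y = (if E x y then 1 / sqrt (D x * D y) else 0)"

lemma D_nonneg: "x \<in> Z \<Longrightarrow> D x \<ge> 0"
  using degE[of x] by linarith

lemma D_pos: "x \<in> Z \<Longrightarrow> y \<in> Z \<Longrightarrow> E x y \<Longrightarrow> D x > 0"
proof -
  assume "x \<in> Z" "y \<in> Z" "E x y"
  then have "card {y \<in> Z. E x y} > 0" using finZ by (auto simp: card_gt_0_iff)
  then show "D x > 0" using degE[OF \<open>x \<in> Z\<close>] by linarith
qed

sublocale sym_kernel Z W
proof
  show "W x y = W y x" if "x \<in> Z" "y \<in> Z" for x y
    using symE that by (auto simp: W_def mult.commute)
  show "W x y \<ge> 0" if "x \<in> Z" "y \<in> Z" for x y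
    using D_nonneg that by (simp add: W_def)
qed (rule finZ)

text \<open>The vertex \<^term>\<open>x\<close> is determined up to few choices by its neighbour \<^term>\<open>c\<close> and by \<^term>\<open>y\<close>, which is
  reached from \<^term>\<open>c\<close> without passing \<^term>\<open>x\<close>; two applications of Cauchy-Schwarz turn this
  into a gain over the number of all closed walks.\<close>

lemma conflict_bound:
  assumes conf: "\<And>c y. c \<in> Z \<Longrightarrow> y \<in> Z \<Longrightarrow> real (card {x \<in> Z. E c x \<and> C x c y}) \<le> \<kappa> * D c"
    and "\<kappa> \<ge> 0" and d: "1 \<le> d" "d \<le> l"
  shows "(\<Sum>x\<in>Z. \<Sum>c\<in>Z. \<Sum>y\<in>Z. of_bool (C x c y) * W x c * kpow Z W (d - 1) c y * kpow Z W (2 * l - d) y x)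
    \<le> sqrt (\<kappa> * ktr Z W (2 * l) * ktr Z W (2 * (l - 1)))" (is "?L \<le> _")
proof -
  define h where "h = kpow Z W (l - 1)"
  \<comment> \<open>The bound on the sum over \<open>x\<close> must be free of \<open>y\<close>,
    which is summed out afterwards. Hence all neighbours of \<open>c\<close> enter here, conflicting
    or not; the set of conflicting ones contributes only through its size.\<close>
  define f where "f c w = sqrt (\<Sum>x\<in>{x\<in>Z. E c x}. (h w x)\<^sup>2 / D x)" for c w
  have inner: "(\<Sum>x\<in>Z. of_bool (C x c y) * W x c * h w x) \<le> sqrt \<kappa> * f c w"
    if "c \<in> Z" "y \<in> Z" for c y w
  proof -
    define S where "S = {x \<in> Z. E c x \<and> C x c y}"
    have S: "finite S" "S \<subseteq> Z" using finZ by (auto simp: S_def)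
    have "(\<Sum>x\<in>Z. of_bool (C x c y) * W x c * h w x) = (\<Sum>x\<in>S. of_bool (C x c y) * W x c * h w x)"
      using finZ symE that by (intro sum.mono_neutral_right) (auto simp: S_def W_def)
    also have "\<dots> = (\<Sum>x\<in>S. (1 / sqrt (D c)) * (h w x / sqrt (D x)))"
      using symE that by (intro sum.cong refl) (auto simp: S_def W_def real_sqrt_mult)
    finally have eq: "(\<Sum>x\<in>Z. of_bool (C x c y) * W x c * h w x) = (\<Sum>x\<in>S. (1 / sqrt (D c)) * (h w x / sqrt (D x)))" .
    have "(\<Sum>x\<in>S. (1 / sqrt (D c)) * (h w x / sqrt (D x)))\<^sup>2
        \<le> (\<Sum>x\<in>S. (1 / sqrt (D c))\<^sup>2) * (\<Sum>x\<in>S. (h w x / sqrt (D x))\<^sup>2)"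
      by (rule Cauchy_Schwarz_ineq_sum)
    also have "(\<Sum>x\<in>S. (h w x / sqrt (D x))\<^sup>2) = (\<Sum>x\<in>S. (h w x)\<^sup>2 / D x)"
      using S D_nonneg by (intro sum.cong refl) (auto simp: power_divide)
    also have "(\<Sum>x\<in>S. (1 / sqrt (D c))\<^sup>2) = card S / D c"
      using D_nonneg that by (simp add: power_divide)
    also have "card S / D c * (\<Sum>x\<in>S. (h w x)\<^sup>2 / D x) \<le> \<kappa> * (f c w)\<^sup>2"
    proof (rule mult_mono)
      show "card S / D c \<le> \<kappa>"
        using conf[OF that] D_nonneg[OF that(1)] \<open>\<kappa> \<ge> 0\<close>
        by (cases "D c = 0") (auto simp: S_def divide_le_eq)
      have "(\<Sum>x\<in>S. (h w x)\<^sup>2 / D x) \<le> (\<Sum>x\<in>{x\<in>Z. E c x}. (h w x)\<^sup>2 / D x)"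
        by (rule sum_mono2) (use finZ D_nonneg in \<open>auto simp: S_def\<close>)
      also have "\<dots> = (f c w)\<^sup>2" unfolding f_def
        by (subst real_sqrt_pow2) (auto intro!: sum_nonneg divide_nonneg_nonneg D_nonneg)
      finally show "(\<Sum>x\<in>S. (h w x)\<^sup>2 / D x) \<le> (f c w)\<^sup>2" .
    qed (use \<open>\<kappa> \<ge> 0\<close> S in \<open>auto intro!: sum_nonneg divide_nonneg_nonneg D_nonneg\<close>)
    also have "\<kappa> * (f c w)\<^sup>2 = (sqrt \<kappa> * f c w)\<^sup>2" using \<open>\<kappa> \<ge> 0\<close> by (simp add: power_mult_distrib)
    finally show ?thesis unfolding eq
      by (rule power2_le_imp_le)
        (use \<open>\<kappa> \<ge> 0\<close> in \<open>auto simp: f_def intro!: mult_nonneg_nonneg real_sqrt_ge_zero sum_nonneg divide_nonneg_nonneg D_nonneg\<close>)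
  qed
  \<comment> \<open>The return walk is cut at \<open>w\<close> so that the stretch from
    \<open>c\<close> through \<open>y\<close> to \<open>w\<close> has exactly \<open>l\<close> steps
    and the one between \<open>w\<close> and \<open>x\<close> has \<open>l - 1\<close>. Since
    \<open>d\<close> is at most \<open>l\<close>, the vertex \<open>y\<close> lies on the first
    stretch.\<close>
  have split: "kpow Z W (2 * l - d) y x = (\<Sum>w\<in>Z. kpow Z W (l - d + 1) y w * h w x)" if "y \<in> Z" for y x
  proof -
    have "2 * l - d = (l - d + 1) + (l - 1)" using d by simp
    then show ?thesis using kpow_add[OF finZ that, of W "l - d + 1" "l - 1" x] by (simp only: h_def)
  qed
  have "?L = (\<Sum>x\<in>Z. \<Sum>c\<in>Z. \<Sum>y\<in>Z. \<Sum>w\<in>Z. kpow Z W (d - 1) c y * kpow Z W (l - d + 1) y w * (of_bool (C x c y) * W x c * h w x))"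
  proof (intro sum.cong refl)
    fix x c y assume "y \<in> Z"
    show "of_bool (C x c y) * W x c * kpow Z W (d - 1) c y * kpow Z W (2 * l - d) y x
      = (\<Sum>w\<in>Z. kpow Z W (d - 1) c y * kpow Z W (l - d + 1) y w * (of_bool (C x c y) * W x c * h w x))"
      unfolding split[OF \<open>y \<in> Z\<close>] sum_distrib_left by (intro sum.cong refl) (simp only: mult_ac)
  qed
  also have "\<dots> = (\<Sum>c\<in>Z. \<Sum>x\<in>Z. \<Sum>y\<in>Z. \<Sum>w\<in>Z. kpow Z W (d - 1) c y * kpow Z W (l - d + 1) y w * (of_bool (C x c y) * W x c * h w x))"
    by (rule sum.swap)
  also have "\<dots> = (\<Sum>c\<in>Z. \<Sum>y\<in>Z. \<Sum>x\<in>Z. \<Sum>w\<in>Z. kpow Z W (d - 1) c y * kpow Z W (l - d + 1) y w * (of_bool (C x c y) * W x c * h w x))"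
    by (rule sum.cong[OF refl], rule sum.swap)
  also have "\<dots> = (\<Sum>c\<in>Z. \<Sum>y\<in>Z. \<Sum>w\<in>Z. \<Sum>x\<in>Z. kpow Z W (d - 1) c y * kpow Z W (l - d + 1) y w * (of_bool (C x c y) * W x c * h w x))"
    by (rule sum.cong[OF refl], rule sum.cong[OF refl], rule sum.swap)
  also have "\<dots> = (\<Sum>c\<in>Z. \<Sum>y\<in>Z. \<Sum>w\<in>Z. kpow Z W (d - 1) c y * kpow Z W (l - d + 1) y w * (\<Sum>x\<in>Z. of_bool (C x c y) * W x c * h w x))"
    by (simp only: sum_distrib_left)
  also have "\<dots> \<le> (\<Sum>c\<in>Z. \<Sum>y\<in>Z. \<Sum>w\<in>Z. kpow Z W (d - 1) c y * kpow Z W (l - d + 1) y w * (sqrt \<kappa> * f c w))"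
    by (intro sum_mono mult_left_mono inner mult_nonneg_nonneg kpow_nonneg nonnegB)
  also have "\<dots> = (\<Sum>c\<in>Z. \<Sum>w\<in>Z. \<Sum>y\<in>Z. kpow Z W (d - 1) c y * kpow Z W (l - d + 1) y w * (sqrt \<kappa> * f c w))"
    by (rule sum.cong[OF refl], rule sum.swap)
  also have "\<dots> = sqrt \<kappa> * (\<Sum>c\<in>Z. \<Sum>w\<in>Z. kpow Z W l c w * f c w)"
  proof -
    have "(\<Sum>y\<in>Z. kpow Z W (d - 1) c y * kpow Z W (l - d + 1) y w * (sqrt \<kappa> * f c w)) = sqrt \<kappa> * (kpow Z W l c w * f c w)"
      if "c \<in> Z" for c w
    proof -
      have "l = (d - 1) + (l - d + 1)" using d by simp
      then have "kpow Z W l c w = (\<Sum>y\<in>Z. kpow Z W (d - 1) c y * kpow Z W (l - d + 1) y w)"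
        using kpow_add[OF finZ that, of W "d - 1" "l - d + 1" w] by simp
      then show ?thesis unfolding sum_distrib_right[symmetric] by (simp only: mult_ac)
    qed
    then show ?thesis by (simp add: sum_distrib_left del: kpow.simps)
  qed
  also have "\<dots> \<le> sqrt \<kappa> * sqrt (ktr Z W (2 * l) * ktr Z W (2 * (l - 1)))"
  proof (rule mult_left_mono)
    have "(\<Sum>c\<in>Z. \<Sum>w\<in>Z. (f c w)\<^sup>2) = (\<Sum>c\<in>Z. \<Sum>w\<in>Z. \<Sum>x\<in>Z. of_bool (E c x) * ((h w x)\<^sup>2 / D x))"
    proof (intro sum.cong refl)
      fix c w
      have "(f c w)\<^sup>2 = (\<Sum>x\<in>{x\<in>Z. E c x}. (h w x)\<^sup>2 / D x)" unfolding f_def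
        by (subst real_sqrt_pow2) (auto intro!: sum_nonneg divide_nonneg_nonneg D_nonneg)
      also have "\<dots> = (\<Sum>x\<in>Z. of_bool (E c x) * ((h w x)\<^sup>2 / D x))"
        using finZ by (intro sum.mono_neutral_cong_left) auto
      finally show "(f c w)\<^sup>2 = (\<Sum>x\<in>Z. of_bool (E c x) * ((h w x)\<^sup>2 / D x))" .
    qed
    also have "\<dots> = (\<Sum>w\<in>Z. \<Sum>c\<in>Z. \<Sum>x\<in>Z. of_bool (E c x) * ((h w x)\<^sup>2 / D x))"
      by (rule sum.swap)
    also have "\<dots> = (\<Sum>w\<in>Z. \<Sum>x\<in>Z. (\<Sum>c\<in>Z. of_bool (E c x)) * ((h w x)\<^sup>2 / D x))"
      unfolding sum_distrib_right by (intro sum.cong refl sum.swap)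
    \<comment> \<open>Each \<open>x\<close> is counted once per neighbour \<open>c\<close>, at most
      \<open>D x\<close> times, which cancels the divisor.\<close>
    also have "\<dots> \<le> (\<Sum>w\<in>Z. \<Sum>x\<in>Z. (h w x)\<^sup>2)"
    proof (intro sum_mono)
      fix w x assume "w \<in> Z" "x \<in> Z"
      have "(\<Sum>c\<in>Z. of_bool (E c x)) = real (card {c\<in>Z. E c x})"
        using finZ by (simp add: of_bool_def sum.If_cases Int_def)
      also have "{c\<in>Z. E c x} = {c\<in>Z. E x c}" using symE \<open>x \<in> Z\<close> by auto
      finally have "(\<Sum>c\<in>Z. of_bool (E c x)) \<le> D x" using degE[OF \<open>x \<in> Z\<close>] by simp
      then have "(\<Sum>c\<in>Z. of_bool (E c x)) * ((h w x)\<^sup>2 / D x) \<le> D x * ((h w x)\<^sup>2 / D x)"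
        using D_nonneg[OF \<open>x \<in> Z\<close>] by (intro mult_right_mono) auto
      also have "\<dots> \<le> (h w x)\<^sup>2" by (cases "D x = 0") auto
      finally show "(\<Sum>c\<in>Z. of_bool (E c x)) * ((h w x)\<^sup>2 / D x) \<le> (h w x)\<^sup>2" .
    qed
    finally have F: "(\<Sum>c\<in>Z. \<Sum>w\<in>Z. (f c w)\<^sup>2) \<le> ktr Z W (2 * (l - 1))"
      unfolding ktr_double h_def .
    have "(\<Sum>c\<in>Z. \<Sum>w\<in>Z. kpow Z W l c w * f c w)\<^sup>2 \<le> ktr Z W (2 * l) * (\<Sum>c\<in>Z. \<Sum>w\<in>Z. (f c w)\<^sup>2)"
      unfolding ktr_double by (rule sum2_Cauchy_Schwarz)
    also have "\<dots> \<le> ktr Z W (2 * l) * ktr Z W (2 * (l - 1))"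
      by (intro mult_left_mono F) (auto simp: ktr_double intro!: sum_nonneg)
    finally show "(\<Sum>c\<in>Z. \<Sum>w\<in>Z. kpow Z W l c w * f c w) \<le> sqrt (ktr Z W (2 * l) * ktr Z W (2 * (l - 1)))"
      by (rule real_le_rsqrt)
  qed (use \<open>\<kappa> \<ge> 0\<close> in simp)
  finally show ?thesis by (simp add: real_sqrt_mult mult.assoc)
qed

lemma W_quadratic: "(\<Sum>x\<in>Z. \<Sum>y\<in>Z. sqrt (D x) * W x y * sqrt (D y)) = (\<Sum>x\<in>Z. real (card {y \<in> Z. E x y}))"
proof (rule sum.cong[OF refl])
  fix x assume x: "x \<in> Z"
  have "(\<Sum>y\<in>Z. sqrt (D x) * W x y * sqrt (D y)) = (\<Sum>y\<in>Z. of_bool (E x y))"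
  proof (rule sum.cong[OF refl])
    fix y assume y: "y \<in> Z"
    show "sqrt (D x) * W x y * sqrt (D y) = of_bool (E x y)"
    proof (cases "E x y")
      case True
      then have "D x > 0" "D y > 0" using D_pos[OF x y] D_pos[OF y x] symE[OF x y] by auto
      then show ?thesis using True by (simp add: W_def real_sqrt_mult)
    qed (simp add: W_def)
  qed
  then show "(\<Sum>y\<in>Z. sqrt (D x) * W x y * sqrt (D y)) = real (card {y \<in> Z. E x y})"
    using finZ by (simp add: of_bool_def sum.If_cases Int_def)
qed

lemma ktr_W_ratio:
  fixes \<nu> \<mu> :: real
  assumes "(\<Sum>x\<in>Z. D x) > 0" "\<nu> > 0"
    and dense: "\<nu> * (\<Sum>x\<in>Z. D x) \<le> (\<Sum>x\<in>Z. real (card {y \<in> Z. E x y}))"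
    and "n \<ge> 1" and "\<mu> ^ n * card Z < \<nu> ^ (2 * n)"
  shows "\<mu> * ktr Z W (2 * (n - 1)) < ktr Z W (2 * n)"
proof (rule ktr_ratio[where v = "\<lambda>x. sqrt (D x)"])
  have eq: "(\<Sum>x\<in>Z. (sqrt (D x))\<^sup>2) = (\<Sum>x\<in>Z. D x)" by (intro sum.cong refl) (simp add: D_nonneg)
  show "0 < (\<Sum>x\<in>Z. (sqrt (D x))\<^sup>2)" using eq assms by simp
  show "\<nu> * (\<Sum>x\<in>Z. (sqrt (D x))\<^sup>2) \<le> (\<Sum>x\<in>Z. \<Sum>y\<in>Z. sqrt (D x) * W x y * sqrt (D y))"
    unfolding W_quadratic eq by (rule dense)
qed (use assms in auto)

lemma ktr_W_pos:
  fixes \<nu> :: real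
  assumes "(\<Sum>x\<in>Z. D x) > 0" "\<nu> > 0"
    and dense: "\<nu> * (\<Sum>x\<in>Z. D x) \<le> (\<Sum>x\<in>Z. real (card {y \<in> Z. E x y}))"
  shows "\<nu> ^ (2 * n) \<le> ktr Z W (2 * n)"
proof (rule ktr_lower[where v = "\<lambda>x. sqrt (D x)"])
  have eq: "(\<Sum>x\<in>Z. (sqrt (D x))\<^sup>2) = (\<Sum>x\<in>Z. D x)" by (intro sum.cong refl) (simp add: D_nonneg)
  show "0 < (\<Sum>x\<in>Z. (sqrt (D x))\<^sup>2)" using eq assms by simp
  show "\<nu> * (\<Sum>x\<in>Z. (sqrt (D x))\<^sup>2) \<le> (\<Sum>x\<in>Z. \<Sum>y\<in>Z. sqrt (D x) * W x y * sqrt (D y))"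
    unfolding W_quadratic eq by (rule dense)
qed (use assms in auto)

text \<open>Splitting off the neighbour \<open>c\<close> of \<open>x\<close> reduces the case
  \<open>d \<le> l\<close> to \<open>conflict_bound\<close>. For larger \<open>d\<close> the closed
  walk is started at \<open>y\<close> instead, which exchanges \<open>d\<close> with
  \<open>2 * l - d\<close> and calls for the symmetry of \<open>X\<close>.\<close>

lemma conflict_pair_bound:
  assumes conf: "\<And>c y. c \<in> Z \<Longrightarrow> y \<in> Z \<Longrightarrow> real (card {x \<in> Z. E c x \<and> X x y}) \<le> \<kappa> * D c"
    and symX: "\<And>x y. X x y \<Longrightarrow> X y x" and "\<kappa> \<ge> 0" and d: "1 \<le> d" "d < 2 * l"
  shows "(\<Sum>x\<in>Z. \<Sum>y\<in>Z. of_bool (X x y) * kpow Z W d x y * kpow Z W (2 * l - d) y x)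
    \<le> sqrt (\<kappa> * ktr Z W (2 * l) * ktr Z W (2 * (l - 1)))"
proof -
  have main: "(\<Sum>x\<in>Z. \<Sum>y\<in>Z. of_bool (X x y) * kpow Z W d x y * kpow Z W (2 * l - d) y x)
    \<le> sqrt (\<kappa> * ktr Z W (2 * l) * ktr Z W (2 * (l - 1)))" if d: "1 \<le> d" "d \<le> l" for d
  proof -
    obtain e where e: "d = Suc e" using d by (cases d) auto
    have "(\<Sum>x\<in>Z. \<Sum>y\<in>Z. of_bool (X x y) * kpow Z W d x y * kpow Z W (2 * l - d) y x)
      = (\<Sum>x\<in>Z. \<Sum>y\<in>Z. \<Sum>c\<in>Z. of_bool (X x y) * W x c * kpow Z W (d - 1) c y * kpow Z W (2 * l - d) y x)"
      unfolding e by (simp add: sum_distrib_left sum_distrib_right mult_ac)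
    also have "\<dots> = (\<Sum>x\<in>Z. \<Sum>c\<in>Z. \<Sum>y\<in>Z. of_bool (X x y) * W x c * kpow Z W (d - 1) c y * kpow Z W (2 * l - d) y x)"
      by (intro sum.cong refl sum.swap)
    also have "\<dots> \<le> sqrt (\<kappa> * ktr Z W (2 * l) * ktr Z W (2 * (l - 1)))"
      by (rule conflict_bound[where C = "\<lambda>x c y. X x y"]) (use conf \<open>\<kappa> \<ge> 0\<close> d in auto)
    finally show ?thesis .
  qed
  show ?thesis
  proof (cases "d \<le> l")
    case False
    have "(\<Sum>x\<in>Z. \<Sum>y\<in>Z. of_bool (X x y) * kpow Z W d x y * kpow Z W (2 * l - d) y x)
      = (\<Sum>y\<in>Z. \<Sum>x\<in>Z. of_bool (X x y) * kpow Z W d x y * kpow Z W (2 * l - d) y x)" by (rule sum.swap)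
    also have "\<dots> = (\<Sum>x\<in>Z. \<Sum>y\<in>Z. of_bool (X x y) * kpow Z W (2 * l - d) x y * kpow Z W (2 * l - (2 * l - d)) y x)"
      using d symX by (intro sum.cong refl) (auto simp: mult_ac)
    finally show ?thesis using main[of "2 * l - d"] False d by simp
  qed (use main d in simp)
qed

text \<open>If every closed walk of positive weight had a conflict, the trace \<open>a\<close> for
  length \<open>2 * l\<close> would be at most the number of position pairs times the root of
  \<open>\<kappa> * a * b\<close>, with \<open>b\<close> the trace for length
  \<open>2 * (l - 1)\<close>. This gives \<open>a \<le> 16 * l ^ 4 * \<kappa> * b\<close>, whereas
  the assumption \<open>small\<close> pushes the ratio of the two traces above that factor.\<close>

theorem conflict_free_closed_walk:
  fixes \<kappa> \<nu> :: real
  assumes D: "(\<Sum>x\<in>Z. D x) > 0" and "\<nu> > 0"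
    and dense: "\<nu> * (\<Sum>x\<in>Z. D x) \<le> (\<Sum>x\<in>Z. real (card {y \<in> Z. E x y}))"
    and conf: "\<And>c y. c \<in> Z \<Longrightarrow> y \<in> Z \<Longrightarrow> real (card {x \<in> Z. E c x \<and> X x y}) \<le> \<kappa> * D c"
    and symX: "\<And>x y. X x y \<Longrightarrow> X y x" and "\<kappa> \<ge> 0" and l: "l \<ge> 1"
    and small: "(16 * real l ^ 4 * \<kappa>) ^ l * card Z < \<nu> ^ (2 * l)"
  shows "\<exists>zs. set zs \<subseteq> Z \<and> length zs = 2 * l
    \<and> (\<forall>i<2*l. E (zs ! i) (zs ! (Suc i mod (2 * l))))
    \<and> (\<forall>i j. i < j \<longrightarrow> j < 2 * l \<longrightarrow> \<not> X (zs ! i) (zs ! j))"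
proof (rule ccontr)
  assume no: "\<not> ?thesis"
  define a b where "a = ktr Z W (2 * l)" and "b = ktr Z W (2 * (l - 1))"
  have b: "b > 0" using ktr_W_pos[OF D \<open>\<nu> > 0\<close> dense, of "l - 1"] \<open>\<nu> > 0\<close>
    unfolding b_def by (smt (verit) zero_less_power)
  have a: "a > 0" using ktr_W_pos[OF D \<open>\<nu> > 0\<close> dense, of l] \<open>\<nu> > 0\<close>
    unfolding a_def by (smt (verit) zero_less_power)
  define IJ where "IJ = {(i, j). i < j \<and> j < 2 * l}"
  have IJ: "finite IJ" "card IJ \<le> (2 * l) * (2 * l)"
  proof -
    have sub: "IJ \<subseteq> {..<2*l} \<times> {..<2*l}" by (auto simp: IJ_def)
    show "finite IJ" using finite_subset[OF sub] by simp
    show "card IJ \<le> (2 * l) * (2 * l)" using card_mono[OF _ sub] by (simp add: card_cartesian_product)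
  qed
  have nonneg: "cw W xs \<ge> 0" if "xs \<in> wl Z (2 * l)" for xs
  proof -
    have "xs \<noteq> []" using that l by (auto simp: wl_def)
    then have "set (xs @ [hd xs]) \<subseteq> Z" using that by (auto simp: wl_def)
    then show ?thesis unfolding cw_def by (intro lw_nonneg[of Z] nonnegB)
  qed
  have "a = (\<Sum>xs\<in>wl Z (2 * l). cw W xs)" unfolding a_def using sum_cw[OF finZ] l by simp
  also have "\<dots> \<le> (\<Sum>xs\<in>wl Z (2 * l). \<Sum>(i,j)\<in>IJ. of_bool (X (xs ! i) (xs ! j)) * cw W xs)"
  proof (rule sum_mono)
    fix xs assume xs: "xs \<in> wl Z (2 * l)"
    have rest: "(\<Sum>(i,j)\<in>IJ. of_bool (X (xs ! i) (xs ! j)) * cw W xs) \<ge> 0"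
      by (intro sum_nonneg) (use nonneg[OF xs] in auto)
    show "cw W xs \<le> (\<Sum>(i,j)\<in>IJ. of_bool (X (xs ! i) (xs ! j)) * cw W xs)"
    proof (cases "cw W xs = 0")
      case False
      have "E (xs ! i) (xs ! (Suc i mod (2 * l)))" if "i < 2 * l" for i
        using cw_nonzero_nth[OF False, of i] that xs by (auto simp: wl_def W_def split: if_splits)
      then obtain i j where ij: "i < j" "j < 2 * l" "X (xs ! i) (xs ! j)"
        using no xs by (auto simp: wl_def)
      then have "(\<lambda>(i,j). of_bool (X (xs ! i) (xs ! j)) * cw W xs) (i, j)
          \<le> (\<Sum>p\<in>IJ. (\<lambda>(i,j). of_bool (X (xs ! i) (xs ! j)) * cw W xs) p)"
        by (intro member_le_sum) (use IJ nonneg[OF xs] in \<open>auto simp: IJ_def\<close>)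
      then show ?thesis using ij by simp
    qed (use rest in simp)
  qed
  also have "\<dots> = (\<Sum>(i,j)\<in>IJ. \<Sum>xs\<in>wl Z (2 * l). of_bool (X (xs ! i) (xs ! j)) * cw W xs)"
    unfolding case_prod_unfold by (rule sum.swap)
  also have "\<dots> \<le> (\<Sum>(i,j)\<in>IJ. sqrt (\<kappa> * a * b))"
  proof (intro sum_mono, clarify)
    fix i j assume "(i, j) \<in> IJ"
    then have ij: "i < j" "j < 2 * l" by (auto simp: IJ_def)
    show "(\<Sum>xs\<in>wl Z (2 * l). of_bool (X (xs ! i) (xs ! j)) * cw W xs) \<le> sqrt (\<kappa> * a * b)"
      unfolding sum_cw_pair[OF finZ ij, of "\<lambda>x y. of_bool (X x y)"] a_def b_def
      by (rule conflict_pair_bound) (use conf symX \<open>\<kappa> \<ge> 0\<close> ij in auto)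
  qed
  also have "\<dots> \<le> 4 * real l ^ 2 * sqrt (\<kappa> * a * b)"
  proof -
    have "real (card IJ) \<le> real ((2 * l) * (2 * l))" using IJ(2) by (simp only: of_nat_le_iff)
    then have "real (card IJ) * sqrt (\<kappa> * a * b) \<le> (4 * real l ^ 2) * sqrt (\<kappa> * a * b)"
      by (intro mult_right_mono) (use a b \<open>\<kappa> \<ge> 0\<close> in \<open>auto simp: power2_eq_square\<close>)
    then show ?thesis by simp
  qed
  finally have "a\<^sup>2 \<le> (4 * real l ^ 2 * sqrt (\<kappa> * a * b))\<^sup>2" using a by (intro power_mono) auto
  also have "\<dots> = a * (16 * real l ^ 4 * \<kappa> * b)" using a b \<open>\<kappa> \<ge> 0\<close>
    by (simp add: power_mult_distrib mult_ac flip: power_mult)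
  finally have "a \<le> 16 * real l ^ 4 * \<kappa> * b" using a by (simp add: power2_eq_square)
  moreover have "16 * real l ^ 4 * \<kappa> * b < a"
    unfolding a_def b_def by (rule ktr_W_ratio[OF D \<open>\<nu> > 0\<close> dense l small])
  ultimately show False by simp
qed

end

section \<open>Columns\<close>

definition role :: "bool \<Rightarrow> 'v \<times> 'v \<Rightarrow> 'v" where
  "role b e = (if b then fst e else snd e)"

text \<open>The share bound is available only at entries that are \<open>ok\<close>, but a single
  \<open>ok\<close> entry with endpoint \<open>w\<close> already bounds the whole fibre over
  \<open>w\<close>. The other coordinates stay free.\<close>

lemma card_PiE_fix_one:
  fixes S :: "nat \<Rightarrow> ('v \<times> 'v) set" and \<kappa> :: real
  assumes fin: "\<And>m. m < r \<Longrightarrow> finite (S m)" and m: "m < r" and "\<kappa> \<ge> 0"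
    and share: "\<And>m f b. m < r \<Longrightarrow> f \<in> S m \<Longrightarrow> ok m f \<Longrightarrow>
      real (card {f' \<in> S m. role b f' = role b f}) \<le> \<kappa> * card (S m)"
    and T: "T \<subseteq> PiE {..<r} S" "\<And>d m. d \<in> T \<Longrightarrow> m < r \<Longrightarrow> ok m (d m)"
  shows "real (card {d \<in> T. role b (d m) = w})
    \<le> \<kappa> * (\<Prod>i<r. card (S i))"
proof -
  define A where "A = {f \<in> S m. ok m f \<and> role b f = w}"
  have A: "real (card A) \<le> \<kappa> * card (S m)"
  proof (cases "A = {}")
    case False
    then obtain f where f: "f \<in> S m" "ok m f" "role b f = w" by (auto simp: A_def)
    have "card A \<le> card {f' \<in> S m. role b f' = role b f}"
      by (rule card_mono) (use fin[OF m] f in \<open>auto simp: A_def\<close>)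
    then show ?thesis using share[OF m f(1,2), of b] by linarith
  qed (use \<open>\<kappa> \<ge> 0\<close> in simp)
  have "{d \<in> T. role b (d m) = w} \<subseteq> PiE {..<r} (S(m := A))"
  proof
    fix d assume d: "d \<in> {d \<in> T. role b (d m) = w}"
    then have "d \<in> PiE {..<r} S" "ok m (d m)" using T m by auto
    then show "d \<in> PiE {..<r} (S(m := A))" using d m by (auto simp: PiE_iff A_def)
  qed
  then have "card {d \<in> T. role b (d m) = w} \<le> card (PiE {..<r} (S(m := A)))"
    by (rule card_mono[rotated]) (use fin m in \<open>auto intro!: finite_PiE simp: A_def\<close>)
  also have "\<dots> = card A * (\<Prod>i\<in>{..<r} - {m}. card (S i))"
    using m by (simp add: card_PiE prod.remove[of "{..<r}" m])
  finally have "real (card {d \<in> T. role b (d m) = w})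
      \<le> real (card A) * real (\<Prod>i\<in>{..<r} - {m}. card (S i))"
    unfolding of_nat_mult[symmetric] by (simp only: of_nat_le_iff)
  also have "\<dots> \<le> \<kappa> * card (S m) * real (\<Prod>i\<in>{..<r} - {m}. card (S i))"
    using A by (intro mult_right_mono) (auto simp del: of_nat_prod)
  also have "\<dots> = \<kappa> * (\<Prod>i<r. card (S i))"
  proof -
    have "(\<Prod>i<r. card (S i)) = card (S m) * (\<Prod>i\<in>{..<r} - {m}. card (S i))"
      using m by (intro prod.remove) auto
    then have "real (\<Prod>i<r. card (S i)) = real (card (S m)) * real (\<Prod>i\<in>{..<r} - {m}. card (S i))"
      by (simp only: of_nat_mult)
    then show ?thesis by (simp only: mult.assoc)
  qed
  finally show ?thesis .
qed

text \<open>Sum over the common value: coordinate \<open>m\<close> ranges freely over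
  \<open>S m\<close>, and its value fixes an endpoint of the \<open>ok\<close> entry at
  \<open>m'\<close>, leaving only a share \<open>\<kappa>\<close> of \<open>S m'\<close>.\<close>

lemma card_PiE_coincide:
  fixes S :: "nat \<Rightarrow> ('v \<times> 'v) set" and \<kappa> :: real
  assumes fin: "\<And>m. m < r \<Longrightarrow> finite (S m)" and m: "m < r" "m' < r" "m \<noteq> m'" and "\<kappa> \<ge> 0"
    and share: "\<And>m f b. m < r \<Longrightarrow> f \<in> S m \<Longrightarrow> ok m f \<Longrightarrow>
      real (card {f' \<in> S m. role b f' = role b f}) \<le> \<kappa> * card (S m)"
    and T: "T \<subseteq> PiE {..<r} S" "\<And>d m. d \<in> T \<Longrightarrow> m < r \<Longrightarrow> ok m (d m)"
  shows "real (card {d \<in> T. role b (d m) = role b' (d m')})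
    \<le> \<kappa> * (\<Prod>i<r. card (S i))"
proof -
  define A where "A w = {f \<in> S m. role b f = w}" for w
  define Y where "Y w = {f \<in> S m'. ok m' f \<and> role b' f = w}" for w
  define Q where "Q w = PiE {..<r} (S(m := A w, m' := Y w))" for w
  define p where "p = real (\<Prod>i\<in>{..<r} - {m} - {m'}. card (S i))"
  have Y: "real (card (Y w)) \<le> \<kappa> * card (S m')" for w
  proof (cases "Y w = {}")
    case False
    then obtain f where f: "f \<in> S m'" "ok m' f" "role b' f = w" by (auto simp: Y_def)
    have "card (Y w) \<le> card {f' \<in> S m'. role b' f' = role b' f}"
      by (rule card_mono) (use fin[OF m(2)] f in \<open>auto simp: Y_def\<close>)
    then show ?thesis using share[OF m(2) f(1,2), of b'] by linarith
  qed (use \<open>\<kappa> \<ge> 0\<close> in simp)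
  have cardQ: "real (card (Q w)) = card (A w) * (card (Y w) * p)" for w
  proof -
    have "card (Q w) = card (A w) * (card (Y w) * (\<Prod>i\<in>{..<r} - {m} - {m'}. card (S i)))"
      using m by (simp add: Q_def card_PiE prod.remove[of "{..<r}" m] prod.remove[of "{..<r} - {m}" m'])
    then show ?thesis by (simp add: p_def)
  qed
  have sumA: "(\<Sum>w\<in>role b ` S m. card (A w)) = card (S m)"
    using card_eq_sum sum.image_gen[OF fin[OF m(1)], of "\<lambda>_. 1::nat" "role b"] by (simp add: A_def)
  have "{d \<in> T. role b (d m) = role b' (d m')} \<subseteq> (\<Union>w\<in>role b ` S m. Q w)"
  proof
    fix d assume d: "d \<in> {d \<in> T. role b (d m) = role b' (d m')}"
    then have dP: "d \<in> PiE {..<r} S" and "ok m' (d m')" using T m by auto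
    then have "d \<in> Q (role b (d m))" using d m by (auto simp: Q_def A_def Y_def PiE_iff)
    moreover have "role b (d m) \<in> role b ` S m" using dP m by (intro imageI) (auto simp: PiE_iff)
    ultimately show "d \<in> (\<Union>w\<in>role b ` S m. Q w)" by blast
  qed
  then have "card {d \<in> T. role b (d m) = role b' (d m')}
      \<le> card (\<Union>w\<in>role b ` S m. Q w)"
    by (rule card_mono[rotated]) (use fin m in \<open>auto intro!: finite_PiE simp: Q_def A_def Y_def\<close>)
  also have "\<dots> \<le> (\<Sum>w\<in>role b ` S m. card (Q w))"
    using fin[OF m(1)] by (intro card_UN_le) auto
  finally have "real (card {d \<in> T. role b (d m) = role b' (d m')})
      \<le> (\<Sum>w\<in>role b ` S m. real (card (Q w)))"
    unfolding of_nat_sum[symmetric] by (simp only: of_nat_le_iff)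
  also have "\<dots> \<le> (\<Sum>w\<in>role b ` S m. card (A w) * (\<kappa> * card (S m') * p))"
    unfolding cardQ by (intro sum_mono mult_left_mono mult_right_mono Y) (auto simp: p_def simp del: of_nat_prod)
  also have "\<dots> = real (card (S m)) * (\<kappa> * card (S m') * p)"
    by (simp add: sum_distrib_right[symmetric] sumA[symmetric])
  also have "\<dots> = \<kappa> * (\<Prod>i<r. card (S i))"
  proof -
    have "(\<Prod>i<r. card (S i)) = card (S m) * (card (S m') * (\<Prod>i\<in>{..<r} - {m} - {m'}. card (S i)))"
      using m prod.remove[of "{..<r}" m "\<lambda>i. card (S i)"] prod.remove[of "{..<r} - {m}" m' "\<lambda>i. card (S i)"] by simp
    then have "real (\<Prod>i<r. card (S i)) = real (card (S m)) * (real (card (S m')) * p)"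
      by (simp only: p_def of_nat_mult)
    then show ?thesis by (simp only: mult_ac)
  qed
  finally show ?thesis .
qed

section \<open>Interleaving two columns into one closed walk\<close>

definition weave :: "nat \<Rightarrow> (nat \<Rightarrow> 'e) \<Rightarrow> (nat \<Rightarrow> 'e) \<Rightarrow> 'e list" where
  "weave r c d = map (\<lambda>p. if even p then c (p div 2) else d (p div 2)) [0..<2 * r]"

lemma length_weave: "length (weave r c d) = 2 * r"
  by (simp add: weave_def)

lemma nth_weave:
  assumes "m < r"
  shows "weave r c d ! (2 * m) = c m" "weave r c d ! (2 * m + 1) = d m"
    "weave r c d ! (Suc (2 * m) mod (2 * r)) = d m"
    "weave r c d ! (Suc (Suc (2 * m)) mod (2 * r)) = c (Suc m mod r)"
    "weave r c d ! (Suc (Suc (Suc (2 * m))) mod (2 * r)) = d (Suc m mod r)"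
proof -
  have e: "weave r c d ! (2 * n) = c n" and o: "weave r c d ! (2 * n + 1) = d n" if "n < r" for n
    using that by (simp_all add: weave_def)
  have s: "Suc (Suc (2 * m)) mod (2 * r) = 2 * (Suc m mod r)"
    using mult_mod_right[of 2 "Suc m" r] by simp
  have s': "Suc (Suc (Suc (2 * m))) mod (2 * r) = 2 * (Suc m mod r) + 1"
  proof (cases "Suc m = r")
    case True
    then have "Suc (Suc (Suc (2 * m))) = 1 + 2 * r" by simp
    then have "Suc (Suc (Suc (2 * m))) mod (2 * r) = 1 mod (2 * r)" by (simp only: mod_add_self2)
    then show ?thesis using assms True by simp
  next
    case False
    then show ?thesis using assms by simp
  qed
  have r: "Suc m mod r < r" using assms by simp
  show "weave r c d ! (2 * m) = c m" "weave r c d ! (2 * m + 1) = d m"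
    using e[OF assms] o[OF assms] by auto
  show "weave r c d ! (Suc (2 * m) mod (2 * r)) = d m" using o[OF assms] assms by simp
  show "weave r c d ! (Suc (Suc (2 * m)) mod (2 * r)) = c (Suc m mod r)" unfolding s by (rule e[OF r])
  show "weave r c d ! (Suc (Suc (Suc (2 * m))) mod (2 * r)) = d (Suc m mod r)" unfolding s' by (rule o[OF r])
qed

lemma sum_wl_weave:
  fixes Z :: "'b set"
  shows
  "(\<Sum>xs\<in>wl Z (2 * r). F xs) = (\<Sum>c\<in>{..<r} \<rightarrow>\<^sub>E Z. \<Sum>d\<in>{..<r} \<rightarrow>\<^sub>E Z. F (weave r c d))"
proof -
  have dec: "weave r (\<lambda>m\<in>{..<r}. xs ! (2 * m)) (\<lambda>m\<in>{..<r}. xs ! (2 * m + 1)) = xs"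
    if "length xs = 2 * r" for xs :: "'b list"
  proof (rule nth_equalityI)
    fix i assume "i < length (weave r (\<lambda>m\<in>{..<r}. xs ! (2 * m)) (\<lambda>m\<in>{..<r}. xs ! (2 * m + 1)))"
    then show "weave r (\<lambda>m\<in>{..<r}. xs ! (2 * m)) (\<lambda>m\<in>{..<r}. xs ! (2 * m + 1)) ! i = xs ! i"
      by (auto simp: weave_def)
  qed (simp add: that length_weave)
  have inv: "(\<lambda>m\<in>{..<r}. weave r c d ! (2 * m)) = c" "(\<lambda>m\<in>{..<r}. weave r c d ! (2 * m + 1)) = d"
    if "c \<in> {..<r} \<rightarrow>\<^sub>E Z" "d \<in> {..<r} \<rightarrow>\<^sub>E Z" for c d
  proof -
    show "(\<lambda>m\<in>{..<r}. weave r c d ! (2 * m)) = c"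
      by (rule PiE_ext[OF _ that(1)]) (use that in \<open>auto simp: PiE_iff nth_weave\<close>)
    show "(\<lambda>m\<in>{..<r}. weave r c d ! (2 * m + 1)) = d"
      by (rule PiE_ext[OF _ that(2)]) (use that in \<open>auto simp: PiE_iff nth_weave[simplified]\<close>)
  qed
  have weave_in: "weave r c d \<in> wl Z (2 * r)"
    if "c \<in> {..<r} \<rightarrow>\<^sub>E Z" "d \<in> {..<r} \<rightarrow>\<^sub>E Z" for c d
    using that by (auto simp: wl_def weave_def PiE_iff)
  have "(\<Sum>c\<in>{..<r} \<rightarrow>\<^sub>E Z. \<Sum>d\<in>{..<r} \<rightarrow>\<^sub>E Z. F (weave r c d))
    = (\<Sum>p\<in>({..<r} \<rightarrow>\<^sub>E Z) \<times> ({..<r} \<rightarrow>\<^sub>E Z). F (weave r (fst p) (snd p)))"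
    by (simp add: sum.cartesian_product case_prod_unfold)
  also have "\<dots> = (\<Sum>xs\<in>wl Z (2 * r). F xs)"
  proof (rule sum.reindex_bij_witness[of _ "\<lambda>xs. (\<lambda>m\<in>{..<r}. xs ! (2 * m), \<lambda>m\<in>{..<r}. xs ! (2 * m + 1))" "\<lambda>p. weave r (fst p) (snd p)"])
    fix xs assume "xs \<in> wl Z (2 * r)"
    then have xs: "length xs = 2 * r" "set xs \<subseteq> Z" by (auto simp: wl_def)
    show "weave r (fst (\<lambda>m\<in>{..<r}. xs ! (2 * m), \<lambda>m\<in>{..<r}. xs ! (2 * m + 1))) (snd (\<lambda>m\<in>{..<r}. xs ! (2 * m), \<lambda>m\<in>{..<r}. xs ! (2 * m + 1))) = xs"
      unfolding fst_conv snd_conv by (rule dec[OF xs(1)])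
    have "xs ! i \<in> Z" if "i < 2 * r" for i using xs that nth_mem[of i xs] by auto
    then show "(\<lambda>m\<in>{..<r}. xs ! (2 * m), \<lambda>m\<in>{..<r}. xs ! (2 * m + 1)) \<in> ({..<r} \<rightarrow>\<^sub>E Z) \<times> ({..<r} \<rightarrow>\<^sub>E Z)"
      by (simp add: PiE_iff)
  next
    fix p assume "p \<in> ({..<r} \<rightarrow>\<^sub>E Z) \<times> ({..<r} \<rightarrow>\<^sub>E Z)"
    then have p: "fst p \<in> {..<r} \<rightarrow>\<^sub>E Z" "snd p \<in> {..<r} \<rightarrow>\<^sub>E Z"
      by (simp_all only: mem_Times_iff)
    show "(\<lambda>m\<in>{..<r}. weave r (fst p) (snd p) ! (2 * m), \<lambda>m\<in>{..<r}. weave r (fst p) (snd p) ! (2 * m + 1)) = p"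
      unfolding inv[OF p] by simp
    show "weave r (fst p) (snd p) \<in> wl Z (2 * r)" by (rule weave_in[OF p])
  qed (rule refl)
  finally show ?thesis ..
qed

lemma cw_of_bool:
  assumes "xs \<noteq> []"
  shows "cw (\<lambda>x y. of_bool (R x y)) xs = of_bool (\<forall>i<length xs. R (xs ! i) (xs ! (Suc i mod length xs)))"
proof -
  have lw: "lw (\<lambda>x y. of_bool (R x y)) ys = of_bool (\<forall>i. Suc i < length ys \<longrightarrow> R (ys ! i) (ys ! Suc i))" for ys
  proof (induction "\<lambda>x y. of_bool (R x y) :: real" ys rule: lw.induct)
    case (1 x y ys)
    have "(\<forall>i. Suc i < length (x # y # ys) \<longrightarrow> R ((x # y # ys) ! i) ((x # y # ys) ! Suc i)) \<longleftrightarrow>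
      R x y \<and> (\<forall>i. Suc i < length (y # ys) \<longrightarrow> R ((y # ys) ! i) ((y # ys) ! Suc i))"
      by (auto simp: nth_Cons' less_Suc_eq_0_disj)
    then show ?case using 1 by (simp del: length_Cons nth_Cons_Suc)
  qed auto
  have nth: "(xs @ [hd xs]) ! i = xs ! i" "(xs @ [hd xs]) ! Suc i = xs ! (Suc i mod length xs)" if "i < length xs" for i
    using that assms by (auto simp: nth_append hd_conv_nth) (metis Suc_lessI mod_self)
  have "(\<forall>i. Suc i < length (xs @ [hd xs]) \<longrightarrow> R ((xs @ [hd xs]) ! i) ((xs @ [hd xs]) ! Suc i))
    \<longleftrightarrow> (\<forall>i<length xs. R (xs ! i) (xs ! (Suc i mod length xs)))" using nth by simp
  then show ?thesis unfolding cw_def lw by presburger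
qed

lemma all_less_double: "(\<forall>i<2 * r. Q i) \<longleftrightarrow> (\<forall>m<r. Q (2 * m) \<and> Q (Suc (2 * m)))"
proof safe
  fix i assume Q: "\<forall>m<r. Q (2 * m) \<and> Q (Suc (2 * m))" and "i < 2 * r"
  then show "Q i" by (cases "even i") (auto elim!: evenE oddE)
qed auto

text \<open>A closed walk \<open>e\<^sub>0, e\<^sub>1, \<dots>\<close> of length \<^term>\<open>2 * r\<close> in the relation \<^term>\<open>R\<close> on directed edges is cut into the
  two columns \<open>c = (e\<^sub>0, e\<^sub>2, \<dots>)\<close> and \<open>d = (e\<^sub>1, e\<^sub>3, \<dots>)\<close>. Given \<open>c\<close>, the entries of \<open>d\<close> can be chosen
  independently of each other, and conversely.\<close>

locale edge_links =
  fixes EE :: "('v \<times> 'v) set" and R :: "'v \<times> 'v \<Rightarrow> 'v \<times> 'v \<Rightarrow> bool" and \<kappa> :: real and r :: nat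
  assumes finEE: "finite EE" and r2: "r \<ge> 2" and kappa_nonneg: "\<kappa> \<ge> 0"
begin

definition mid :: "'v \<times> 'v \<Rightarrow> 'v \<times> 'v \<Rightarrow> ('v \<times> 'v) set" where
  "mid e g = {f \<in> EE. R e f \<and> R f g}"

text \<open>A property of the single choice \<open>f\<close> and not of the pair \<open>e\<close>,
  \<open>g\<close>: a few popular endpoints may well exist among the choices, and only walks through
  them are discarded.\<close>

definition ok :: "'v \<times> 'v \<Rightarrow> 'v \<times> 'v \<Rightarrow> 'v \<times> 'v \<Rightarrow> bool" where
  "ok e f g \<longleftrightarrow> (\<forall>b. real (card {f' \<in> mid e g. role b f' = role b f}) \<le> \<kappa> * card (mid e g))"

abbreviation Rk :: "'v \<times> 'v \<Rightarrow> 'v \<times> 'v \<Rightarrow> real" where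
  "Rk \<equiv> \<lambda>e f. of_bool (R e f)"

abbreviation nx :: "nat \<Rightarrow> nat" where "nx m \<equiv> Suc m mod r"

definition pv :: "nat \<Rightarrow> nat" where "pv m = (if m = 0 then r - 1 else m - 1)"

abbreviation Col :: "(nat \<Rightarrow> 'v \<times> 'v) set" where "Col \<equiv> {..<r} \<rightarrow>\<^sub>E EE"

definition M :: "(nat \<Rightarrow> 'v \<times> 'v) \<Rightarrow> (nat \<Rightarrow> 'v \<times> 'v) \<Rightarrow> bool" where
  "M c d \<longleftrightarrow> (\<forall>m<r. R (c m) (d m) \<and> R (d m) (c (nx m)))"

definition okM :: "(nat \<Rightarrow> 'v \<times> 'v) \<Rightarrow> (nat \<Rightarrow> 'v \<times> 'v) \<Rightarrow> bool" where
  "okM c d \<longleftrightarrow> (\<forall>m<r. ok (c m) (d m) (c (nx m)) \<and> ok (d m) (c (nx m)) (d (nx m)))"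

definition nondeg :: "(nat \<Rightarrow> 'v \<times> 'v) \<Rightarrow> bool" where
  "nondeg c \<longleftrightarrow> (\<forall>m<r. \<forall>m'<r. m \<noteq> m' \<longrightarrow> (\<forall>b b'. role b (c m) \<noteq> role b' (c m')))"

definition G :: "(nat \<Rightarrow> 'v \<times> 'v) \<Rightarrow> (nat \<Rightarrow> 'v \<times> 'v) \<Rightarrow> bool" where
  "G c d \<longleftrightarrow> M c d \<and> okM c d \<and> nondeg c \<and> nondeg d"

definition Dl :: "(nat \<Rightarrow> 'v \<times> 'v) \<Rightarrow> nat" where "Dl c = (\<Prod>m<r. card (mid (c m) (c (nx m))))"
definition Dr :: "(nat \<Rightarrow> 'v \<times> 'v) \<Rightarrow> nat" where "Dr d = (\<Prod>m<r. card (mid (d (pv m)) (d m)))"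

lemma nx_pv: "m < r \<Longrightarrow> nx m < r" "m < r \<Longrightarrow> pv m < r" "m < r \<Longrightarrow> nx (pv m) = m" "m < r \<Longrightarrow> pv (nx m) = m"
  using r2 by (auto simp: pv_def mod_if)

lemma finite_Col: "finite Col"
  by (simp add: finEE finite_PiE)

lemma finite_mid: "finite (mid e g)"
  using finEE by (simp add: mid_def)

lemma M_left: "{d \<in> Col. M c d} = PiE {..<r} (\<lambda>m. mid (c m) (c (nx m)))"
proof (rule set_eqI)
  fix d
  show "d \<in> {d \<in> Col. M c d} \<longleftrightarrow> d \<in> PiE {..<r} (\<lambda>m. mid (c m) (c (nx m)))"
    unfolding M_def mid_def PiE_iff mem_Collect_eq Ball_def lessThan_iff by blast
qed

text \<open>Seen from \<open>d\<close>, the entry \<open>c m\<close> sits between the cyclic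
  predecessor of \<open>d m\<close> and \<open>d m\<close> itself, which is why \<open>pv\<close>
  appears.\<close>

lemma M_right: "{c \<in> Col. M c d} = PiE {..<r} (\<lambda>m. mid (d (pv m)) (d m))"
proof -
  have M: "M c d \<longleftrightarrow> (\<forall>m<r. R (d (pv m)) (c m) \<and> R (c m) (d m))" for c
  proof
    assume L: "M c d"
    show "\<forall>m<r. R (d (pv m)) (c m) \<and> R (c m) (d m)"
    proof (intro allI impI conjI)
      fix m assume m: "m < r"
      show "R (c m) (d m)" using L m by (simp add: M_def)
      have "R (d (pv m)) (c (nx (pv m)))" using L nx_pv(2)[OF m] unfolding M_def by blast
      then show "R (d (pv m)) (c m)" by (simp only: nx_pv(3)[OF m])
    qed
  next
    assume L: "\<forall>m<r. R (d (pv m)) (c m) \<and> R (c m) (d m)"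
    show "M c d"
      unfolding M_def
    proof (intro allI impI conjI)
      fix m assume m: "m < r"
      show "R (c m) (d m)" using L m by simp
      have "R (d (pv (nx m))) (c (nx m))" using L nx_pv(1)[OF m] by blast
      then show "R (d m) (c (nx m))" by (simp only: nx_pv(4)[OF m])
    qed
  qed
  show ?thesis
  proof (rule set_eqI)
    fix c
    show "c \<in> {c \<in> Col. M c d} \<longleftrightarrow> c \<in> PiE {..<r} (\<lambda>m. mid (d (pv m)) (d m))"
      unfolding M mid_def PiE_iff mem_Collect_eq Ball_def lessThan_iff by blast
  qed
qed

lemma card_M_left: "card {d \<in> Col. M c d} = Dl c"
  by (simp add: M_left card_PiE Dl_def)

lemma card_M_right: "card {c \<in> Col. M c d} = Dr d"
  by (simp add: M_right card_PiE Dr_def)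

lemma okM_left: "okM c d \<Longrightarrow> m < r \<Longrightarrow> ok (c m) (d m) (c (nx m))"
  by (simp add: okM_def)

lemma okM_right: "okM c d \<Longrightarrow> m < r \<Longrightarrow> ok (d (pv m)) (c m) (d m)"
  using nx_pv(2)[of m] nx_pv(3)[of m] by (auto simp: okM_def)

lemma share_left:
  assumes "m < r"
  shows "real (card {d \<in> Col. M c d \<and> okM c d \<and> role b (d m) = w}) \<le> \<kappa> * Dl c"
proof -
  have "real (card {d \<in> {d \<in> Col. M c d \<and> okM c d}. role b (d m) = w}) \<le> \<kappa> * (\<Prod>m<r. card (mid (c m) (c (nx m))))"
  proof (rule card_PiE_fix_one[where ok = "\<lambda>m f. ok (c m) f (c (nx m))"])
    show "{d \<in> Col. M c d \<and> okM c d} \<subseteq> PiE {..<r} (\<lambda>m. mid (c m) (c (nx m)))"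
      using M_left by blast
  qed (use assms kappa_nonneg finite_mid okM_left in \<open>auto simp: ok_def\<close>)
  then show ?thesis by (simp add: Dl_def)
qed

lemma share_right:
  assumes "m < r"
  shows "real (card {c \<in> Col. M c d \<and> okM c d \<and> role b (c m) = w}) \<le> \<kappa> * Dr d"
proof -
  have "real (card {c \<in> {c \<in> Col. M c d \<and> okM c d}. role b (c m) = w}) \<le> \<kappa> * (\<Prod>m<r. card (mid (d (pv m)) (d m)))"
  proof (rule card_PiE_fix_one[where ok = "\<lambda>m f. ok (d (pv m)) f (d m)"])
    show "{c \<in> Col. M c d \<and> okM c d} \<subseteq> PiE {..<r} (\<lambda>m. mid (d (pv m)) (d m))"
      using M_right by blast
  qed (use assms kappa_nonneg finite_mid okM_right in \<open>auto simp: ok_def\<close>)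
  then show ?thesis by (simp add: Dr_def)
qed

lemma coincide_left:
  assumes "m < r" "m' < r" "m \<noteq> m'"
  shows "real (card {d \<in> Col. M c d \<and> okM c d \<and> role b (d m) = role b' (d m')}) \<le> \<kappa> * Dl c"
proof -
  have "real (card {d \<in> {d \<in> Col. M c d \<and> okM c d}. role b (d m) = role b' (d m')}) \<le> \<kappa> * (\<Prod>m<r. card (mid (c m) (c (nx m))))"
  proof (rule card_PiE_coincide[where ok = "\<lambda>m f. ok (c m) f (c (nx m))"])
    show "{d \<in> Col. M c d \<and> okM c d} \<subseteq> PiE {..<r} (\<lambda>m. mid (c m) (c (nx m)))"
      using M_left by blast
  qed (use assms kappa_nonneg finite_mid okM_left in \<open>auto simp: ok_def\<close>)
  then show ?thesis by (simp add: Dl_def)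
qed

lemma coincide_right:
  assumes "m < r" "m' < r" "m \<noteq> m'"
  shows "real (card {c \<in> Col. M c d \<and> okM c d \<and> role b (c m) = role b' (c m')}) \<le> \<kappa> * Dr d"
proof -
  have "real (card {c \<in> {c \<in> Col. M c d \<and> okM c d}. role b (c m) = role b' (c m')}) \<le> \<kappa> * (\<Prod>m<r. card (mid (d (pv m)) (d m)))"
  proof (rule card_PiE_coincide[where ok = "\<lambda>m f. ok (d (pv m)) f (d m)"])
    show "{c \<in> Col. M c d \<and> okM c d} \<subseteq> PiE {..<r} (\<lambda>m. mid (d (pv m)) (d m))"
      using M_right by blast
  qed (use assms kappa_nonneg finite_mid okM_right in \<open>auto simp: ok_def\<close>)
  then show ?thesis by (simp add: Dr_def)
qed

section \<open>Counting degenerate columns and pairs that fail \<open>okM\<close>\<close>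

abbreviation slots :: "((nat \<times> bool) \<times> nat \<times> bool) set" where
  "slots \<equiv> ({..<r} \<times> UNIV) \<times> ({..<r} \<times> UNIV)"

lemma card_slots: "card slots = 4 * r\<^sup>2"
  by (simp add: card_cartesian_product power2_eq_square)

lemma card_UN_slots:
  fixes t :: real
  assumes "finite S" "\<And>p. p \<in> slots \<Longrightarrow> real (card (A p)) \<le> t" "S \<subseteq> (\<Union>p\<in>slots. A p)"
    "\<And>p. p \<in> slots \<Longrightarrow> finite (A p)"
  shows "real (card S) \<le> 4 * r\<^sup>2 * t"
proof -
  have "card S \<le> card (\<Union>p\<in>slots. A p)"
    by (rule card_mono) (use assms in auto)
  also have "\<dots> \<le> (\<Sum>p\<in>slots. card (A p))" by (rule card_UN_le) auto
  finally have "real (card S) \<le> (\<Sum>p\<in>slots. real (card (A p)))"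
    unfolding of_nat_sum[symmetric] by (simp only: of_nat_le_iff)
  also have "\<dots> \<le> (\<Sum>p\<in>slots. t)" by (rule sum_mono) (rule assms(2))
  also have "\<dots> = real (card slots) * t" by (simp only: sum_constant)
  also have "\<dots> = 4 * r\<^sup>2 * t" unfolding card_slots by simp
  finally show ?thesis .
qed

lemma card_degenerate:
  fixes t :: real
  assumes "finite T" "t \<ge> 0"
    and bound: "\<And>m m' b b'. m < r \<Longrightarrow> m' < r \<Longrightarrow> m \<noteq> m' \<Longrightarrow>
      real (card {d \<in> T. role b (d m) = role b' (d m')}) \<le> t"
  shows "real (card {d \<in> T. \<not> nondeg d}) \<le> 4 * r\<^sup>2 * t"
proof (rule card_UN_slots)
  \<comment> \<open>\<open>slots\<close> also contains pairs with equal index; the condition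
    \<open>m \<noteq> m'\<close> empties the sets that belong to them.\<close>
  let ?A = "\<lambda>((m, b), (m', b')). {d \<in> T. m \<noteq> m' \<and> role b (d m) = role b' (d m')}"
  show "{d \<in> T. \<not> nondeg d} \<subseteq> (\<Union>p\<in>slots. ?A p)"
  proof
    fix d assume d: "d \<in> {d \<in> T. \<not> nondeg d}"
    then obtain m m' b b' where "m < r" "m' < r" "m \<noteq> m'" "role b (d m) = role b' (d m')"
      unfolding nondeg_def by blast
    then have "((m, b), (m', b')) \<in> slots" "d \<in> ?A ((m, b), (m', b'))" using d by auto
    then show "d \<in> (\<Union>p\<in>slots. ?A p)" by blast
  qed
  show "real (card (?A p)) \<le> t" if p: "p \<in> slots" for p
  proof -
    obtain m b m' b' where p': "p = ((m, b), (m', b'))" by (metis surj_pair)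
    show ?thesis using bound[of m m' b b'] p p' \<open>t \<ge> 0\<close> by (cases "m = m'") auto
  qed
qed (use assms in \<open>auto simp: case_prod_unfold\<close>)

lemma degenerate_left: "real (card {d \<in> Col. M c d \<and> okM c d \<and> \<not> nondeg d}) \<le> 4 * r\<^sup>2 * (\<kappa> * Dl c)"
  using card_degenerate[of "{d \<in> Col. M c d \<and> okM c d}" "\<kappa> * Dl c"] coincide_left finite_Col kappa_nonneg
  by simp

lemma degenerate_right: "real (card {c \<in> Col. M c d \<and> okM c d \<and> \<not> nondeg c}) \<le> 4 * r\<^sup>2 * (\<kappa> * Dr d)"
  using card_degenerate[of "{c \<in> Col. M c d \<and> okM c d}" "\<kappa> * Dr d"] coincide_right finite_Col kappa_nonneg
  by simp

lemma cw_weave: "cw Rk (weave r c d) = of_bool (M c d)"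
proof -
  have ne: "weave r c d \<noteq> []" using length_weave[of r c d] r2 by auto
  show ?thesis unfolding cw_of_bool[OF ne] length_weave all_less_double
    by (auto simp: M_def nth_weave nth_weave[simplified])
qed

lemma sum_M: "(\<Sum>c\<in>Col. \<Sum>d\<in>Col. of_bool (M c d)) = ktr EE Rk (2 * r)"
  using sum_cw[OF finEE, of "2 * r" Rk] r2 by (simp add: sum_wl_weave cw_weave)

lemma sum_Dl: "(\<Sum>c\<in>Col. real (Dl c)) = ktr EE Rk (2 * r)"
proof -
  have "real (Dl c) = (\<Sum>d\<in>Col. of_bool (M c d))" for c
    using card_M_left[of c] finite_Col by (simp add: of_bool_def sum.If_cases Int_def)
  then show ?thesis using sum_M by simp
qed

lemma sum_Dr: "(\<Sum>d\<in>Col. real (Dr d)) = ktr EE Rk (2 * r)"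
proof -
  have "real (Dr d) = (\<Sum>c\<in>Col. of_bool (M c d))" for d
    using card_M_right[of d] finite_Col by (simp add: of_bool_def sum.If_cases Int_def)
  then have "(\<Sum>d\<in>Col. real (Dr d)) = (\<Sum>d\<in>Col. \<Sum>c\<in>Col. of_bool (M c d))" by simp
  also have "\<dots> = (\<Sum>c\<in>Col. \<Sum>d\<in>Col. of_bool (M c d))" by (rule sum.swap)
  finally show ?thesis using sum_M by simp
qed

text \<open>The number of closed walks of length \<open>2 * r\<close> in \<open>R\<close> whose
  first three entries violate \<open>ok\<close>, split into two steps and a return walk.\<close>

definition bad_weight :: real where
  "bad_weight = (\<Sum>e\<in>EE. \<Sum>f\<in>EE. \<Sum>g\<in>EE. of_bool (\<not> ok e f g) * Rk e f * Rk f g * kpow EE Rk (2 * r - 2) g e)"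

text \<open>A woven walk has \<open>2 * r\<close> windows of three consecutive entries; by rotation,
  the walks failing at any given window number \<open>bad_weight\<close>.\<close>

lemma sum_not_okM: "(\<Sum>c\<in>Col. \<Sum>d\<in>Col. of_bool (M c d \<and> \<not> okM c d)) \<le> 2 * r * bad_weight"
proof -
  let ?\<psi> = "\<lambda>xs i. of_bool (\<not> ok (xs ! i) (xs ! (Suc i mod (2 * r))) (xs ! (Suc (Suc i) mod (2 * r)))) :: real"
  have "of_bool (M c d \<and> \<not> okM c d) \<le> (\<Sum>i<2*r. ?\<psi> (weave r c d) i * cw Rk (weave r c d))"
    if "c \<in> Col" "d \<in> Col" for c d
  proof (cases "M c d \<and> \<not> okM c d")
    case True
    then obtain m where m: "m < r" "\<not> ok (c m) (d m) (c (nx m)) \<or> \<not> ok (d m) (c (nx m)) (d (nx m))"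
      by (auto simp: okM_def)
    have "\<exists>i<2*r. ?\<psi> (weave r c d) i = 1"
      using m(2)
    proof
      assume "\<not> ok (c m) (d m) (c (nx m))"
      then show ?thesis using m(1) by (intro exI[of _ "2 * m"]) (simp add: nth_weave nth_weave(2)[simplified])
    next
      assume "\<not> ok (d m) (c (nx m)) (d (nx m))"
      then show ?thesis using m(1) by (intro exI[of _ "Suc (2 * m)"]) (simp add: nth_weave nth_weave(2)[simplified])
    qed
    then obtain i where i: "i < 2 * r" "?\<psi> (weave r c d) i = 1" by blast
    have "?\<psi> (weave r c d) i \<le> (\<Sum>i<2*r. ?\<psi> (weave r c d) i)"
      by (rule member_le_sum) (use i in auto)
    then show ?thesis using True i by (simp add: cw_weave)
  qed (auto intro!: sum_nonneg simp: cw_weave)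
  then have "(\<Sum>c\<in>Col. \<Sum>d\<in>Col. of_bool (M c d \<and> \<not> okM c d))
      \<le> (\<Sum>c\<in>Col. \<Sum>d\<in>Col. \<Sum>i<2*r. ?\<psi> (weave r c d) i * cw Rk (weave r c d))" by (intro sum_mono)
  also have "\<dots> = (\<Sum>xs\<in>wl EE (2 * r). \<Sum>i<2*r. ?\<psi> xs i * cw Rk xs)" by (rule sum_wl_weave[symmetric])
  also have "\<dots> = (\<Sum>i<2*r. \<Sum>xs\<in>wl EE (2 * r). ?\<psi> xs i * cw Rk xs)" by (rule sum.swap)
  also have "\<dots> = (\<Sum>i<2*r. bad_weight)"
    unfolding bad_weight_def
    by (intro sum.cong refl sum_cw_window[where \<psi> = "\<lambda>e f g. of_bool (\<not> ok e f g)"]) (use finEE r2 in auto)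
  finally show ?thesis by simp
qed

text \<open>Of the pairs related by \<open>M\<close>, at most one half fail \<open>okM\<close>, and
  each of the two kinds of degeneracy takes at most another eighth.\<close>

lemma sum_G:
  assumes bad: "4 * r * bad_weight \<le> ktr EE Rk (2 * r)" and small: "32 * r\<^sup>2 * \<kappa> \<le> 1"
  shows "ktr EE Rk (2 * r) / 4 \<le> (\<Sum>c\<in>Col. \<Sum>d\<in>Col. of_bool (G c d))"
proof -
  let ?t = "ktr EE Rk (2 * r)"
  let ?L = "\<Sum>c\<in>Col. \<Sum>d\<in>Col. of_bool (M c d \<and> okM c d \<and> \<not> nondeg d) :: real"
  let ?R = "\<Sum>c\<in>Col. \<Sum>d\<in>Col. of_bool (M c d \<and> okM c d \<and> \<not> nondeg c) :: real"
  have "?t \<ge> 0" unfolding sum_Dl[symmetric] by (simp add: sum_nonneg)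
  have cnt: "(\<Sum>d\<in>Col. of_bool (Q d)) = real (card {d \<in> Col. Q d})" for Q
    using finite_Col by (simp add: of_bool_def sum.If_cases Int_def)
  have "?L \<le> (\<Sum>c\<in>Col. 4 * r\<^sup>2 * (\<kappa> * Dl c))"
    unfolding cnt by (intro sum_mono degenerate_left)
  then have L: "?L \<le> 4 * r\<^sup>2 * \<kappa> * ?t" by (simp add: sum_distrib_left[symmetric] sum_Dl mult.assoc)
  have "?R = (\<Sum>d\<in>Col. \<Sum>c\<in>Col. of_bool (M c d \<and> okM c d \<and> \<not> nondeg c))" by (rule sum.swap)
  also have "\<dots> \<le> (\<Sum>d\<in>Col. 4 * r\<^sup>2 * (\<kappa> * Dr d))"
    unfolding cnt by (intro sum_mono degenerate_right)
  finally have R: "?R \<le> 4 * r\<^sup>2 * \<kappa> * ?t" by (simp add: sum_distrib_left[symmetric] sum_Dr mult.assoc)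
  have "?t = (\<Sum>c\<in>Col. \<Sum>d\<in>Col. of_bool (M c d))" by (rule sum_M[symmetric])
  also have "\<dots> \<le> (\<Sum>c\<in>Col. \<Sum>d\<in>Col. of_bool (G c d) + of_bool (M c d \<and> \<not> okM c d)
      + of_bool (M c d \<and> okM c d \<and> \<not> nondeg d) + of_bool (M c d \<and> okM c d \<and> \<not> nondeg c))"
    by (intro sum_mono) (auto simp: G_def)
  also have "\<dots> = (\<Sum>c\<in>Col. \<Sum>d\<in>Col. of_bool (G c d)) + (\<Sum>c\<in>Col. \<Sum>d\<in>Col. of_bool (M c d \<and> \<not> okM c d)) + ?L + ?R"
    by (simp only: sum.distrib)
  finally have "?t \<le> (\<Sum>c\<in>Col. \<Sum>d\<in>Col. of_bool (G c d)) + 2 * r * bad_weight + 8 * r\<^sup>2 * \<kappa> * ?t"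
    using L R sum_not_okM by linarith
  moreover have "2 * r * bad_weight \<le> ?t / 2" using bad by simp
  moreover have "32 * r\<^sup>2 * \<kappa> * ?t \<le> 1 * ?t" by (rule mult_right_mono[OF small \<open>?t \<ge> 0\<close>])
  ultimately show ?thesis by linarith
qed

text \<open>\<open>M\<close> is directed: \<open>c m\<close> precedes \<open>d m\<close>, which
  precedes the next entry of \<open>c\<close>. Two copies of the set of columns, told apart by the
  flag, turn \<open>G\<close> into an undirected bipartite graph.\<close>

definition E :: "bool \<times> (nat \<Rightarrow> 'v \<times> 'v) \<Rightarrow> bool \<times> (nat \<Rightarrow> 'v \<times> 'v) \<Rightarrow> bool" where
  "E x y \<longleftrightarrow> fst x \<noteq> fst y \<and> (if fst x then G (snd y) (snd x) else G (snd x) (snd y))"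

text \<open>Degrees in \<open>M\<close> and not in \<open>G\<close>, because the share bounds are
  relative to these. By \<open>sum_G\<close> the graph still has at least a quarter of the edges
  that these degrees would allow.\<close>

definition D :: "bool \<times> (nat \<Rightarrow> 'v \<times> 'v) \<Rightarrow> real" where
  "D x = (if fst x then Dr (snd x) else Dl (snd x))"

definition meet :: "bool \<times> (nat \<Rightarrow> 'v \<times> 'v) \<Rightarrow> bool \<times> (nat \<Rightarrow> 'v \<times> 'v) \<Rightarrow> bool" where
  "meet x y \<longleftrightarrow> (\<exists>m<r. \<exists>m'<r. \<exists>b b'. role b (snd x m) = role b' (snd y m'))"

lemma E_neighbours:
  "{y \<in> UNIV \<times> Col. E (False, c) y \<and> Q y} = Pair True ` {d \<in> Col. G c d \<and> Q (True, d)}"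
  "{y \<in> UNIV \<times> Col. E (True, d) y \<and> Q y} = Pair False ` {c \<in> Col. G c d \<and> Q (False, c)}"
  by (rule set_eqI, case_tac x, case_tac a; simp add: E_def image_iff)+

lemma card_E_neighbours:
  "card {y \<in> UNIV \<times> Col. E (False, c) y \<and> Q y} = card {d \<in> Col. G c d \<and> Q (True, d)}"
  "card {y \<in> UNIV \<times> Col. E (True, d) y \<and> Q y} = card {c \<in> Col. G c d \<and> Q (False, c)}"
  unfolding E_neighbours by (simp_all add: card_image inj_on_def)

lemma weighted_graph: "weighted_graph (UNIV \<times> Col) E D"
proof
  show "finite ((UNIV :: bool set) \<times> Col)" using finite_Col by simp
  show "E y x" if "E x y" for x y using that by (auto simp: E_def split: if_splits)
  show "real (card {y \<in> UNIV \<times> Col. E x y}) \<le> D x" if x: "x \<in> UNIV \<times> Col" for x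
  proof (cases x)
    case (Pair s c)
    show ?thesis
    proof (cases s)
      case True
      have "card {c' \<in> Col. G c' c} \<le> card {c' \<in> Col. M c' c}"
        by (rule card_mono) (use finite_Col in \<open>auto simp: G_def\<close>)
      then show ?thesis using card_E_neighbours(2)[of c "\<lambda>_. True"] card_M_right[of c] Pair True x by (simp add: D_def)
    next
      case False
      have "card {d \<in> Col. G c d} \<le> card {d \<in> Col. M c d}"
        by (rule card_mono) (use finite_Col in \<open>auto simp: G_def\<close>)
      then show ?thesis using card_E_neighbours(1)[of c "\<lambda>_. True"] card_M_left[of c] Pair False x by (simp add: D_def)
    qed
  qed
qed

lemma card_meet:
  fixes t :: real
  assumes "finite T" and bound: "\<And>m b w. m < r \<Longrightarrow> real (card {d \<in> T. role b (d m) = w}) \<le> t"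
  shows "real (card {d \<in> T. meet (s, d) y}) \<le> 4 * r\<^sup>2 * t"
proof (rule card_UN_slots)
  let ?A = "\<lambda>((m, b), (m', b')). {d \<in> T. role b (d m) = role b' (snd y m')}"
  show "{d \<in> T. meet (s, d) y} \<subseteq> (\<Union>p\<in>slots. ?A p)"
  proof
    fix d assume d: "d \<in> {d \<in> T. meet (s, d) y}"
    then obtain m m' b b' where "m < r" "m' < r" "role b (d m) = role b' (snd y m')"
      unfolding meet_def by auto
    then have "((m, b), (m', b')) \<in> slots" "d \<in> ?A ((m, b), (m', b'))" using d by auto
    then show "d \<in> (\<Union>p\<in>slots. ?A p)" by blast
  qed
qed (use assms in \<open>auto simp: case_prod_unfold\<close>)

lemma meet_bound: "real (card {z \<in> UNIV \<times> Col. E x z \<and> meet z y}) \<le> 4 * r\<^sup>2 * \<kappa> * D x"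
proof (cases x)
  case (Pair s c)
  show ?thesis
  proof (cases s)
    case False
    have "card {d \<in> Col. G c d \<and> meet (True, d) y} \<le> card {d \<in> {d \<in> Col. M c d \<and> okM c d}. meet (True, d) y}"
      by (rule card_mono) (use finite_Col in \<open>auto simp: G_def\<close>)
    also have "real \<dots> \<le> 4 * r\<^sup>2 * (\<kappa> * Dl c)" by (rule card_meet) (use share_left finite_Col in auto)
    finally show ?thesis using card_E_neighbours(1)[of c "\<lambda>z. meet z y"] Pair False by (simp add: D_def mult.assoc)
  next
    case True
    have "card {d \<in> Col. G d c \<and> meet (False, d) y} \<le> card {d \<in> {d \<in> Col. M d c \<and> okM d c}. meet (False, d) y}"
      by (rule card_mono) (use finite_Col in \<open>auto simp: G_def\<close>)
    also have "real \<dots> \<le> 4 * r\<^sup>2 * (\<kappa> * Dr c)" by (rule card_meet) (use share_right finite_Col in auto)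
    finally show ?thesis using card_E_neighbours(2)[of c "\<lambda>z. meet z y"] Pair True by (simp add: D_def mult.assoc)
  qed
qed

text \<open>The closed-walk theorem for the conflict relation \<open>meet\<close>, with density 1/4
  and share \<open>4 * r\<^sup>2 * \<kappa>\<close>, one \<open>\<kappa>\<close> for each pair of
  slots. The two copies of the columns give the factor 2.\<close>

lemma column_walk:
  assumes pos: "ktr EE Rk (2 * r) > 0"
    and bad: "4 * r * bad_weight \<le> ktr EE Rk (2 * r)" and small: "32 * r\<^sup>2 * \<kappa> \<le> 1"
    and l: "l \<ge> 1"
    and tiny: "(16 * real l ^ 4 * (4 * r\<^sup>2 * \<kappa>)) ^ l * (2 * real (card EE) ^ r) < (1/4) ^ (2 * l)"
  shows "\<exists>zs. set zs \<subseteq> UNIV \<times> Col \<and> length zs = 2 * l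
    \<and> (\<forall>i<2*l. E (zs ! i) (zs ! (Suc i mod (2 * l))))
    \<and> (\<forall>i j. i < j \<longrightarrow> j < 2 * l \<longrightarrow> \<not> meet (zs ! i) (zs ! j))"
proof -
  interpret wg: weighted_graph "UNIV \<times> Col" E D by (rule weighted_graph)
  have split: "(\<Sum>x\<in>UNIV \<times> Col. f x) = (\<Sum>c\<in>Col. f (False, c)) + (\<Sum>c\<in>Col. f (True, c))" for f :: "_ \<Rightarrow> real"
  proof -
    have "(UNIV :: bool set) \<times> Col = Pair False ` Col \<union> Pair True ` Col"
      unfolding UNIV_bool by blast
    moreover have "(\<Sum>x\<in>Pair False ` Col \<union> Pair True ` Col. f x) = (\<Sum>x\<in>Pair False ` Col. f x) + (\<Sum>x\<in>Pair True ` Col. f x)"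
      by (rule sum.union_disjoint) (use finite_Col in auto)
    ultimately show ?thesis by (simp add: sum.reindex inj_on_def)
  qed
  have sumD: "(\<Sum>x\<in>UNIV \<times> Col. D x) = 2 * ktr EE Rk (2 * r)"
    unfolding split by (simp add: D_def sum_Dl sum_Dr)
  have cnt: "(\<Sum>d\<in>Col. of_bool (Q d)) = real (card {d \<in> Col. Q d})" for Q
    using finite_Col by (simp add: of_bool_def sum.If_cases Int_def)
  have "(\<Sum>x\<in>UNIV \<times> Col. real (card {y \<in> UNIV \<times> Col. E x y}))
      = (\<Sum>c\<in>Col. \<Sum>d\<in>Col. of_bool (G c d)) + (\<Sum>d\<in>Col. \<Sum>c\<in>Col. of_bool (G c d))"
    unfolding split cnt using card_E_neighbours[of _ "\<lambda>_. True"] by simp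
  also have "(\<Sum>d\<in>Col. \<Sum>c\<in>Col. of_bool (G c d) :: real) = (\<Sum>c\<in>Col. \<Sum>d\<in>Col. of_bool (G c d))"
    by (rule sum.swap)
  finally have sumE: "1 / 4 * (\<Sum>x\<in>UNIV \<times> Col. D x) \<le> (\<Sum>x\<in>UNIV \<times> Col. real (card {y \<in> UNIV \<times> Col. E x y}))"
    unfolding sumD using sum_G[OF bad small] by linarith
  have "card ((UNIV :: bool set) \<times> Col) = 2 * card EE ^ r"
    by (simp add: card_cartesian_product card_PiE)
  then have tiny': "(16 * real l ^ 4 * (4 * r\<^sup>2 * \<kappa>)) ^ l * real (card ((UNIV :: bool set) \<times> Col)) < (1/4) ^ (2 * l)"
    using tiny by simp
  show ?thesis
  proof (rule wg.conflict_free_closed_walk[OF _ _ sumE _ _ _ l tiny'])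
    show "meet y x" if "meet x y" for x y using that unfolding meet_def by metis
  qed (use sumD pos meet_bound kappa_nonneg in auto)
qed

end

section \<open>From closed walks of columns to the target graph\<close>

text \<open>Position of the vertex \<open>x\<^bsub>a,j\<^esub>\<close> inside a column: the rows run along the first half of the closed
  walk and back along its second half, so that every row owns one even and one odd edge of the walk.
  The flag \<^term>\<open>s\<close> tells whether the column consists of the odd edges.\<close>

definition slot :: "nat \<Rightarrow> bool \<Rightarrow> nat \<Rightarrow> nat \<times> bool" where
  "slot k s a = (let q = (a - 1) div 4; t = (a - 1) mod 4 in
     if s = (t \<ge> 2) then (q, even t) else (2 * k - 1 - q, odd t))"

definition vert :: "nat \<Rightarrow> bool \<times> (nat \<Rightarrow> 'v \<times> 'v) \<Rightarrow> nat \<Rightarrow> 'v" where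
  "vert k x a = role (snd (slot k (fst x) a)) (snd x (fst (slot k (fst x) a)))"

lemma slot_simps:
  "slot k s (4 * q + 1) = (if s then (2 * k - 1 - q, False) else (q, True))"
  "slot k s (4 * q + 2) = (if s then (2 * k - 1 - q, True) else (q, False))"
  "slot k s (4 * q + 3) = (if s then (q, True) else (2 * k - 1 - q, False))"
  "slot k s (4 * q + 4) = (if s then (q, False) else (2 * k - 1 - q, True))"
proof -
  have dm: "(4 * q + j) div 4 = q" "(4 * q + j) mod 4 = j" if "j < 4" for j
    using that by simp_all
  have "(4 * q + 1 - 1) div 4 = q" "(4 * q + 1 - 1) mod 4 = 0"
    "(4 * q + 2 - 1) div 4 = q" "(4 * q + 2 - 1) mod 4 = 1"
    "(4 * q + 3 - 1) div 4 = q" "(4 * q + 3 - 1) mod 4 = 2"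
    "(4 * q + 4 - 1) div 4 = q" "(4 * q + 4 - 1) mod 4 = 3"
    using dm[of 0] dm[of 1] dm[of 2] dm[of 3] by simp_all
  note * = this
  show "slot k s (4 * q + 1) = (if s then (2 * k - 1 - q, False) else (q, True))"
    "slot k s (4 * q + 2) = (if s then (2 * k - 1 - q, True) else (q, False))"
    "slot k s (4 * q + 3) = (if s then (q, True) else (2 * k - 1 - q, False))"
    "slot k s (4 * q + 4) = (if s then (q, False) else (2 * k - 1 - q, True))"
    unfolding slot_def Let_def * by auto
qed

lemma row_cases:
  fixes a k :: nat
  assumes "1 \<le> a" "a \<le> 4 * k"
  obtains q where "q < k" "a = 4 * q + 1" | q where "q < k" "a = 4 * q + 2"
    | q where "q < k" "a = 4 * q + 3" | q where "q < k" "a = 4 * q + 4"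
proof -
  define q where "q = (a - 1) div 4"
  have "q < k" using assms by (auto simp: q_def)
  moreover have "a = 4 * q + 1 \<or> a = 4 * q + 2 \<or> a = 4 * q + 3 \<or> a = 4 * q + 4"
    using assms unfolding q_def by presburger
  ultimately show ?thesis using that by blast
qed

lemma slot_less: "1 \<le> a \<Longrightarrow> a \<le> 4 * k \<Longrightarrow> fst (slot k s a) < 2 * k"
  by (erule (1) row_cases) (auto simp: slot_simps slot_simps[simplified])

lemma slot_inj:
  assumes "1 \<le> a" "a \<le> 4 * k" "1 \<le> a'" "a' \<le> 4 * k" "slot k s a = slot k s a'"
  shows "a = a'"
  using assms(1,2)
proof (cases rule: row_cases)
  case (1 q)
  show ?thesis using assms(3,4) by (cases rule: row_cases) (use assms(5) 1 slot_simps in \<open>auto split: if_splits simp: slot_simps slot_simps[simplified]\<close>)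
next
  case (2 q)
  show ?thesis using assms(3,4) by (cases rule: row_cases) (use assms(5) 2 slot_simps in \<open>auto split: if_splits simp: slot_simps slot_simps[simplified]\<close>)
next
  case (3 q)
  show ?thesis using assms(3,4) by (cases rule: row_cases) (use assms(5) 3 slot_simps in \<open>auto split: if_splits simp: slot_simps slot_simps[simplified]\<close>)
next
  case (4 q)
  show ?thesis using assms(3,4) by (cases rule: row_cases) (use assms(5) 4 slot_simps in \<open>auto split: if_splits simp: slot_simps slot_simps[simplified]\<close>)
qed

locale edge_links_in_graph = edge_links EE R \<kappa> "2 * k"
  for EE :: "('v \<times> 'v) set" and R and \<kappa> and k +
  fixes VG :: "'v set" and EG :: "'v set set"
  assumes edge: "\<And>e. e \<in> EE \<Longrightarrow> fst e \<in> VG \<and> snd e \<in> VG \<and> fst e \<noteq> snd e \<and> {fst e, snd e} \<in> EG"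
    and link: "\<And>e f. e \<in> EE \<Longrightarrow> f \<in> EE \<Longrightarrow> R e f \<Longrightarrow> {snd e, fst f} \<in> EG"
begin

lemma k1: "k \<ge> 1"
  using r2 by simp

text \<open>The walk \<open>c 0\<close>, \<open>d 0\<close>, \<open>c 1\<close>, ... climbs the
  rows, changing columns after every entry, crosses over in row \<open>4 * k\<close>, and descends
  through the remaining slots. Each link of the walk is one edge of the target graph between the two
  columns.\<close>

lemma vert_G:
  assumes c: "c \<in> Col" and d: "d \<in> Col" and G: "G c d"
  shows "{vert k (False, c) 1, vert k (True, d) 1} \<in> EG"
    and "{vert k (False, c) (4 * k), vert k (True, d) (4 * k)} \<in> EG"
    and "1 \<le> i \<Longrightarrow> i \<le> 2 * k - 1 \<Longrightarrow> {vert k (False, c) (2 * i), vert k (True, d) (2 * i + 1)} \<in> EG"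
    and "1 \<le> i \<Longrightarrow> i \<le> 2 * k - 1 \<Longrightarrow> {vert k (False, c) (2 * i + 1), vert k (True, d) (2 * i)} \<in> EG"
proof -
  have inEE: "c m \<in> EE" "d m \<in> EE" if "m < 2 * k" for m using that c d by (auto simp: PiE_iff)
  have cd: "{snd (c m), fst (d m)} \<in> EG" if "m < 2 * k" for m
    using that G inEE link unfolding G_def M_def by blast
  have dc: "{snd (d m), fst (c (nx m))} \<in> EG" if "m < 2 * k" for m
    using that G inEE(2)[OF that] inEE(1)[OF nx_pv(1)[OF that]] link unfolding G_def M_def by blast
  have dc': "{fst (c n), snd (d m)} \<in> EG" if "n = Suc m" "n < 2 * k" for n m
    using dc[of m] that by (simp add: insert_commute)
  \<comment> \<open>The closing link, from index \<open>2 * k - 1\<close> back to index 0, joins the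
    two vertices of row 1.\<close>
  show "{vert k (False, c) 1, vert k (True, d) 1} \<in> EG"
    using dc[of "2 * k - 1"] k1 slot_simps(1)[of k _ 0] by (simp add: vert_def role_def insert_commute)
  \<comment> \<open>The turning point: \<open>d (k - 1)\<close> ends and \<open>c k\<close> starts
    in row \<open>4 * k\<close>.\<close>
  have "4 * k = 4 * (k - 1) + 4" using k1 by simp
  then have "slot k s (4 * k) = (if s then (k - 1, False) else (k, True))" for s
    using slot_simps(4)[of k s "k - 1"] k1 by simp
  then show "{vert k (False, c) (4 * k), vert k (True, d) (4 * k)} \<in> EG"
    using dc'[of k "k - 1"] k1 by (simp add: vert_def role_def)
  show "{vert k (False, c) (2 * i), vert k (True, d) (2 * i + 1)} \<in> EG"
    and "{vert k (False, c) (2 * i + 1), vert k (True, d) (2 * i)} \<in> EG"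
    if i: "1 \<le> i" "i \<le> 2 * k - 1"
  proof -
    have "(\<exists>q. i = 2 * q + 1) \<or> (\<exists>q. i = 2 * q + 2)" using i by presburger
    then obtain q where "i = 2 * q + 1 \<or> i = 2 * q + 2" by blast
    then have "{vert k (False, c) (2 * i), vert k (True, d) (2 * i + 1)} \<in> EG
      \<and> {vert k (False, c) (2 * i + 1), vert k (True, d) (2 * i)} \<in> EG"
    proof
      assume q: "i = 2 * q + 1"
      then have "2 * i = 4 * q + 2" "2 * i + 1 = 4 * q + 3" "q < 2 * k" using i by auto
      note ** = this(1,2)
      have *: "slot k s (2 * i) = (if s then (2 * k - 1 - q, True) else (q, False))"
        "slot k s (2 * i + 1) = (if s then (q, True) else (2 * k - 1 - q, False))" for s
        by (simp_all only: **(1) slot_simps(2)) (simp only: **(1)[symmetric] **(2) slot_simps(3))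
      from \<open>q < 2 * k\<close> show ?thesis unfolding vert_def * fst_conv
        using cd[of q] cd[of "2 * k - 1 - q"] by (simp add: role_def)
    next
      assume q: "i = 2 * q + 2"
      then have "2 * i = 4 * q + 4" "2 * i + 1 = 4 * (q + 1) + 1" "q + 1 < k" using i by auto
      note ** = this(1,2)
      have *: "slot k s (2 * i) = (if s then (q, False) else (2 * k - 1 - q, True))"
        "slot k s (2 * i + 1) = (if s then (2 * k - 1 - (q + 1), False) else (q + 1, True))" for s
        by (simp_all only: **(1) slot_simps(4)) (simp only: **(1)[symmetric] **(2) slot_simps(1))
      have "{fst (c (2 * k - 1 - q)), snd (d (2 * k - 1 - (q + 1)))} \<in> EG" "{fst (c (q + 1)), snd (d q)} \<in> EG"
        by (rule dc'; use \<open>q + 1 < k\<close> in simp)+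
      then show ?thesis unfolding vert_def * fst_conv by (simp add: role_def)
    qed
    then show "{vert k (False, c) (2 * i), vert k (True, d) (2 * i + 1)} \<in> EG"
      and "{vert k (False, c) (2 * i + 1), vert k (True, d) (2 * i)} \<in> EG" by auto
  qed
qed

text \<open>Between adjacent columns the target graph contains both families of diagonals, so it
  does not matter which of the two columns carries the flag \<open>False\<close>.\<close>

lemma vert_E:
  assumes "x \<in> UNIV \<times> Col" "y \<in> UNIV \<times> Col" "E x y"
  shows "{vert k x 1, vert k y 1} \<in> EG"
    and "{vert k x (4 * k), vert k y (4 * k)} \<in> EG"
    and "1 \<le> i \<Longrightarrow> i \<le> 2 * k - 1 \<Longrightarrow> {vert k x (2 * i), vert k y (2 * i + 1)} \<in> EG"
    and "1 \<le> i \<Longrightarrow> i \<le> 2 * k - 1 \<Longrightarrow> {vert k x (2 * i + 1), vert k y (2 * i)} \<in> EG"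
proof -
  obtain s c t d where xy: "x = (s, c)" "y = (t, d)" by (metis surj_pair)
  have cd: "c \<in> Col" "d \<in> Col" using assms xy by simp_all
  show "{vert k x 1, vert k y 1} \<in> EG"
    and "{vert k x (4 * k), vert k y (4 * k)} \<in> EG"
    and "1 \<le> i \<Longrightarrow> i \<le> 2 * k - 1 \<Longrightarrow> {vert k x (2 * i), vert k y (2 * i + 1)} \<in> EG"
    and "1 \<le> i \<Longrightarrow> i \<le> 2 * k - 1 \<Longrightarrow> {vert k x (2 * i + 1), vert k y (2 * i)} \<in> EG"
    using vert_G[OF cd] vert_G[OF cd(2,1)] assms(3)
    by (cases s; cases t; simp add: xy E_def insert_commute)+
qed

lemma contains_H:
  assumes zs: "set zs \<subseteq> UNIV \<times> Col" "length zs = 2 * l" and l: "l \<ge> 1"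
    and E: "\<And>i. i < 2 * l \<Longrightarrow> E (zs ! i) (zs ! (Suc i mod (2 * l)))"
    and nomeet: "\<And>i j. i < j \<Longrightarrow> j < 2 * l \<Longrightarrow> \<not> meet (zs ! i) (zs ! j)"
  shows "contains_copy (H_verts k l) (H_edges k l) VG EG"
proof -
  \<comment> \<open>Columns of the target graph are numbered from 1, entries of \<open>zs\<close>
    from 0.\<close>
  define f where "f p = vert k (zs ! (snd p - 1)) (fst p)" for p
  have zin: "zs ! i \<in> UNIV \<times> Col" if "i < 2 * l" for i using that zs nth_mem[of i zs] by auto
  have nd: "nondeg (snd (zs ! i))" if "i < 2 * l" for i
    using E[OF that] by (auto simp: E_def G_def split: if_splits)
  have inEE: "snd (zs ! i) m \<in> EE" if "i < 2 * l" "m < 2 * k" for i m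
  proof -
    have "snd (zs ! i) \<in> Col" using zin[OF that(1)] by (simp only: mem_Times_iff)
    then show ?thesis by (rule PiE_mem) (use that in simp)
  qed
  \<comment> \<open>Different columns do not meet; within a column \<open>nondeg\<close> separates
    different entries, and the two ends of one entry differ because it is an edge.\<close>
  have inj: "inj_on f (H_verts k l)"
  proof (rule inj_onI)
    fix p p' assume p: "p \<in> H_verts k l" "p' \<in> H_verts k l" "f p = f p'"
    obtain a j a' j' where pp: "p = (a, j)" "p' = (a', j')" by (metis surj_pair)
    have aj: "1 \<le> a" "a \<le> 4 * k" "1 \<le> j" "j \<le> 2 * l" "1 \<le> a'" "a' \<le> 4 * k" "1 \<le> j'" "j' \<le> 2 * l"
      using p by (auto simp: H_verts_def pp)
    let ?s = "slot k (fst (zs ! (j - 1))) a" and ?s' = "slot k (fst (zs ! (j' - 1))) a'"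
    have eq: "role (snd ?s) (snd (zs ! (j - 1)) (fst ?s)) = role (snd ?s') (snd (zs ! (j' - 1)) (fst ?s'))"
      using p(3) by (simp add: f_def pp vert_def)
    have lt: "fst ?s < 2 * k" "fst ?s' < 2 * k" using slot_less aj by auto
    then have "meet (zs ! (j - 1)) (zs ! (j' - 1))" "meet (zs ! (j' - 1)) (zs ! (j - 1))"
      using eq unfolding meet_def by metis+
    moreover have "j - 1 < 2 * l" "j' - 1 < 2 * l" using aj by linarith+
    ultimately have "\<not> j - 1 < j' - 1" "\<not> j' - 1 < j - 1" using nomeet by blast+
    then have j: "j = j'" using aj by simp
    have jl: "j - 1 < 2 * l" using aj by simp
    have fst_eq: "fst ?s = fst ?s'"
      using nd[OF jl] eq lt unfolding nondeg_def j by blast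
    have "fst (snd (zs ! (j - 1)) (fst ?s)) \<noteq> snd (snd (zs ! (j - 1)) (fst ?s))"
      using edge inEE[OF jl lt(1)] by blast
    then have "snd ?s = snd ?s'" using eq fst_eq by (auto simp: role_def j split: if_splits)
    then have "a = a'" using slot_inj[OF aj(1,2,5,6)] fst_eq j prod_eqI by blast
    then show "p = p'" using j pp by simp
  qed
  have sub: "f ` H_verts k l \<subseteq> VG"
  proof
    fix v assume "v \<in> f ` H_verts k l"
    then obtain a j where aj: "1 \<le> a" "a \<le> 4 * k" "1 \<le> j" "j \<le> 2 * l" and v: "v = f (a, j)"
      by (auto simp: H_verts_def)
    have "snd (zs ! (j - 1)) (fst (slot k (fst (zs ! (j - 1))) a)) \<in> EE"
      by (rule inEE) (use aj slot_less in auto)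
    then show "v \<in> VG" using edge by (auto simp: v f_def vert_def role_def)
  qed
  have succ: "Hkl_succ l j - 1 = Suc (j - 1) mod (2 * l)" if "1 \<le> j" "j \<le> 2 * l" for j
    using that by (auto simp: Hkl_succ_def)
  have EE': "E (zs ! (j - 1)) (zs ! (Hkl_succ l j - 1))" "zs ! (j - 1) \<in> UNIV \<times> Col" "zs ! (Hkl_succ l j - 1) \<in> UNIV \<times> Col"
    if "1 \<le> j" "j \<le> 2 * l" for j
  proof -
    have "Suc (j - 1) mod (2 * l) < 2 * l" using l by simp
    then show "E (zs ! (j - 1)) (zs ! (Hkl_succ l j - 1))" "zs ! (j - 1) \<in> UNIV \<times> Col" "zs ! (Hkl_succ l j - 1) \<in> UNIV \<times> Col"
      using that E[of "j - 1"] zin[of "j - 1"] zin[of "Suc (j - 1) mod (2 * l)"] succ[OF that] by auto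
  qed
  have row: "{f (2 * i - 1, j), f (2 * i, j)} \<in> EG" if "1 \<le> i" "i \<le> 2 * k" "1 \<le> j" "j \<le> 2 * l" for i j
  proof -
    let ?z = "zs ! (j - 1)"
    have "(\<exists>q. i = 2 * q + 1) \<or> (\<exists>q. i = 2 * q + 2)" using that by presburger
    then obtain q where q: "i = 2 * q + 1 \<or> i = 2 * q + 2" by blast
    have lt: "j - 1 < 2 * l" "q < 2 * k" "2 * k - 1 - q < 2 * k" using that q by auto
    have e: "{fst (snd ?z m), snd (snd ?z m)} \<in> EG" if "m < 2 * k" for m
      using edge[OF inEE[OF lt(1) that]] by simp
    have fin: "{f (2 * i - 1, j), f (2 * i, j)} \<in> EG"
      if "slot k (fst ?z) (2 * i - 1) = (m, b)" "slot k (fst ?z) (2 * i) = (m, \<not> b)" "m < 2 * k" for m b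
    proof -
      have "f (2 * i - 1, j) = role b (snd ?z m)" "f (2 * i, j) = role (\<not> b) (snd ?z m)"
        unfolding f_def vert_def fst_conv snd_conv that(1,2) by simp_all
      then show ?thesis using e[OF that(3)] by (cases b) (simp_all add: role_def insert_commute)
    qed
    from q show ?thesis
    proof
      assume "i = 2 * q + 1"
      then have *: "2 * i - 1 = 4 * q + 1" "2 * i = 4 * q + 2" by auto
      show ?thesis
      proof (rule fin)
        show "slot k (fst ?z) (2 * i - 1) = (if fst ?z then 2 * k - 1 - q else q, \<not> fst ?z)"
          unfolding *(1) slot_simps by simp
        show "slot k (fst ?z) (2 * i) = (if fst ?z then 2 * k - 1 - q else q, \<not> \<not> fst ?z)"
          unfolding *(2) slot_simps by simp
      qed (use lt in simp)
    next
      assume "i = 2 * q + 2"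
      then have *: "2 * i - 1 = 4 * q + 3" "2 * i = 4 * q + 4" by auto
      show ?thesis
      proof (rule fin)
        show "slot k (fst ?z) (2 * i - 1) = (if fst ?z then q else 2 * k - 1 - q, fst ?z)"
          unfolding *(1) slot_simps by simp
        show "slot k (fst ?z) (2 * i) = (if fst ?z then q else 2 * k - 1 - q, \<not> fst ?z)"
          unfolding *(2) slot_simps by simp
      qed (use lt in simp)
    qed
  qed
  have "f ` e \<in> EG" if "e \<in> H_edges k l" for e
    using that unfolding H_edges_def
  proof (elim UnE)
    assume "e \<in> {{(2*i-1, j), (2*i, j)} | i j. 1 \<le> i \<and> i \<le> 2*k \<and> 1 \<le> j \<and> j \<le> 2*l}"
    then show ?thesis using row by auto
  next
    assume "e \<in> {{(1, j), (1, Hkl_succ l j)} | j. 1 \<le> j \<and> j \<le> 2*l}"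
    then show ?thesis using vert_E(1)[OF EE'(2,3,1)] by (auto simp: f_def)
  next
    assume "e \<in> {{(4*k, j), (4*k, Hkl_succ l j)} | j. 1 \<le> j \<and> j \<le> 2*l}"
    then show ?thesis using vert_E(2)[OF EE'(2,3,1)] by (auto simp: f_def)
  next
    assume "e \<in> {{(2*i, j), (2*i+1, Hkl_succ l j)} | i j. 1 \<le> i \<and> i \<le> 2*k-1 \<and> 1 \<le> j \<and> j \<le> 2*l}"
    then show ?thesis using vert_E(3)[OF EE'(2,3,1)] by (auto simp: f_def)
  next
    assume "e \<in> {{(2*i+1, j), (2*i, Hkl_succ l j)} | i j. 1 \<le> i \<and> i \<le> 2*k-1 \<and> 1 \<le> j \<and> j \<le> 2*l}"
    then show ?thesis using vert_E(4)[OF EE'(2,3,1)] by (auto simp: f_def)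
  qed
  then show ?thesis unfolding contains_copy_def using inj sub by blast
qed

text \<open>Here \<open>r\<close> is \<open>2 * k\<close>. The constant 4096 is a product of three
  factors 16: from the pairs of positions in the closed walk, from the pairs of slots, and from the
  power of the density 1/4.\<close>

theorem contains_H_if_mostly_ok:
  assumes "ktr EE Rk (4 * k) > 0"
    and "8 * real k * bad_weight \<le> ktr EE Rk (4 * k)" and "128 * real k ^ 2 * \<kappa> \<le> 1"
    and "l \<ge> 1"
    and tiny: "2 * real (card EE) ^ (2 * k) * (4096 * real l ^ 4 * real k ^ 2 * \<kappa>) ^ l < 1"
  shows "contains_copy (H_verts k l) (H_edges k l) VG EG"
proof -
  have tiny': "(16 * real l ^ 4 * (4 * (2 * k)\<^sup>2 * \<kappa>)) ^ l * (2 * real (card EE) ^ (2 * k)) < (1/4) ^ (2 * l)"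
  proof -
    let ?x = "16 * real l ^ 4 * (4 * (2 * k)\<^sup>2 * \<kappa>)"
    have "(4096 * real l ^ 4 * real k ^ 2 * \<kappa>) = 16 * ?x" by (simp add: power2_eq_square)
    then have "2 * real (card EE) ^ (2 * k) * (16 ^ l * ?x ^ l) < 1"
      using tiny by (simp only: power_mult_distrib)
    then have "16 ^ l * (?x ^ l * (2 * real (card EE) ^ (2 * k))) < 1" by (simp only: mult_ac)
    then have "?x ^ l * (2 * real (card EE) ^ (2 * k)) < (1 / 16) ^ l" by (simp add: field_simps)
    moreover have "(1 / 16 :: real) ^ l = (1 / 4) ^ (2 * l)" by (simp add: power_mult power_divide)
    ultimately show ?thesis by simp
  qed
  obtain zs where "set zs \<subseteq> UNIV \<times> Col" "length zs = 2 * l"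
    "\<forall>i<2*l. E (zs ! i) (zs ! (Suc i mod (2 * l)))"
    "\<forall>i j. i < j \<longrightarrow> j < 2 * l \<longrightarrow> \<not> meet (zs ! i) (zs ! j)"
    using column_walk[OF _ _ _ assms(4) tiny'] assms(1-3) by (auto simp: mult_ac power2_eq_square)
  then show ?thesis using contains_H assms(4) by blast
qed

end

section \<open>Graphs without rich neighbourhoods\<close>

lemma sum_of_bool: "finite S \<Longrightarrow> (\<Sum>z\<in>S. of_bool (Q z)) = real (card {z \<in> S. Q z})"
  by (simp add: of_bool_def sum.If_cases Int_def)

locale bounded_graph =
  fixes V :: "'v set" and adj :: "'v \<Rightarrow> 'v \<Rightarrow> bool" and \<Delta> :: real and VG :: "'v set" and EG :: "'v set set"
  assumes finV: "finite V"
    and adjV: "\<And>x y. adj x y \<Longrightarrow> x \<in> V \<and> y \<in> V"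
    and adj_sym: "\<And>x y. adj x y \<Longrightarrow> adj y x"
    and adj_irrefl: "\<And>x. \<not> adj x x"
    and adj_EG: "\<And>x y. adj x y \<Longrightarrow> {x, y} \<in> EG"
    and V_VG: "V \<subseteq> VG"
    and deg: "\<And>x. x \<in> V \<Longrightarrow> real (card {y \<in> V. adj x y}) \<le> \<Delta>"
    and Delta_pos: "\<Delta> > 0"
begin

abbreviation A :: "'v \<Rightarrow> 'v \<Rightarrow> real" where "A \<equiv> \<lambda>x y. of_bool (adj x y)"

lemma adj_commute: "adj x y \<longleftrightarrow> adj y x"
  using adj_sym by blast

sublocale sym_kernel V A
  by unfold_locales (auto simp: finV adj_commute)

definition codeg :: "'v \<Rightarrow> 'v \<Rightarrow> nat" where
  "codeg x y = card {z \<in> V. adj x z \<and> adj z y}"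

lemma codeg_commute: "codeg x y = codeg y x"
  unfolding codeg_def by (rule arg_cong[of _ _ card]) (use adj_commute in blast)

lemma codeg_sum: "real (codeg x y) = (\<Sum>z\<in>V. A x z * A z y)"
proof -
  have "(\<Sum>z\<in>V. A x z * A z y) = (\<Sum>z\<in>V. of_bool (adj x z \<and> adj z y))" by (intro sum.cong) auto
  also have "\<dots> = real (codeg x y)" unfolding codeg_def by (rule sum_of_bool[OF finV])
  finally show ?thesis by simp
qed

lemma sum_kpow_A_le:
  assumes "x \<in> V"
  shows "(\<Sum>y\<in>V. kpow V A n x y) \<le> \<Delta> ^ n"
  using assms
proof (induction n arbitrary: x)
  case 0
  then show ?case using finV by simp
next
  case (Suc n)
  have "(\<Sum>y\<in>V. kpow V A (Suc n) x y) = (\<Sum>z\<in>V. A x z * (\<Sum>y\<in>V. kpow V A n z y))"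
    by (simp add: sum_distrib_left) (rule sum.swap)
  also have "\<dots> \<le> (\<Sum>z\<in>V. A x z * \<Delta> ^ n)"
    by (intro sum_mono mult_left_mono Suc.IH) auto
  also have "\<dots> = real (card {y \<in> V. adj x y}) * \<Delta> ^ n"
    by (simp only: sum_distrib_right[symmetric] sum_of_bool[OF finV])
  also have "\<dots> \<le> \<Delta> * \<Delta> ^ n" using deg[OF Suc.prems] Delta_pos by (intro mult_right_mono) auto
  finally show ?case by simp
qed

text \<open>The number of closed walks of length \<open>8 * k\<close> whose first and third vertices
  have codegree above \<open>T\<close>.\<close>

definition rich_weight :: "real \<Rightarrow> nat \<Rightarrow> real" where
  "rich_weight T k = (\<Sum>x\<in>V. \<Sum>y\<in>V. \<Sum>z\<in>V. of_bool (real (codeg x z) > T) * A x y * A y z * kpow V A (8 * k - 2) z x)"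

section \<open>Arcs of the host graph as entries of columns\<close>

definition arcs :: "('v \<times> 'v) set" where
  "arcs = {e. adj (fst e) (snd e)}"

definition arc_link :: "'v \<times> 'v \<Rightarrow> 'v \<times> 'v \<Rightarrow> bool" where
  "arc_link e f \<longleftrightarrow> adj (snd e) (fst f)"

abbreviation Lk :: "'v \<times> 'v \<Rightarrow> 'v \<times> 'v \<Rightarrow> real" where
  "Lk \<equiv> \<lambda>e f. of_bool (arc_link e f)"

lemma arcs_subset: "arcs \<subseteq> V \<times> V"
  using adjV by (auto simp: arcs_def)

lemma finite_arcs: "finite arcs"
  using finite_subset[OF arcs_subset] finV by simp

lemma card_arcs_le: "card arcs \<le> (card V)\<^sup>2"
  using card_mono[OF _ arcs_subset] finV by (simp add: card_cartesian_product power2_eq_square)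

lemma sum_arcs: "(\<Sum>e\<in>arcs. F (fst e) (snd e)) = (\<Sum>x\<in>V. \<Sum>y\<in>V. A x y * F x y)"
proof -
  have "(\<Sum>x\<in>V. \<Sum>y\<in>V. A x y * F x y) = (\<Sum>e\<in>V \<times> V. A (fst e) (snd e) * F (fst e) (snd e))"
    by (simp add: sum.cartesian_product case_prod_unfold)
  also have "\<dots> = (\<Sum>e\<in>arcs. F (fst e) (snd e))"
    by (intro sum.mono_neutral_cong_right) (use arcs_subset finV in \<open>auto simp: arcs_def\<close>)
  finally show ?thesis ..
qed

text \<open>An arc is itself a step: \<open>Suc n\<close> links and the \<open>n\<close> arcs
  between \<open>e\<close> and \<open>g\<close> make \<open>2 * n + 1\<close> steps from the head of
  \<open>e\<close> to the tail of \<open>g\<close>.\<close>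

lemma kpow_Lk: "e \<in> arcs \<Longrightarrow> g \<in> arcs \<Longrightarrow> kpow arcs Lk (Suc n) e g = kpow V A (2 * n + 1) (snd e) (fst g)"
proof (induction n arbitrary: e)
  case 0
  have "fst g \<in> V" using 0 arcs_subset by auto
  then show ?case using kpow_one[OF finite_arcs 0(2), of Lk e] kpow_one[OF finV, of "fst g" A "snd e"]
    by (simp add: arc_link_def del: kpow.simps)
next
  case (Suc n)
  have "kpow arcs Lk (Suc (Suc n)) e g = (\<Sum>f\<in>arcs. Lk e f * kpow V A (2 * n + 1) (snd f) (fst g))"
    using Suc by (simp only: kpow.simps(2)[of _ _ "Suc n"]) simp
  also have "\<dots> = (\<Sum>x\<in>V. \<Sum>y\<in>V. A x y * (A (snd e) x * kpow V A (2 * n + 1) y (fst g)))"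
    unfolding arc_link_def by (rule sum_arcs[of "\<lambda>x y. A (snd e) x * kpow V A (2 * n + 1) y (fst g)"])
  also have "\<dots> = kpow V A (Suc (Suc (2 * n + 1))) (snd e) (fst g)"
    unfolding kpow.simps(2)[of _ _ "Suc (2 * n + 1)"] kpow.simps(2)[of _ _ "2 * n + 1"] sum_distrib_left
    by (intro sum.cong refl) (rule mult.left_commute)
  finally show ?case by simp
qed

lemma ktr_Lk: "ktr arcs Lk (Suc n) = ktr V A (2 * Suc n)"
proof -
  have "ktr arcs Lk (Suc n) = (\<Sum>e\<in>arcs. kpow V A (2 * n + 1) (snd e) (fst e))"
    unfolding ktr_def by (intro sum.cong refl kpow_Lk)
  also have "\<dots> = (\<Sum>x\<in>V. \<Sum>y\<in>V. A x y * kpow V A (2 * n + 1) y x)"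
    by (rule sum_arcs[of "\<lambda>x y. kpow V A (2 * n + 1) y x"])
  also have "\<dots> = ktr V A (Suc (2 * n + 1))" by (simp add: ktr_def)
  finally show ?thesis by simp
qed

text \<open>The tail of \<open>e\<close> and the head of \<open>g\<close> do not occur in
  \<open>\<Phi>\<close>. Summing them out adds one step at each end of the return walk, from
  \<open>2 * n + 1\<close> to \<open>2 * n + 3\<close>.\<close>

lemma sum_arcs3:
  "(\<Sum>e\<in>arcs. \<Sum>f\<in>arcs. \<Sum>g\<in>arcs. \<Phi> (snd e) (fst f) (snd f) (fst g) * Lk e f * Lk f g * kpow arcs Lk (Suc n) g e)
   = (\<Sum>a\<in>V. \<Sum>x\<in>V. \<Sum>y\<in>V. \<Sum>b\<in>V. \<Phi> a x y b * A a x * A x y * A y b * kpow V A (2 * n + 3) b a)"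
proof -
  have k: "kpow V A (2 * n + 3) b a = (\<Sum>c\<in>V. \<Sum>d\<in>V. A c a * A b d * kpow V A (2 * n + 1) d c)"
    if "a \<in> V" "b \<in> V" for a b
  proof -
    have "kpow V A (Suc (Suc (2 * n + 1))) b a = (\<Sum>c\<in>V. kpow V A (Suc (2 * n + 1)) b c * A c a)"
      by (rule kpow_Suc_right[OF finV that(2,1)])
    also have "\<dots> = (\<Sum>c\<in>V. \<Sum>d\<in>V. A c a * A b d * kpow V A (2 * n + 1) d c)"
      unfolding kpow.simps(2)[of _ _ "2 * n + 1"] sum_distrib_right by (simp only: mult_ac)
    also have "Suc (Suc (2 * n + 1)) = 2 * n + 3" by simp
    finally show ?thesis .
  qed
  have "(\<Sum>e\<in>arcs. \<Sum>f\<in>arcs. \<Sum>g\<in>arcs. \<Phi> (snd e) (fst f) (snd f) (fst g) * Lk e f * Lk f g * kpow arcs Lk (Suc n) g e)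
    = (\<Sum>e\<in>arcs. \<Sum>f\<in>arcs. \<Sum>g\<in>arcs. \<Phi> (snd e) (fst f) (snd f) (fst g) * A (snd e) (fst f) * A (snd f) (fst g) * kpow V A (2 * n + 1) (snd g) (fst e))"
  proof (intro sum.cong refl)
    fix e f g assume "e \<in> arcs" "g \<in> arcs"
    show "\<Phi> (snd e) (fst f) (snd f) (fst g) * Lk e f * Lk f g * kpow arcs Lk (Suc n) g e
      = \<Phi> (snd e) (fst f) (snd f) (fst g) * A (snd e) (fst f) * A (snd f) (fst g) * kpow V A (2 * n + 1) (snd g) (fst e)"
      unfolding kpow_Lk[OF \<open>g \<in> arcs\<close> \<open>e \<in> arcs\<close>] by (simp only: arc_link_def)
  qed
  also have "\<dots> = (\<Sum>c\<in>V. \<Sum>a\<in>V. A c a * (\<Sum>x\<in>V. \<Sum>y\<in>V. A x y * (\<Sum>b\<in>V. \<Sum>d\<in>V. A b d * (\<Phi> a x y b * A a x * A y b * kpow V A (2 * n + 1) d c))))"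
    by (subst sum_arcs[of "\<lambda>c a. \<Sum>f\<in>arcs. \<Sum>g\<in>arcs. \<Phi> a (fst f) (snd f) (fst g) * A a (fst f) * A (snd f) (fst g) * kpow V A (2 * n + 1) (snd g) c"],
        subst sum_arcs[of "\<lambda>x y. \<Sum>g\<in>arcs. \<Phi> _ x y (fst g) * A _ x * A y (fst g) * kpow V A (2 * n + 1) (snd g) _"],
        subst sum_arcs[of "\<lambda>b d. \<Phi> _ _ _ b * A _ _ * A _ b * kpow V A (2 * n + 1) d _"]) (rule refl)
  also have "\<dots> = (\<Sum>c\<in>V. \<Sum>a\<in>V. \<Sum>x\<in>V. \<Sum>y\<in>V. \<Sum>b\<in>V. \<Phi> a x y b * A a x * A x y * A y b * (\<Sum>d\<in>V. A c a * A b d * kpow V A (2 * n + 1) d c))"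
    by (simp only: sum_distrib_left mult_ac)
  also have "\<dots> = (\<Sum>a\<in>V. \<Sum>c\<in>V. \<Sum>x\<in>V. \<Sum>y\<in>V. \<Sum>b\<in>V. \<Phi> a x y b * A a x * A x y * A y b * (\<Sum>d\<in>V. A c a * A b d * kpow V A (2 * n + 1) d c))"
    by (rule sum.swap)
  also have "\<dots> = (\<Sum>a\<in>V. \<Sum>x\<in>V. \<Sum>c\<in>V. \<Sum>y\<in>V. \<Sum>b\<in>V. \<Phi> a x y b * A a x * A x y * A y b * (\<Sum>d\<in>V. A c a * A b d * kpow V A (2 * n + 1) d c))"
    by (rule sum.cong[OF refl], rule sum.swap)
  also have "\<dots> = (\<Sum>a\<in>V. \<Sum>x\<in>V. \<Sum>y\<in>V. \<Sum>c\<in>V. \<Sum>b\<in>V. \<Phi> a x y b * A a x * A x y * A y b * (\<Sum>d\<in>V. A c a * A b d * kpow V A (2 * n + 1) d c))"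
    by (rule sum.cong[OF refl], rule sum.cong[OF refl], rule sum.swap)
  also have "\<dots> = (\<Sum>a\<in>V. \<Sum>x\<in>V. \<Sum>y\<in>V. \<Sum>b\<in>V. \<Sum>c\<in>V. \<Phi> a x y b * A a x * A x y * A y b * (\<Sum>d\<in>V. A c a * A b d * kpow V A (2 * n + 1) d c))"
    by (rule sum.cong[OF refl], rule sum.cong[OF refl], rule sum.cong[OF refl], rule sum.swap)
  also have "\<dots> = (\<Sum>a\<in>V. \<Sum>x\<in>V. \<Sum>y\<in>V. \<Sum>b\<in>V. \<Phi> a x y b * A a x * A x y * A y b * kpow V A (2 * n + 3) b a)"
    by (intro sum.cong refl) (simp only: k sum_distrib_left)
  finally show ?thesis .
qed

text \<open>Choosing an arc between \<open>e\<close> and \<open>g\<close> means choosing a 3-walk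
  from the head of \<open>e\<close> to the tail of \<open>g\<close>, and with one endpoint of the
  arc fixed the remaining choices are bounded by a codegree. So \<open>ok\<close> can fail only if
  there are fewer than \<open>\<rho>\<close> such 3-walks or one of two codegrees exceeds
  \<open>\<kappa> * \<rho>\<close>.\<close>

theorem contains_H_if_not_rich:
  fixes k l :: nat and \<kappa> \<rho> :: real
  assumes k: "k \<ge> 1" and l: "l \<ge> 1" and pos: "ktr V A (8 * k) > 0"
    and few: "32 * k * rich_weight (\<kappa> * \<rho>) k \<le> ktr V A (8 * k)"
    and rho: "16 * k * \<rho> * card V * \<Delta> ^ (8 * k - 3) \<le> ktr V A (8 * k)" and "\<rho> \<ge> 0"
    and kappa: "\<kappa> \<ge> 0" "128 * real k ^ 2 * \<kappa> \<le> 1"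
    and tiny: "2 * real (card V) ^ (4 * k) * (4096 * real l ^ 4 * real k ^ 2 * \<kappa>) ^ l < 1"
  shows "contains_copy (H_verts k l) (H_edges k l) VG EG"
proof -
  interpret el: edge_links_in_graph arcs arc_link \<kappa> k VG EG
  proof
    show "fst e \<in> VG \<and> snd e \<in> VG \<and> fst e \<noteq> snd e \<and> {fst e, snd e} \<in> EG" if "e \<in> arcs" for e
    proof -
      have "adj (fst e) (snd e)" using that by (simp add: arcs_def)
      then show ?thesis using adjV V_VG adj_EG adj_irrefl by (metis subsetD)
    qed
    show "{snd e, fst f} \<in> EG" if "arc_link e f" for e f using that adj_EG by (simp add: arc_link_def)
  qed (use k kappa finite_arcs in auto)
  define T where "T = \<kappa> * \<rho>"
  define K3 where "K3 a b = (\<Sum>x\<in>V. \<Sum>y\<in>V. A a x * A x y * A y b)" for a b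
  have cardmid: "real (card (el.mid e g)) = K3 (snd e) (fst g)" for e g
  proof -
    have "K3 (snd e) (fst g) = (\<Sum>x\<in>V. \<Sum>y\<in>V. A x y * (A (snd e) x * A y (fst g)))"
      unfolding K3_def by (simp only: mult_ac)
    also have "\<dots> = (\<Sum>f\<in>arcs. A (snd e) (fst f) * A (snd f) (fst g))"
      by (rule sum_arcs[symmetric])
    also have "\<dots> = (\<Sum>f\<in>arcs. of_bool (adj (snd e) (fst f) \<and> adj (snd f) (fst g)))"
      by (intro sum.cong) auto
    also have "\<dots> = real (card {f \<in> arcs. adj (snd e) (fst f) \<and> adj (snd f) (fst g)})"
      by (rule sum_of_bool[OF finite_arcs])
    finally show ?thesis by (simp add: el.mid_def arc_link_def)
  qed
  have midD: "adj (fst f') (snd f')" "adj (snd e) (fst f')" "adj (snd f') (fst g)" if "f' \<in> el.mid e g" for e f' g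
    using that by (auto simp: el.mid_def arc_link_def) (simp add: arcs_def)
  have notok: "of_bool (\<not> el.ok e f g) * Lk e f * Lk f g
      \<le> (of_bool (K3 (snd e) (fst g) < \<rho>) + of_bool (real (codeg (fst f) (fst g)) > T) + of_bool (real (codeg (snd e) (snd f)) > T)) * Lk e f * Lk f g"
    for e f g
  proof (cases "arc_link e f \<and> arc_link f g \<and> \<not> el.ok e f g")
    case True
    have c1: "card {f' \<in> el.mid e g. role True f' = role True f} \<le> codeg (fst f) (fst g)"
    proof -
      have "{f' \<in> el.mid e g. role True f' = role True f} \<subseteq> Pair (fst f) ` {z \<in> V. adj (fst f) z \<and> adj z (fst g)}"
      proof
        fix f' assume f': "f' \<in> {f' \<in> el.mid e g. role True f' = role True f}"
        then have "f' = Pair (fst f) (snd f')" by (simp add: role_def prod_eq_iff)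
        moreover have "snd f' \<in> {z \<in> V. adj (fst f) z \<and> adj z (fst g)}"
          using f' midD[of f' e g] adjV by (auto simp: role_def)
        ultimately show "f' \<in> Pair (fst f) ` {z \<in> V. adj (fst f) z \<and> adj z (fst g)}" by (rule image_eqI)
      qed
      then have "card {f' \<in> el.mid e g. role True f' = role True f} \<le> card (Pair (fst f) ` {z \<in> V. adj (fst f) z \<and> adj z (fst g)})"
        by (rule card_mono[rotated]) (simp add: finV)
      also have "\<dots> \<le> codeg (fst f) (fst g)" unfolding codeg_def by (rule card_image_le) (simp add: finV)
      finally show ?thesis .
    qed
    have c2: "card {f' \<in> el.mid e g. role False f' = role False f} \<le> codeg (snd e) (snd f)"
    proof -
      have "{f' \<in> el.mid e g. role False f' = role False f} \<subseteq> (\<lambda>z. (z, snd f)) ` {z \<in> V. adj (snd e) z \<and> adj z (snd f)}"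
      proof
        fix f' assume f': "f' \<in> {f' \<in> el.mid e g. role False f' = role False f}"
        then have "f' = (\<lambda>z. (z, snd f)) (fst f')" by (simp add: role_def prod_eq_iff)
        moreover have "fst f' \<in> {z \<in> V. adj (snd e) z \<and> adj z (snd f)}"
          using f' midD[of f' e g] adjV by (auto simp: role_def)
        ultimately show "f' \<in> (\<lambda>z. (z, snd f)) ` {z \<in> V. adj (snd e) z \<and> adj z (snd f)}" by (rule image_eqI)
      qed
      then have "card {f' \<in> el.mid e g. role False f' = role False f} \<le> card ((\<lambda>z. (z, snd f)) ` {z \<in> V. adj (snd e) z \<and> adj z (snd f)})"
        by (rule card_mono[rotated]) (simp add: finV)
      also have "\<dots> \<le> codeg (snd e) (snd f)" unfolding codeg_def by (rule card_image_le) (simp add: finV)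
      finally show ?thesis .
    qed
    have "K3 (snd e) (fst g) < \<rho> \<or> real (codeg (fst f) (fst g)) > T \<or> real (codeg (snd e) (snd f)) > T"
    proof (rule ccontr)
      assume neg: "\<not> ?thesis"
      then have "T \<le> \<kappa> * K3 (snd e) (fst g)" unfolding T_def using kappa by (intro mult_left_mono) auto
      then have "real (card {f' \<in> el.mid e g. role b f' = role b f}) \<le> \<kappa> * card (el.mid e g)" for b
        using c1 c2 neg unfolding cardmid by (cases b) auto
      then show False using True by (simp add: el.ok_def)
    qed
    then show ?thesis by auto
  qed auto
  obtain n where n: "4 * k - 2 = Suc n" "2 * n + 3 = 8 * k - 3" using k
    by (cases "4 * k - 2") auto
  have nn: "0 \<le> kpow V A m x y" if "x \<in> V" "y \<in> V" for m x y
    by (rule kpow_nonneg) (use that in auto)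
  have nnL: "0 \<le> kpow arcs Lk m x y" if "x \<in> arcs" "y \<in> arcs" for m x y
    by (rule kpow_nonneg) (use that in auto)
  define F where "F a x y b = of_bool (K3 a b < \<rho>) + of_bool (real (codeg x b) > T) + (of_bool (real (codeg a y) > T) :: real)" for a x y b
  have "el.bad_weight \<le> (\<Sum>e\<in>arcs. \<Sum>f\<in>arcs. \<Sum>g\<in>arcs. F (snd e) (fst f) (snd f) (fst g) * Lk e f * Lk f g * kpow arcs Lk (Suc n) g e)"
    unfolding el.bad_weight_def F_def using n(1)
    by (intro sum_mono) (simp add: mult_right_mono[OF notok nnL] del: kpow.simps)
  also have "\<dots> = (\<Sum>a\<in>V. \<Sum>x\<in>V. \<Sum>y\<in>V. \<Sum>b\<in>V. F a x y b * A a x * A x y * A y b * kpow V A (8 * k - 3) b a)"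
    unfolding sum_arcs3 n(2) ..
  also have "\<dots> = (\<Sum>a\<in>V. \<Sum>x\<in>V. \<Sum>y\<in>V. \<Sum>b\<in>V. of_bool (K3 a b < \<rho>) * A a x * A x y * A y b * kpow V A (8 * k - 3) b a)
    + (\<Sum>a\<in>V. \<Sum>x\<in>V. \<Sum>y\<in>V. \<Sum>b\<in>V. of_bool (real (codeg x b) > T) * A a x * A x y * A y b * kpow V A (8 * k - 3) b a)
    + (\<Sum>a\<in>V. \<Sum>x\<in>V. \<Sum>y\<in>V. \<Sum>b\<in>V. of_bool (real (codeg a y) > T) * A a x * A x y * A y b * kpow V A (8 * k - 3) b a)"
    (is "_ = ?I1 + ?I2 + ?I3") unfolding F_def by (simp only: distrib_right sum.distrib)
  finally have bw: "el.bad_weight \<le> ?I1 + ?I2 + ?I3" .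
  have k2: "8 * k - 2 = Suc (8 * k - 3)" using k by simp
  have "?I3 = (\<Sum>a\<in>V. \<Sum>x\<in>V. \<Sum>y\<in>V. of_bool (real (codeg a y) > T) * A a x * A x y * kpow V A (8 * k - 2) y a)"
    unfolding k2 kpow.simps(2)[of _ _ "8 * k - 3"] by (simp only: sum_distrib_left mult.assoc)
  then have I3: "?I3 = rich_weight T k" unfolding rich_weight_def .
  \<comment> \<open>The pair of large codegree starts one step later here; moving the starting point
    of the closed walk turns this sum into \<open>rich_weight\<close> as well.\<close>
  have "?I2 = (\<Sum>x\<in>V. \<Sum>a\<in>V. \<Sum>y\<in>V. \<Sum>b\<in>V. of_bool (real (codeg x b) > T) * A a x * A x y * A y b * kpow V A (8 * k - 3) b a)"
    by (rule sum.swap)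
  also have "\<dots> = (\<Sum>x\<in>V. \<Sum>y\<in>V. \<Sum>a\<in>V. \<Sum>b\<in>V. of_bool (real (codeg x b) > T) * A a x * A x y * A y b * kpow V A (8 * k - 3) b a)"
    by (rule sum.cong[OF refl], rule sum.swap)
  also have "\<dots> = (\<Sum>x\<in>V. \<Sum>y\<in>V. \<Sum>b\<in>V. \<Sum>a\<in>V. of_bool (real (codeg x b) > T) * A a x * A x y * A y b * kpow V A (8 * k - 3) b a)"
    by (rule sum.cong[OF refl], rule sum.cong[OF refl], rule sum.swap)
  also have "\<dots> = (\<Sum>x\<in>V. \<Sum>y\<in>V. \<Sum>b\<in>V. of_bool (real (codeg x b) > T) * A x y * A y b * kpow V A (8 * k - 2) b x)"
  proof (intro sum.cong refl)
    fix x y b assume "x \<in> V" "b \<in> V"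
    show "(\<Sum>a\<in>V. of_bool (real (codeg x b) > T) * A a x * A x y * A y b * kpow V A (8 * k - 3) b a)
      = of_bool (real (codeg x b) > T) * A x y * A y b * kpow V A (8 * k - 2) b x"
      unfolding k2 kpow_Suc_right[OF finV \<open>b \<in> V\<close> \<open>x \<in> V\<close>] sum_distrib_left
      by (intro sum.cong refl) (simp only: mult_ac)
  qed
  finally have I2: "?I2 = rich_weight T k" unfolding rich_weight_def .
  have "?I1 = (\<Sum>a\<in>V. \<Sum>x\<in>V. \<Sum>b\<in>V. \<Sum>y\<in>V. of_bool (K3 a b < \<rho>) * A a x * A x y * A y b * kpow V A (8 * k - 3) b a)"
    by (rule sum.cong[OF refl], rule sum.cong[OF refl], rule sum.swap)
  also have "\<dots> = (\<Sum>a\<in>V. \<Sum>b\<in>V. \<Sum>x\<in>V. \<Sum>y\<in>V. of_bool (K3 a b < \<rho>) * A a x * A x y * A y b * kpow V A (8 * k - 3) b a)"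
    by (rule sum.cong[OF refl], rule sum.swap)
  also have "\<dots> = (\<Sum>a\<in>V. \<Sum>b\<in>V. of_bool (K3 a b < \<rho>) * K3 a b * kpow V A (8 * k - 3) b a)"
    unfolding K3_def by (simp only: sum_distrib_left sum_distrib_right mult_ac)
  \<comment> \<open>Each such pair has fewer than \<open>\<rho>\<close> 3-walks; the return walks of
    \<open>8 * k - 3\<close> steps are then bounded by the maximum degree alone.\<close>
  also have "\<dots> \<le> (\<Sum>a\<in>V. \<Sum>b\<in>V. \<rho> * kpow V A (8 * k - 3) b a)"
    using \<open>\<rho> \<ge> 0\<close> by (intro sum_mono mult_right_mono nn) auto
  also have "\<dots> = \<rho> * (\<Sum>b\<in>V. \<Sum>a\<in>V. kpow V A (8 * k - 3) b a)"
    unfolding sum_distrib_left by (rule sum.swap)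
  also have "\<dots> \<le> \<rho> * (\<Sum>b\<in>V. \<Delta> ^ (8 * k - 3))"
    by (intro mult_left_mono sum_mono sum_kpow_A_le) (use \<open>\<rho> \<ge> 0\<close> in auto)
  finally have I1: "?I1 \<le> \<rho> * (card V * \<Delta> ^ (8 * k - 3))" by simp
  have tr: "ktr arcs Lk (4 * k) = ktr V A (8 * k)"
    using ktr_Lk[of "4 * k - 1"] k by (simp add: Suc_diff_1)
  show ?thesis
  proof (rule el.contains_H_if_mostly_ok)
    show "0 < ktr arcs Lk (4 * k)" using tr pos by simp
    have "16 * real k * el.bad_weight \<le> 16 * real k * (\<rho> * (card V * \<Delta> ^ (8 * k - 3)) + 2 * rich_weight T k)"
      using bw I1 I2 I3 by (intro mult_left_mono) auto
    then show "8 * real k * el.bad_weight \<le> ktr arcs Lk (4 * k)"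
      using few rho unfolding tr T_def[symmetric] by (simp add: algebra_simps)
    have "real (card arcs) ^ (2 * k) \<le> (real (card V) ^ 2) ^ (2 * k)"
      using card_arcs_le by (intro power_mono) (auto simp flip: of_nat_power)
    also have "\<dots> = real (card V) ^ (4 * k)" by (simp flip: power_mult)
    finally have "2 * real (card arcs) ^ (2 * k) * (4096 * real l ^ 4 * real k ^ 2 * \<kappa>) ^ l
      \<le> 2 * real (card V) ^ (4 * k) * (4096 * real l ^ 4 * real k ^ 2 * \<kappa>) ^ l"
      using kappa by (intro mult_right_mono) auto
    then show "2 * real (card arcs) ^ (2 * k) * (4096 * real l ^ 4 * real k ^ 2 * \<kappa>) ^ l < 1" using tiny by simp
  qed (use kappa l in auto)
qed

lemma weighted: "weighted_graph V adj (\<lambda>_. \<Delta>)"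
  by unfold_locales (use finV adj_sym deg in auto)

lemma W_eq: "weighted_graph.W adj (\<lambda>_. \<Delta>) = (\<lambda>x y. (1 / \<Delta>) * A x y)"
  using Delta_pos by (intro ext) (simp add: weighted_graph.W_def[OF weighted])

text \<open>If no vertex had that many pairs of neighbours, every \<open>c\<close> would have fewer
  than \<open>s\<close> neighbours with at least \<open>s\<close> partners each. In a window x, c,
  y, either \<open>y\<close> has few partners at \<open>c\<close>, leaving few choices for
  \<open>x\<close>, or \<open>y\<close> is one of the few rich neighbours of \<open>c\<close>. Both
  are conflicts of share \<open>s / \<Delta>\<close>.\<close>

lemma rich_neighbourhood:
  fixes K s T :: real
  assumes k: "k \<ge> 1" and dense: "card V * \<Delta> \<le> K * (\<Sum>x\<in>V. real (card {y \<in> V. adj x y}))"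
    and "V \<noteq> {}" "K > 0" "s > 0" and small: "((64 * real k)\<^sup>2 * s / \<Delta>) ^ (4 * k) * card V < (1 / K) ^ (8 * k)"
    and rich: "32 * k * rich_weight T k > ktr V A (8 * k)"
  shows "\<exists>v\<in>V. s\<^sup>2 \<le> real (card {p \<in> V \<times> V. adj v (fst p) \<and> adj v (snd p) \<and> real (codeg (fst p) (snd p)) > T})"
proof (rule ccontr)
  assume "\<not> ?thesis"
  then have poor: "real (card {p \<in> V \<times> V. adj v (fst p) \<and> adj v (snd p) \<and> real (codeg (fst p) (snd p)) > T}) < s\<^sup>2"
    if "v \<in> V" for v using that by force
  interpret wg: weighted_graph V adj "\<lambda>_. \<Delta>" by (rule weighted)
  define N where "N c y = {x \<in> V. adj c x \<and> real (codeg x y) > T}" for c y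
  define rich where "rich c y \<longleftrightarrow> real (card (N c y)) \<ge> s" for c y
  have few_rich: "real (card {x \<in> V. adj c x \<and> rich c x}) < s" if c: "c \<in> V" for c
  proof (rule ccontr)
    assume many: "\<not> ?thesis"
    let ?X = "{x \<in> V. adj c x \<and> rich c x}"
    have fin: "finite ?X" "\<forall>x\<in>?X. finite (N c x)" using finV by (auto simp: N_def)
    have "s * s \<le> real (card ?X) * s" using many \<open>s > 0\<close> by (intro mult_right_mono) auto
    also have "\<dots> = (\<Sum>x\<in>?X. s)" by simp
    also have "\<dots> \<le> (\<Sum>x\<in>?X. real (card (N c x)))" by (intro sum_mono) (simp add: rich_def)
    also have "\<dots> = real (card (SIGMA x:?X. N c x))" using fin by simp
    also have "\<dots> \<le> real (card {p \<in> V \<times> V. adj c (fst p) \<and> adj c (snd p) \<and> real (codeg (fst p) (snd p)) > T})"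
      by (intro of_nat_mono card_mono) (use finV codeg_commute in \<open>auto simp: N_def\<close>)
    finally show False using poor[OF c] by (simp add: power2_eq_square)
  qed
  define g where "g i = ktr V wg.W (2 * i)" for i
  define Y where "Y Q = (\<Sum>x\<in>V. \<Sum>c\<in>V. \<Sum>y\<in>V. of_bool (Q x c y) * wg.W x c * kpow V wg.W 1 c y * kpow V wg.W (8 * k - 2) y x)"
    for Q :: "'v \<Rightarrow> 'v \<Rightarrow> 'v \<Rightarrow> bool"
  have bound: "Y Q \<le> sqrt ((s / \<Delta>) * g (4 * k) * g (4 * k - 1))"
    if "\<And>c y. c \<in> V \<Longrightarrow> y \<in> V \<Longrightarrow> real (card {x \<in> V. adj c x \<and> Q x c y}) \<le> s" for Q
  proof -
    \<comment> \<open>The instance \<open>d = 2\<close> of \<open>conflict_bound\<close>: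
      \<open>y\<close> is one step beyond \<open>c\<close>, on closed walks of length
      \<open>2 * (4 * k)\<close>.\<close>
    have "(\<Sum>x\<in>V. \<Sum>c\<in>V. \<Sum>y\<in>V. of_bool (Q x c y) * wg.W x c * kpow V wg.W (2 - 1) c y * kpow V wg.W (2 * (4 * k) - 2) y x)
      \<le> sqrt ((s / \<Delta>) * ktr V wg.W (2 * (4 * k)) * ktr V wg.W (2 * (4 * k - 1)))"
      by (rule wg.conflict_bound) (use that Delta_pos \<open>s > 0\<close> k in auto)
    then show ?thesis unfolding Y_def g_def by simp
  qed
  have Y1: "Y (\<lambda>x c y. real (codeg x y) > T \<and> \<not> rich c y) \<le> sqrt ((s / \<Delta>) * g (4 * k) * g (4 * k - 1))"
  proof (rule bound)
    fix c y
    show "real (card {x \<in> V. adj c x \<and> real (codeg x y) > T \<and> \<not> rich c y}) \<le> s"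
      using \<open>s > 0\<close> by (cases "rich c y") (auto simp: rich_def N_def)
  qed
  have Y2: "Y (\<lambda>x c y. rich c x) \<le> sqrt ((s / \<Delta>) * g (4 * k) * g (4 * k - 1))"
    by (rule bound) (use few_rich in \<open>auto intro: less_imp_le\<close>)
  have W1: "kpow V wg.W 1 c y = wg.W c y" if "y \<in> V" for c y
    using kpow_one[OF finV that] by simp
  have Y_alt: "Y Q = (\<Sum>x\<in>V. \<Sum>y\<in>V. \<Sum>c\<in>V. of_bool (Q x c y) * wg.W x c * wg.W c y * kpow V wg.W (8 * k - 2) y x)" for Q
  proof -
    have "Y Q = (\<Sum>x\<in>V. \<Sum>c\<in>V. \<Sum>y\<in>V. of_bool (Q x c y) * wg.W x c * wg.W c y * kpow V wg.W (8 * k - 2) y x)"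
      unfolding Y_def by (intro sum.cong refl) (simp only: W1)
    also have "\<dots> = (\<Sum>x\<in>V. \<Sum>y\<in>V. \<Sum>c\<in>V. of_bool (Q x c y) * wg.W x c * wg.W c y * kpow V wg.W (8 * k - 2) y x)"
      by (rule sum.cong[OF refl], rule sum.swap)
    finally show ?thesis .
  qed
  \<comment> \<open>The bound requires few choices for the first vertex of the window; reversing the
    closed walk moves the rich vertex from the third place to the first.\<close>
  have Y2': "Y (\<lambda>x c y. rich c y) = Y (\<lambda>x c y. rich c x)"
  proof -
    have "Y (\<lambda>x c y. rich c y) = (\<Sum>x\<in>V. \<Sum>y\<in>V. \<Sum>c\<in>V. of_bool (rich c y) * wg.W x c * wg.W c y * kpow V wg.W (8 * k - 2) y x)"
      by (rule Y_alt)
    also have "\<dots> = (\<Sum>y\<in>V. \<Sum>x\<in>V. \<Sum>c\<in>V. of_bool (rich c y) * wg.W x c * wg.W c y * kpow V wg.W (8 * k - 2) y x)"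
      by (rule sum.swap)
    also have "\<dots> = (\<Sum>y\<in>V. \<Sum>x\<in>V. \<Sum>c\<in>V. of_bool (rich c y) * wg.W y c * wg.W c x * kpow V wg.W (8 * k - 2) x y)"
    proof (intro sum.cong refl)
      fix x y c assume "y \<in> V" "x \<in> V" "c \<in> V"
      then show "of_bool (rich c y) * wg.W x c * wg.W c y * kpow V wg.W (8 * k - 2) y x
        = of_bool (rich c y) * wg.W y c * wg.W c x * kpow V wg.W (8 * k - 2) x y"
        using wg.symB[of x c] wg.symB[of c y] wg.kpow_sym[of y x] by simp
    qed
    also have "\<dots> = Y (\<lambda>x c y. rich c x)" by (rule Y_alt[symmetric])
    finally show ?thesis .
  qed
  have nn: "0 \<le> kpow V wg.W m x y" if "x \<in> V" "y \<in> V" for m x y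
    by (rule kpow_nonneg) (use that wg.nonnegB in auto)
  have "Y (\<lambda>x c y. real (codeg x y) > T) \<le> Y (\<lambda>x c y. real (codeg x y) > T \<and> \<not> rich c y) + Y (\<lambda>x c y. rich c y)"
    unfolding Y_def sum.distrib[symmetric] distrib_right[symmetric]
    by (intro sum_mono mult_right_mono nn wg.nonnegB) auto
  then have Y: "Y (\<lambda>x c y. real (codeg x y) > T) \<le> 2 * sqrt ((s / \<Delta>) * g (4 * k) * g (4 * k - 1))"
    using Y1 Y2 Y2' by linarith
  have rw: "Y (\<lambda>x c y. real (codeg x y) > T) = (1 / \<Delta>) ^ (8 * k) * rich_weight T k"
  proof -
    have e: "8 * k = Suc (Suc (8 * k - 2))" using k by simp
    have p: "(1 / \<Delta>) ^ (8 * k) = (1 / \<Delta>) * ((1 / \<Delta>) * (1 / \<Delta>) ^ (8 * k - 2))"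
      by (subst e) (simp only: power_Suc)
    show ?thesis
      unfolding Y_def rich_weight_def sum_distrib_left p
    proof (intro sum.cong refl)
      fix x c y assume "y \<in> V"
      show "of_bool (real (codeg x y) > T) * wg.W x c * kpow V wg.W 1 c y * kpow V wg.W (8 * k - 2) y x
        = 1 / \<Delta> * (1 / \<Delta> * (1 / \<Delta>) ^ (8 * k - 2)) * (of_bool (real (codeg x y) > T) * A x c * A c y * kpow V A (8 * k - 2) y x)"
        unfolding W1[OF \<open>y \<in> V\<close>] unfolding W_eq kpow_scale by (simp only: mult_ac)
    qed
  qed
  have tr: "g (4 * k) = (1 / \<Delta>) ^ (8 * k) * ktr V A (8 * k)"
    unfolding g_def W_eq ktr_scale by simp
  have Dsum: "(\<Sum>x\<in>V. \<Delta>) > 0" using \<open>V \<noteq> {}\<close> finV Delta_pos by (simp add: card_gt_0_iff)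
  have dens: "1 / K * (\<Sum>x\<in>V. \<Delta>) \<le> (\<Sum>x\<in>V. real (card {y \<in> V. adj x y}))"
    using dense \<open>K > 0\<close> by (simp add: field_simps)
  \<comment> \<open>64 is the 32 of the threshold times 2 for the two kinds of conflict; it appears
    squared because the conflict bound is a square root.\<close>
  have "(64 * real k)\<^sup>2 * s / \<Delta> * ktr V wg.W (2 * (4 * k - 1)) < ktr V wg.W (2 * (4 * k))"
    by (rule wg.ktr_W_ratio[OF Dsum _ dens]) (use \<open>K > 0\<close> k small in auto)
  then have ratio: "(64 * real k)\<^sup>2 * ((s / \<Delta>) * g (4 * k - 1)) < g (4 * k)" by (simp add: g_def)
  have gpos: "g (4 * k) > 0"
    using wg.ktr_W_pos[OF Dsum _ dens, of "4 * k"] \<open>K > 0\<close> unfolding g_def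
    by (smt (verit) divide_pos_pos zero_less_power)
  have "(64 * real k)\<^sup>2 * ((s / \<Delta>) * g (4 * k) * g (4 * k - 1)) \<le> (g (4 * k))\<^sup>2"
    using mult_left_mono[OF less_imp_le[OF ratio], of "g (4 * k)"] gpos by (simp add: power2_eq_square mult_ac)
  then have "sqrt ((64 * real k)\<^sup>2 * ((s / \<Delta>) * g (4 * k) * g (4 * k - 1))) \<le> g (4 * k)"
    using gpos by (intro real_le_lsqrt) auto
  then have "64 * real k * sqrt ((s / \<Delta>) * g (4 * k) * g (4 * k - 1)) \<le> g (4 * k)"
    unfolding real_sqrt_mult[of "(64 * real k)\<^sup>2"] real_sqrt_abs by simp
  then have "32 * k * Y (\<lambda>x c y. real (codeg x y) > T) \<le> g (4 * k)"
    using mult_left_mono[OF Y, of "32 * real k"] by simp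
  then have "(1 / \<Delta>) ^ (8 * k) * (32 * k * rich_weight T k) \<le> (1 / \<Delta>) ^ (8 * k) * ktr V A (8 * k)"
    unfolding rw tr by (simp only: mult_ac)
  then show False using rich Delta_pos by (simp add: mult_le_cancel_left_pos)
qed

end

section \<open>Rich neighbourhoods\<close>

text \<open>Closed walks \<open>b\<^sub>1, u\<^sub>1, b\<^sub>2, u\<^sub>2, \<dots>\<close> with all \<open>b\<^sub>i\<close> in the neighbourhood of \<^term>\<open>v\<close>, consecutive \<open>b\<^sub>i\<close> having
  codegree about \<^term>\<open>t\<close>: the lower bound makes the \<open>u\<^sub>i\<close> flexible, the upper bound the \<open>b\<^sub>i\<close>.\<close>

locale rich_spot = bounded_graph V adj \<Delta> VG EG
  for V :: "'v set" and adj and \<Delta> and VG and EG +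
  fixes v :: 'v and t \<tau> :: real
  assumes v: "v \<in> V" and t_pos: "t > 0"
begin

definition B :: "'v set" where "B = {b \<in> V. adj v b}"

definition Q :: "'v \<Rightarrow> 'v \<Rightarrow> bool" where
  "Q b b' \<longleftrightarrow> t < real (codeg b b') \<and> real (codeg b b') \<le> \<tau>"

text \<open>Two-step walks of the host graph between \<open>b\<close> and \<open>b'\<close>,
  restricted to pairs in the codegree window: the kernel left on \<open>B\<close> once the vertices
  in between are summed out.\<close>

definition Nk :: "'v \<Rightarrow> 'v \<Rightarrow> real" where
  "Nk b b' = of_bool (Q b b') * real (codeg b b')"

definition EE :: "('v \<times> 'v) set" where
  "EE = {e. fst e \<in> B \<and> adj (fst e) (snd e)}"

definition R :: "'v \<times> 'v \<Rightarrow> 'v \<times> 'v \<Rightarrow> bool" where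
  "R e f \<longleftrightarrow> adj (snd e) (fst f) \<and> Q (fst e) (fst f)"

abbreviation Rk :: "'v \<times> 'v \<Rightarrow> 'v \<times> 'v \<Rightarrow> real" where
  "Rk \<equiv> \<lambda>e f. of_bool (R e f)"

lemma B: "finite B" "B \<subseteq> V" "real (card B) \<le> \<Delta>"
  using finV deg[OF v] by (auto simp: B_def)

lemma Q_commute: "Q b b' \<longleftrightarrow> Q b' b"
  by (simp add: Q_def codeg_commute)

lemma Nk_kernel: "sym_kernel B Nk"
  by unfold_locales (auto simp: B Nk_def Q_commute codeg_commute)

lemma EE_subset: "EE \<subseteq> V \<times> V"
  using adjV by (auto simp: EE_def)

lemma finite_EE: "finite EE"
  using finite_subset[OF EE_subset] finV by simp

lemma card_EE_le: "card EE \<le> (card V)\<^sup>2"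
  using card_mono[OF _ EE_subset] finV by (simp add: card_cartesian_product power2_eq_square)

lemma sum_EE: "(\<Sum>e\<in>EE. F (fst e) (snd e)) = (\<Sum>b\<in>B. \<Sum>u\<in>V. A b u * F b u)"
proof -
  have "(\<Sum>b\<in>B. \<Sum>u\<in>V. A b u * F b u) = (\<Sum>e\<in>B \<times> V. A (fst e) (snd e) * F (fst e) (snd e))"
    by (simp add: sum.cartesian_product case_prod_unfold)
  also have "\<dots> = (\<Sum>e\<in>EE. F (fst e) (snd e))"
  proof (intro sum.mono_neutral_cong_right)
    show "EE \<subseteq> B \<times> V" using adjV by (auto simp: EE_def)
  qed (use B finV in \<open>auto simp: EE_def\<close>)
  finally show ?thesis ..
qed

text \<open>The second endpoint \<open>u\<close> of an entry is constrained only by the two vertices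
  of \<open>B\<close> next to it, so it sums out to their codegree. Iterating this reduces powers of
  \<open>Rk\<close> to powers of \<open>Nk\<close>.\<close>

lemma sum_through:
  "(\<Sum>u\<in>V. A b u * (\<Sum>b'\<in>B. of_bool (adj u b' \<and> Q b b') * X b')) = (\<Sum>b'\<in>B. Nk b b' * X b')"
proof -
  have "(\<Sum>u\<in>V. A b u * (\<Sum>b'\<in>B. of_bool (adj u b' \<and> Q b b') * X b'))
    = (\<Sum>u\<in>V. \<Sum>b'\<in>B. A b u * A u b' * (of_bool (Q b b') * X b'))"
    unfolding sum_distrib_left by (intro sum.cong refl) (simp add: of_bool_conj)
  also have "\<dots> = (\<Sum>b'\<in>B. \<Sum>u\<in>V. A b u * A u b' * (of_bool (Q b b') * X b'))" by (rule sum.swap)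
  also have "\<dots> = (\<Sum>b'\<in>B. Nk b b' * X b')"
    unfolding sum_distrib_right[symmetric] codeg_sum[symmetric] Nk_def by (simp only: mult_ac)
  finally show ?thesis .
qed

lemma kpow_Rk: "e \<in> EE \<Longrightarrow> g \<in> EE \<Longrightarrow>
  kpow EE Rk (Suc n) e g = (\<Sum>b\<in>B. of_bool (adj (snd e) b \<and> Q (fst e) b) * kpow B Nk n b (fst g))"
proof (induction n arbitrary: e)
  case 0
  have "fst g \<in> B" using 0 by (auto simp: EE_def)
  have "(\<Sum>b\<in>B. of_bool (adj (snd e) b \<and> Q (fst e) b) * kpow B Nk 0 b (fst g))
    = (\<Sum>b\<in>B. if b = fst g then of_bool (adj (snd e) b \<and> Q (fst e) b) else 0)"
    by (intro sum.cong refl) auto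
  also have "\<dots> = Rk e g" using \<open>fst g \<in> B\<close> B by (simp add: R_def)
  finally show ?case using kpow_one[OF finite_EE 0(2), of Rk e] by (simp only: One_nat_def)
next
  case (Suc n)
  have "kpow EE Rk (Suc (Suc n)) e g = (\<Sum>f\<in>EE. Rk e f * kpow EE Rk (Suc n) f g)" by simp
  also have "\<dots> = (\<Sum>f\<in>EE. of_bool (adj (snd e) (fst f) \<and> Q (fst e) (fst f)) *
      (\<Sum>b\<in>B. of_bool (adj (snd f) b \<and> Q (fst f) b) * kpow B Nk n b (fst g)))"
    unfolding R_def[of e]
    by (intro sum.cong refl) (subst Suc.IH, use Suc.prems in auto)
  also have "\<dots> = (\<Sum>b1\<in>B. \<Sum>u\<in>V. A b1 u * (of_bool (adj (snd e) b1 \<and> Q (fst e) b1) *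
      (\<Sum>b\<in>B. of_bool (adj u b \<and> Q b1 b) * kpow B Nk n b (fst g))))"
    by (rule sum_EE)
  also have "\<dots> = (\<Sum>b1\<in>B. of_bool (adj (snd e) b1 \<and> Q (fst e) b1) *
      (\<Sum>u\<in>V. A b1 u * (\<Sum>b\<in>B. of_bool (adj u b \<and> Q b1 b) * kpow B Nk n b (fst g))))"
    unfolding sum_distrib_left[of "of_bool (adj (snd e) _ \<and> _)" _ V] by (intro sum.cong refl) (rule mult.left_commute)
  also have "\<dots> = (\<Sum>b1\<in>B. of_bool (adj (snd e) b1 \<and> Q (fst e) b1) * kpow B Nk (Suc n) b1 (fst g))"
    unfolding sum_through kpow.simps(2) ..
  finally show ?case .
qed

lemma ktr_Rk: "ktr EE Rk (Suc n) = ktr B Nk (Suc n)"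
proof -
  have "ktr EE Rk (Suc n) = (\<Sum>e\<in>EE. \<Sum>b\<in>B. of_bool (adj (snd e) b \<and> Q (fst e) b) * kpow B Nk n b (fst e))"
    unfolding ktr_def by (intro sum.cong refl kpow_Rk)
  also have "\<dots> = (\<Sum>b1\<in>B. \<Sum>u\<in>V. A b1 u * (\<Sum>b\<in>B. of_bool (adj u b \<and> Q b1 b) * kpow B Nk n b b1))"
    by (rule sum_EE)
  also have "\<dots> = ktr B Nk (Suc n)" unfolding sum_through ktr_def kpow.simps(2) ..
  finally show ?thesis .
qed

lemma kpow_Nk_nonneg: "x \<in> B \<Longrightarrow> y \<in> B \<Longrightarrow> 0 \<le> kpow B Nk n x y"
  by (rule kpow_nonneg) (auto simp: Nk_def)

text \<open>After summing over \<open>g\<close>, only the first endpoint of \<open>e\<close>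
  matters; its second endpoint costs a factor of at most \<open>\<Delta>\<close>.\<close>

lemma sum_kpow_Rk_le:
  "(\<Sum>e\<in>EE. \<Sum>g\<in>EE. kpow EE Rk (Suc n) g e) \<le> \<Delta> * (\<Sum>b\<in>B. \<Sum>b'\<in>B. kpow B Nk (Suc n) b b')"
proof -
  have inner: "(\<Sum>g\<in>EE. kpow EE Rk (Suc n) g e) = (\<Sum>b2\<in>B. kpow B Nk (Suc n) b2 (fst e))" if "e \<in> EE" for e
  proof -
    have "(\<Sum>g\<in>EE. kpow EE Rk (Suc n) g e)
      = (\<Sum>g\<in>EE. \<Sum>b\<in>B. of_bool (adj (snd g) b \<and> Q (fst g) b) * kpow B Nk n b (fst e))"
      using that by (intro sum.cong refl kpow_Rk)
    also have "\<dots> = (\<Sum>b2\<in>B. \<Sum>u\<in>V. A b2 u * (\<Sum>b\<in>B. of_bool (adj u b \<and> Q b2 b) * kpow B Nk n b (fst e)))"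
      by (rule sum_EE)
    also have "\<dots> = (\<Sum>b2\<in>B. kpow B Nk (Suc n) b2 (fst e))" unfolding sum_through kpow.simps(2) ..
    finally show ?thesis .
  qed
  have "(\<Sum>e\<in>EE. \<Sum>g\<in>EE. kpow EE Rk (Suc n) g e) = (\<Sum>e\<in>EE. \<Sum>b2\<in>B. kpow B Nk (Suc n) b2 (fst e))"
    by (intro sum.cong refl inner)
  also have "\<dots> = (\<Sum>b0\<in>B. \<Sum>u\<in>V. A b0 u * (\<Sum>b2\<in>B. kpow B Nk (Suc n) b2 b0))"
    by (rule sum_EE)
  also have "\<dots> = (\<Sum>b0\<in>B. real (card {u \<in> V. adj b0 u}) * (\<Sum>b2\<in>B. kpow B Nk (Suc n) b2 b0))"
    by (simp only: sum_distrib_right[symmetric] sum_of_bool[OF finV])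
  also have "\<dots> \<le> (\<Sum>b0\<in>B. \<Delta> * (\<Sum>b2\<in>B. kpow B Nk (Suc n) b2 b0))"
    by (intro sum_mono mult_right_mono deg sum_nonneg kpow_Nk_nonneg) (use B in auto)
  also have "\<dots> = \<Delta> * (\<Sum>b2\<in>B. \<Sum>b0\<in>B. kpow B Nk (Suc n) b2 b0)"
    unfolding sum_distrib_left[symmetric] by (subst sum.swap) (rule refl)
  finally show ?thesis .
qed

text \<open>Fixing the endpoint of the middle entry in \<open>B\<close> leaves at most
  \<open>\<tau>\<close> choices, a small share unless there are fewer than \<open>\<rho>\<close>
  choices altogether. Fixing its other endpoint may leave too many, but such heavy endpoints lie on
  a small proportion of the closed walks. Walks with few choices are outnumbered by the trace ratio
  of \<open>Nk\<close>.\<close>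

theorem contains_H_in_spot:
  fixes k l :: nat and \<kappa> \<rho> q :: real
  assumes k: "k \<ge> 1" and l: "l \<ge> 1" and "q > 0" "\<rho> \<ge> 0"
    and q: "q \<le> real (card {p \<in> B \<times> B. Q (fst p) (snd p)})"
    and kappa: "\<kappa> > 0" "128 * real k ^ 2 * \<kappa> \<le> 1" and tau: "\<tau> \<le> \<kappa> * \<rho>" and heavy_t: "16 * k \<le> \<kappa> * t"
    and small: "(16 * k * \<rho> * \<Delta>\<^sup>2) ^ (2 * k) * \<Delta> < (t * q / \<Delta>) ^ (4 * k)"
    and tiny: "2 * real (card V) ^ (4 * k) * (4096 * real l ^ 4 * real k ^ 2 * \<kappa>) ^ l < 1"
  shows "contains_copy (H_verts k l) (H_edges k l) VG EG"
proof -
  interpret el: edge_links_in_graph EE R \<kappa> k VG EG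
  proof
    show "fst e \<in> VG \<and> snd e \<in> VG \<and> fst e \<noteq> snd e \<and> {fst e, snd e} \<in> EG" if "e \<in> EE" for e
    proof -
      have "adj (fst e) (snd e)" using that by (simp add: EE_def)
      then show ?thesis using adjV V_VG adj_EG adj_irrefl by (metis subsetD)
    qed
    show "{snd e, fst f} \<in> EG" if "R e f" for e f using that adj_EG by (simp add: R_def)
  qed (use k kappa finite_EE in auto)
  interpret N: sym_kernel B Nk by (rule Nk_kernel)
  define P where "P e g = real (card (el.mid e g))" for e g
  define U where "U e g u = {f \<in> el.mid e g. snd f = u}" for e g u
  define heavy where "heavy e g u \<longleftrightarrow> real (card (U e g u)) > \<kappa> * P e g" for e g u
  have fin_mid: "finite (el.mid e g)" for e g using finite_EE by (simp add: el.mid_def)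
  have mid: "f \<in> el.mid e g \<longleftrightarrow> fst f \<in> B \<and> adj (fst f) (snd f) \<and> adj (snd e) (fst f) \<and> Q (fst e) (fst f)
      \<and> adj (snd f) (fst g) \<and> Q (fst f) (fst g)" for e f g
    unfolding el.mid_def by (auto simp: EE_def R_def)
  have notok: "of_bool (\<not> el.ok e f g) * Rk e f * Rk f g
      \<le> (of_bool (P e g < \<rho>) + of_bool (heavy e g (snd f))) * Rk e f * Rk f g" for e f g
  proof (cases "R e f \<and> R f g \<and> \<not> el.ok e f g")
    case True
    have "{f' \<in> el.mid e g. role True f' = role True f} \<subseteq> Pair (fst f) ` {z \<in> V. adj (fst f) z \<and> adj z (fst g)}"
    proof
      fix f' assume f': "f' \<in> {f' \<in> el.mid e g. role True f' = role True f}"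
      then have "f' = Pair (fst f) (snd f')" by (simp add: role_def prod_eq_iff)
      moreover have "snd f' \<in> {z \<in> V. adj (fst f) z \<and> adj z (fst g)}"
        using f' adjV by (auto simp: mid role_def)
      ultimately show "f' \<in> Pair (fst f) ` {z \<in> V. adj (fst f) z \<and> adj z (fst g)}" by (rule image_eqI)
    qed
    then have "card {f' \<in> el.mid e g. role True f' = role True f} \<le> card (Pair (fst f) ` {z \<in> V. adj (fst f) z \<and> adj z (fst g)})"
      by (rule card_mono[rotated]) (simp add: finV)
    also have "\<dots> \<le> codeg (fst f) (fst g)" unfolding codeg_def by (rule card_image_le) (simp add: finV)
    finally have c1: "real (card {f' \<in> el.mid e g. role True f' = role True f}) \<le> \<tau>"
      using True by (simp add: R_def Q_def)
    have "P e g < \<rho> \<or> heavy e g (snd f)"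
    proof (rule ccontr)
      assume neg: "\<not> ?thesis"
      then have "\<kappa> * \<rho> \<le> \<kappa> * P e g" using kappa by (intro mult_left_mono) auto
      then have "\<tau> \<le> \<kappa> * P e g" using tau by linarith
      moreover have "real (card {f' \<in> el.mid e g. role False f' = role False f}) \<le> \<kappa> * P e g"
        using neg by (simp add: heavy_def U_def role_def)
      ultimately have "real (card {f' \<in> el.mid e g. role b f' = role b f}) \<le> \<kappa> * P e g" for b
        using c1 by (cases b) auto
      then show False using True by (simp add: el.ok_def P_def)
    qed
    then show ?thesis by auto
  qed auto
  \<comment> \<open>At most \<open>1 / \<kappa>\<close> vertices \<open>u\<close> are heavy, as each
    takes more than a share \<open>\<kappa>\<close> of the choices. At most \<open>P e g / t\<close>
    vertices of \<open>B\<close> occur, as each occurs with more than \<open>t\<close> different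
    \<open>u\<close>. The product bounds the number of choices with a heavy
    \<open>u\<close>.\<close>
  have heavy_few: "(\<Sum>f\<in>EE. of_bool (heavy e g (snd f)) * Rk e f * Rk f g) \<le> P e g / (\<kappa> * t)" for e g
  proof (cases "P e g = 0")
    case True
    then have "el.mid e g = {}" using fin_mid by (simp add: P_def)
    then have "\<not> (R e f \<and> R f g)" if "f \<in> EE" for f using that unfolding el.mid_def by blast
    then have "(\<Sum>f\<in>EE. of_bool (heavy e g (snd f)) * Rk e f * Rk f g) = 0"
      by (intro sum.neutral) auto
    then show ?thesis using True by simp
  next
    case False
    then have P: "P e g > 0" by (simp add: P_def)
    define Hv where "Hv = {u \<in> snd ` el.mid e g. heavy e g u}"
    define Bm where "Bm = fst ` el.mid e g"
    have fin: "finite Hv" "finite Bm" using fin_mid by (auto simp: Hv_def Bm_def)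
    have "real (card Hv) * (\<kappa> * P e g) = (\<Sum>u\<in>Hv. \<kappa> * P e g)" by simp
    also have "\<dots> \<le> (\<Sum>u\<in>Hv. real (card (U e g u)))"
      by (intro sum_mono) (auto simp: Hv_def heavy_def)
    also have "\<dots> \<le> (\<Sum>u\<in>snd ` el.mid e g. real (card (U e g u)))"
      by (rule sum_mono2) (use fin_mid in \<open>auto simp: Hv_def\<close>)
    also have "\<dots> = P e g"
    proof -
      have "card (el.mid e g) = (\<Sum>u\<in>snd ` el.mid e g. card (U e g u))"
        using sum.image_gen[OF fin_mid, of "\<lambda>_. 1::nat" e g snd] by (simp add: U_def)
      then show ?thesis by (simp add: P_def)
    qed
    finally have "real (card Hv) * \<kappa> * P e g \<le> 1 * P e g" by (simp add: mult.assoc)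
    then have Hv: "real (card Hv) * \<kappa> \<le> 1" using P by (simp only: mult_le_cancel_right_pos)
    have "real (card Bm) * t = (\<Sum>b\<in>Bm. t)" by simp
    also have "\<dots> \<le> (\<Sum>b\<in>Bm. real (card {f \<in> el.mid e g. fst f = b}))"
    proof (rule sum_mono)
      fix b assume "b \<in> Bm"
      then obtain f where f: "f \<in> el.mid e g" "fst f = b" by (auto simp: Bm_def)
      then have "Pair b ` {z \<in> V. adj b z \<and> adj z (fst g)} \<subseteq> {f \<in> el.mid e g. fst f = b}"
        by (auto simp: mid)
      then have "card (Pair b ` {z \<in> V. adj b z \<and> adj z (fst g)}) \<le> card {f \<in> el.mid e g. fst f = b}"
        by (rule card_mono[rotated]) (simp add: fin_mid)
      then have "codeg b (fst g) \<le> card {f \<in> el.mid e g. fst f = b}"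
        by (simp add: card_image inj_on_def codeg_def)
      moreover have "t < codeg b (fst g)" using f by (auto simp: mid Q_def)
      ultimately show "t \<le> real (card {f \<in> el.mid e g. fst f = b})" by linarith
    qed
    also have "\<dots> = P e g"
    proof -
      have "card (el.mid e g) = (\<Sum>b\<in>Bm. card {f \<in> el.mid e g. fst f = b})"
        using sum.image_gen[OF fin_mid, of "\<lambda>_. 1::nat" e g fst] by (simp add: Bm_def)
      then show ?thesis by (simp add: P_def)
    qed
    finally have Bm: "real (card Bm) * t \<le> P e g" .
    have "(\<Sum>f\<in>EE. of_bool (heavy e g (snd f)) * Rk e f * Rk f g)
      = (\<Sum>f\<in>EE. of_bool (heavy e g (snd f) \<and> R e f \<and> R f g))" by (intro sum.cong) auto
    also have "\<dots> = real (card {f \<in> EE. heavy e g (snd f) \<and> R e f \<and> R f g})"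
      by (rule sum_of_bool[OF finite_EE])
    also have "\<dots> \<le> real (card (Bm \<times> Hv))"
    proof -
      have "{f \<in> EE. heavy e g (snd f) \<and> R e f \<and> R f g} \<subseteq> Bm \<times> Hv"
      proof
        fix f assume f: "f \<in> {f \<in> EE. heavy e g (snd f) \<and> R e f \<and> R f g}"
        then have "f \<in> el.mid e g" by (simp add: el.mid_def)
        then show "f \<in> Bm \<times> Hv" using f by (auto simp: Bm_def Hv_def mem_Times_iff)
      qed
      then show ?thesis using fin by (intro of_nat_mono card_mono) auto
    qed
    also have "\<dots> = (real (card Bm) * t) * (real (card Hv) * \<kappa>) / (\<kappa> * t)"
      using kappa t_pos by (simp add: card_cartesian_product)
    also have "\<dots> \<le> (P e g * 1) / (\<kappa> * t)"
      by (intro divide_right_mono mult_mono Bm Hv) (use P kappa t_pos in auto)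
    finally show ?thesis by simp
  qed
  have P_sum: "P e g = (\<Sum>f\<in>EE. Rk e f * Rk f g)" for e g
  proof -
    have "(\<Sum>f\<in>EE. Rk e f * Rk f g) = (\<Sum>f\<in>EE. of_bool (R e f \<and> R f g))" by (intro sum.cong) auto
    also have "\<dots> = P e g" unfolding P_def el.mid_def by (rule sum_of_bool[OF finite_EE])
    finally show ?thesis ..
  qed
  have nnR: "0 \<le> kpow EE Rk m x y" if "x \<in> EE" "y \<in> EE" for m x y
    by (rule kpow_nonneg) (use that in auto)
  obtain n where n: "4 * k - 2 = Suc n" using k by (cases "4 * k - 2") auto
  let ?g = "\<lambda>i. ktr B Nk (2 * i)"
  have "el.bad_weight \<le> (\<Sum>e\<in>EE. \<Sum>f\<in>EE. \<Sum>g\<in>EE. (of_bool (P e g < \<rho>) + of_bool (heavy e g (snd f))) * Rk e f * Rk f g * kpow EE Rk (4 * k - 2) g e)"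
    unfolding el.bad_weight_def
    by (intro sum_mono) (simp add: mult_right_mono[OF notok nnR] del: kpow.simps)
  also have "\<dots> = (\<Sum>e\<in>EE. \<Sum>g\<in>EE. \<Sum>f\<in>EE. (of_bool (P e g < \<rho>) + of_bool (heavy e g (snd f))) * Rk e f * Rk f g * kpow EE Rk (4 * k - 2) g e)"
    by (rule sum.cong[OF refl], rule sum.swap)
  also have "\<dots> = (\<Sum>e\<in>EE. \<Sum>g\<in>EE. (of_bool (P e g < \<rho>) * P e g + (\<Sum>f\<in>EE. of_bool (heavy e g (snd f)) * Rk e f * Rk f g)) * kpow EE Rk (4 * k - 2) g e)"
    by (intro sum.cong refl)
      (simp only: P_sum sum_distrib_left sum_distrib_right distrib_right sum.distrib mult.assoc)
  also have "\<dots> \<le> (\<Sum>e\<in>EE. \<Sum>g\<in>EE. (\<rho> + P e g / (\<kappa> * t)) * kpow EE Rk (4 * k - 2) g e)"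
  proof (intro sum_mono mult_right_mono add_mono heavy_few nnR)
    show "of_bool (P e g < \<rho>) * P e g \<le> \<rho>" for e g using \<open>\<rho> \<ge> 0\<close> by simp
  qed
  also have "\<dots> = \<rho> * (\<Sum>e\<in>EE. \<Sum>g\<in>EE. kpow EE Rk (4 * k - 2) g e)
      + (\<Sum>e\<in>EE. \<Sum>g\<in>EE. P e g * kpow EE Rk (4 * k - 2) g e) / (\<kappa> * t)"
    by (simp add: distrib_right sum.distrib sum_distrib_left sum_divide_distrib)
  \<comment> \<open>Weighting the return walks by \<open>P e g\<close> counts all closed walks, so
    heavy vertices spoil at most the share \<open>1 / (\<kappa> * t)\<close> of them.\<close>
  also have "(\<Sum>e\<in>EE. \<Sum>g\<in>EE. P e g * kpow EE Rk (4 * k - 2) g e) = ktr EE Rk (4 * k)"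
  proof -
    have P2: "P e g = kpow EE Rk 2 e g" if "g \<in> EE" for e g
    proof -
      have "kpow EE Rk (Suc (Suc 0)) e g = (\<Sum>f\<in>EE. Rk e f * kpow EE Rk (Suc 0) f g)" by simp
      also have "\<dots> = P e g" unfolding P_sum by (intro sum.cong refl) (simp only: kpow_one[OF finite_EE that])
      finally show ?thesis by (simp only: numeral_2_eq_2)
    qed
    have "(\<Sum>e\<in>EE. \<Sum>g\<in>EE. P e g * kpow EE Rk (4 * k - 2) g e) = (\<Sum>e\<in>EE. kpow EE Rk (2 + (4 * k - 2)) e e)"
    proof (rule sum.cong[OF refl])
      fix e assume "e \<in> EE"
      show "(\<Sum>g\<in>EE. P e g * kpow EE Rk (4 * k - 2) g e) = kpow EE Rk (2 + (4 * k - 2)) e e"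
        unfolding kpow_add[OF finite_EE \<open>e \<in> EE\<close>] by (intro sum.cong refl) (simp only: P2)
    qed
    moreover have "2 + (4 * k - 2) = 4 * k" using k by simp
    ultimately show ?thesis by (simp only: ktr_def)
  qed
  finally have bw: "el.bad_weight \<le> \<rho> * (\<Sum>e\<in>EE. \<Sum>g\<in>EE. kpow EE Rk (4 * k - 2) g e) + ktr EE Rk (4 * k) / (\<kappa> * t)" .
  have k2: "4 * k - 2 = 2 * (2 * k - 1)" using k by simp
  have "(\<Sum>e\<in>EE. \<Sum>g\<in>EE. kpow EE Rk (4 * k - 2) g e) \<le> \<Delta> * (\<Sum>b\<in>B. \<Sum>b'\<in>B. kpow B Nk (4 * k - 2) b b')"
    unfolding n by (rule sum_kpow_Rk_le)
  also have "\<dots> \<le> \<Delta> * (card B * ?g (2 * k - 1))"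
    unfolding k2 by (intro mult_left_mono N.sum_kpow_le) (use Delta_pos in auto)
  also have "\<dots> \<le> \<Delta> * (\<Delta> * ?g (2 * k - 1))"
    by (intro mult_left_mono mult_right_mono B)
      (use Delta_pos in \<open>auto simp: N.ktr_double intro!: sum_nonneg\<close>)
  finally have ctx: "(\<Sum>e\<in>EE. \<Sum>g\<in>EE. kpow EE Rk (4 * k - 2) g e) \<le> \<Delta>\<^sup>2 * ?g (2 * k - 1)"
    by (simp add: power2_eq_square mult.assoc)
  have tr: "ktr EE Rk (4 * k) = ?g (2 * k)"
    using ktr_Rk[of "4 * k - 1"] k by (simp add: Suc_diff_1)
  have Bpos: "real (card B) > 0"
  proof -
    have "{p \<in> B \<times> B. Q (fst p) (snd p)} \<noteq> {}" using q \<open>q > 0\<close> by force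
    then show ?thesis using B by (auto simp: card_gt_0_iff)
  qed
  have one: "(\<Sum>x\<in>B. (1::real)\<^sup>2) = card B" by simp
  have "t * q \<le> t * real (card {p \<in> B \<times> B. Q (fst p) (snd p)})" using q t_pos by simp
  also have "\<dots> = (\<Sum>p\<in>B \<times> B. t * of_bool (Q (fst p) (snd p)))"
    using sum_of_bool[of "B \<times> B" "\<lambda>p. Q (fst p) (snd p)"] B by (simp add: sum_distrib_left[symmetric])
  also have "\<dots> \<le> (\<Sum>p\<in>B \<times> B. Nk (fst p) (snd p))"
    by (intro sum_mono) (auto simp: Nk_def Q_def)
  also have "\<dots> = (\<Sum>x\<in>B. \<Sum>y\<in>B. 1 * Nk x y * 1)" by (simp add: sum.cartesian_product case_prod_unfold)
  finally have tq: "t * q \<le> (\<Sum>x\<in>B. \<Sum>y\<in>B. 1 * Nk x y * 1)" .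
  \<comment> \<open>Rayleigh quotient at the constant vector: the entries of \<open>Nk\<close> sum
    to at least \<open>t * q\<close>, and \<open>B\<close> has at most \<open>\<Delta>\<close>
    elements.\<close>
  have nu: "t * q / \<Delta> * (\<Sum>x\<in>B. (1::real)\<^sup>2) \<le> (\<Sum>x\<in>B. \<Sum>y\<in>B. 1 * Nk x y * 1)"
  proof -
    have "t * q / \<Delta> * card B \<le> t * q / \<Delta> * \<Delta>"
      using B \<open>q > 0\<close> t_pos Delta_pos by (intro mult_left_mono) auto
    also have "\<dots> = t * q" using Delta_pos by simp
    finally show ?thesis using tq unfolding one by linarith
  qed
  have nupos: "t * q / \<Delta> > 0" using t_pos \<open>q > 0\<close> Delta_pos by simp
  have gpos: "?g (2 * k) > 0"
    using N.ktr_lower[OF _ nupos nu, of "2 * k"] Bpos nupos unfolding one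
    by (smt (verit) zero_less_power)
  have "16 * k * \<rho> * \<Delta>\<^sup>2 * ?g (2 * k - 1) < ?g (2 * k)"
  proof (rule N.ktr_ratio[OF _ nupos nu])
    have "(16 * k * \<rho> * \<Delta>\<^sup>2) ^ (2 * k) * card B \<le> (16 * k * \<rho> * \<Delta>\<^sup>2) ^ (2 * k) * \<Delta>"
      using B \<open>\<rho> \<ge> 0\<close> by (intro mult_left_mono) auto
    then show "(16 * k * \<rho> * \<Delta>\<^sup>2) ^ (2 * k) * card B < (t * q / \<Delta>) ^ (2 * (2 * k))" using small by simp
  qed (use Bpos k one in auto)
  then have part1: "16 * k * (\<rho> * (\<Sum>e\<in>EE. \<Sum>g\<in>EE. kpow EE Rk (4 * k - 2) g e)) \<le> ?g (2 * k)"
    using mult_left_mono[OF ctx, of "16 * k * \<rho>"] \<open>\<rho> \<ge> 0\<close> by (simp add: mult.assoc)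
  have part2: "16 * k * (?g (2 * k) / (\<kappa> * t)) \<le> ?g (2 * k)"
    using mult_right_mono[OF heavy_t, of "?g (2 * k)"] gpos kappa t_pos by (simp add: field_simps)
  show ?thesis
  proof (rule el.contains_H_if_mostly_ok)
    show "0 < ktr EE Rk (4 * k)" using tr gpos by simp
    have "16 * real k * el.bad_weight \<le> 16 * real k * (\<rho> * (\<Sum>e\<in>EE. \<Sum>g\<in>EE. kpow EE Rk (4 * k - 2) g e) + ktr EE Rk (4 * k) / (\<kappa> * t))"
      using bw by (intro mult_left_mono) auto
    also have "\<dots> \<le> 2 * ?g (2 * k)" using part1 part2 unfolding tr distrib_left by linarith
    finally show "8 * real k * el.bad_weight \<le> ktr EE Rk (4 * k)" unfolding tr by simp
    have "real (card EE) ^ (2 * k) \<le> (real (card V) ^ 2) ^ (2 * k)"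
      using card_EE_le by (intro power_mono) (auto simp flip: of_nat_power)
    also have "\<dots> = real (card V) ^ (4 * k)" by (simp flip: power_mult)
    finally have "2 * real (card EE) ^ (2 * k) * (4096 * real l ^ 4 * real k ^ 2 * \<kappa>) ^ l
      \<le> 2 * real (card V) ^ (4 * k) * (4096 * real l ^ 4 * real k ^ 2 * \<kappa>) ^ l"
      using kappa by (intro mult_right_mono) auto
    then show "2 * real (card EE) ^ (2 * k) * (4096 * real l ^ 4 * real k ^ 2 * \<kappa>) ^ l < 1" using tiny by simp
  qed (use kappa l in auto)
qed

end

section \<open>Almost regular graphs\<close>

context bounded_graph
begin

lemma codeg_le: "codeg x y \<le> card V"
  unfolding codeg_def by (rule card_mono) (use finV in auto)

lemma sum_deg: "(\<Sum>x\<in>V. real (card {y \<in> V. adj x y})) = (\<Sum>x\<in>V. \<Sum>y\<in>V. 1 * A x y * 1)"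
  by (simp add: sum_of_bool[OF finV])

lemma ktr_A_lower:
  fixes K :: real
  assumes dense: "card V * \<Delta> \<le> K * (\<Sum>x\<in>V. real (card {y \<in> V. adj x y}))" and "V \<noteq> {}" "K > 0"
  shows "(\<Delta> / K) ^ (2 * n) \<le> ktr V A (2 * n)"
proof (rule ktr_lower[where v = "\<lambda>_. 1"])
  show "0 < (\<Sum>x\<in>V. (1::real)\<^sup>2)" using finV \<open>V \<noteq> {}\<close> by (simp add: card_gt_0_iff)
  show "\<Delta> / K * (\<Sum>x\<in>V. (1::real)\<^sup>2) \<le> (\<Sum>x\<in>V. \<Sum>y\<in>V. 1 * A x y * 1)"
    using dense \<open>K > 0\<close> unfolding sum_deg by (simp add: field_simps)
qed (use Delta_pos \<open>K > 0\<close> in simp)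

text \<open>Pigeonhole over the \<open>J\<close> scales \<open>T * y ^ j\<close>, which cover all
  codegrees above \<open>T\<close> because none exceeds \<open>card V\<close>.\<close>

lemma codeg_range:
  fixes T y q :: real
  assumes J: "J \<ge> 1" "card V \<le> T * y ^ J" and "y \<ge> 1" "T > 0"
    and q: "q \<le> real (card {p \<in> V \<times> V. adj v (fst p) \<and> adj v (snd p) \<and> real (codeg (fst p) (snd p)) > T})"
  shows "\<exists>t\<ge>T. q / J \<le> real (card {p \<in> V \<times> V. adj v (fst p) \<and> adj v (snd p)
    \<and> t < real (codeg (fst p) (snd p)) \<and> real (codeg (fst p) (snd p)) \<le> t * y})"
proof (rule ccontr)
  assume neg: "\<not> ?thesis"
  define S where "S j = {p \<in> V \<times> V. adj v (fst p) \<and> adj v (snd p)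
    \<and> T * y ^ j < real (codeg (fst p) (snd p)) \<and> real (codeg (fst p) (snd p)) \<le> T * y ^ j * y}" for j
  let ?X = "{p \<in> V \<times> V. adj v (fst p) \<and> adj v (snd p) \<and> real (codeg (fst p) (snd p)) > T}"
  have fin: "finite (S j)" for j using finV by (simp add: S_def)
  have small: "real (card (S j)) < q / J" for j
  proof -
    have "T * 1 \<le> T * y ^ j" using \<open>T > 0\<close> \<open>y \<ge> 1\<close> by (intro mult_left_mono) auto
    then show ?thesis using neg unfolding S_def by force
  qed
  have "?X \<subseteq> (\<Union>j<J. S j)"
  proof
    fix p assume p: "p \<in> ?X"
    let ?c = "real (codeg (fst p) (snd p))"
    define i where "i = (LEAST i. ?c \<le> T * y ^ i)"
    have top: "?c \<le> T * y ^ J" using codeg_le[of "fst p" "snd p"] J(2) by linarith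
    have ci: "?c \<le> T * y ^ i" unfolding i_def by (rule LeastI, rule top)
    have "i \<noteq> 0" using p ci by (cases i) auto
    then obtain j where j: "i = Suc j" by (cases i) auto
    have "\<not> ?c \<le> T * y ^ j" using not_less_Least[of j "\<lambda>i. ?c \<le> T * y ^ i"] j unfolding i_def by simp
    moreover have "i \<le> J" unfolding i_def by (rule Least_le, rule top)
    ultimately have "p \<in> S j" "j < J" using p ci j by (auto simp: S_def mult_ac)
    then show "p \<in> (\<Union>j<J. S j)" by blast
  qed
  then have "card ?X \<le> card (\<Union>j<J. S j)" by (rule card_mono[rotated]) (use fin in auto)
  also have "\<dots> \<le> (\<Sum>j<J. card (S j))" by (rule card_UN_le) simp
  finally have "q \<le> (\<Sum>j<J. real (card (S j)))" using q unfolding of_nat_sum[symmetric]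
    by (meson of_nat_le_iff order_trans)
  also have "\<dots> < (\<Sum>j<J. q / J)" by (rule sum_strict_mono) (use J small in \<open>auto simp: lessThan_empty_iff\<close>)
  also have "\<dots> = q" using J by simp
  finally show False by simp
qed

theorem contains_H_if_almost_regular:
  fixes k l J :: nat and K y C1 C2 C3 C4 :: real
  defines "C1 \<equiv> 16 * real k * K ^ (8 * k)" and "C2 \<equiv> 4096 * real l ^ 4 * real k ^ 2"
    and "C3 \<equiv> 2 * (64 * real k)\<^sup>2 * K\<^sup>2" and "C4 \<equiv> 16 * real k * K * (real J)\<^sup>2 * C3 ^ 4"
  assumes k: "k \<ge> 1" and l: "l \<ge> 1" and J: "J \<ge> 1" and K: "K \<ge> 1" and "V \<noteq> {}"
    and dense: "card V * \<Delta> \<le> K * (\<Sum>x\<in>V. real (card {y \<in> V. adj x y}))"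
    and y_large: "128 * real k ^ 2 + C1 * (C4 + 16 * real k) + 1 \<le> y"
    and n_large: "2 * C2 ^ l < card V"
    and yk: "card V \<le> y ^ (4 * k)" and yl: "real (card V) ^ (8 * k) \<le> y ^ (2 * l)" and yJ: "card V \<le> y ^ J"
    and Delta: "card V * y ^ 12 \<le> \<Delta> ^ 3"
  shows "contains_copy (H_verts k l) (H_edges k l) VG EG"
proof -
  define x where "x = real (card V)"
  have x1: "x \<ge> 1" unfolding x_def using \<open>V \<noteq> {}\<close> finV by (simp add: Suc_leI card_gt_0_iff)
  have k1: "real k \<ge> 1" using k by simp
  have KK: "K ^ m \<ge> 1" for m using K by simp
  have C1: "C1 \<ge> 1" unfolding C1_def using k1 KK[of "8 * k"]
    by (smt (verit) mult_le_cancel_left1 mult_left_le)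
  have C3: "C3 \<ge> 1"
  proof -
    have "1 * 1 \<le> real k ^ 2 * K\<^sup>2" by (intro mult_mono) (use k1 KK[of 2] in auto)
    then show ?thesis unfolding C3_def by (simp add: power_mult_distrib)
  qed
  have C4: "C4 \<ge> 0" unfolding C4_def using C3 K by simp
  have C2: "C2 \<ge> 0" unfolding C2_def by simp
  have prod0: "C1 * C4 \<ge> 0" "C1 * (16 * real k) \<ge> 0" using C1 C4 by auto
  have ysplit: "128 * real k ^ 2 + C1 * C4 + C1 * (16 * real k) + 1 \<le> y"
    using y_large by (simp add: distrib_left)
  have y1: "y \<ge> 1" using ysplit prod0 by (smt (verit) zero_le_power2)
  have ypow: "y \<le> y ^ m" if "m \<ge> 1" for m using power_increasing[OF that y1] by simp
  have y128: "128 * real k ^ 2 \<le> y" and yC4: "C1 * C4 < y" and y16: "C1 * (16 * real k) \<le> y"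
    using ysplit prod0 zero_le_power2[of "real k"] by linarith+
  have "C1 * 1 \<le> C1 * (16 * real k)" using C1 k1 by (intro mult_left_mono) auto
  then have yC1: "C1 \<le> y" using y16 by simp
  \<comment> \<open>The \<open>l\<close>-th power of this share is at most the inverse of
    \<open>card V ^ (8 * k)\<close>; that outweighs the number of columns, at most
    \<open>card V ^ (4 * k)\<close> on either side, together with \<open>C2 ^ l\<close>.\<close>
  define \<kappa> where "\<kappa> = 1 / y\<^sup>2"
  \<comment> \<open>The typical number of 3-walks between two vertices, with \<open>C1\<close>
    chosen so that \<open>16 * k * \<rho> * card V * \<Delta> ^ (8 * k - 3)\<close> equals
    \<open>(\<Delta> / K) ^ (8 * k)\<close>, the lower bound for the trace.\<close>
  define \<rho> where "\<rho> = \<Delta> ^ 3 / (C1 * x)"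
  define T where "T = \<kappa> * \<rho>"
  have kappa: "\<kappa> > 0" "128 * real k ^ 2 * \<kappa> \<le> 1"
    using y1 y128 ypow[of 2] by (simp_all add: \<kappa>_def)
  have rho: "\<rho> \<ge> 0" using Delta_pos C1 x1 by (simp add: \<rho>_def)
  have T_large: "y ^ 10 / C1 \<le> T"
  proof -
    have "y ^ 12 / C1 \<le> \<rho>"
      using Delta C1 x1 unfolding \<rho>_def x_def[symmetric] by (simp add: field_simps)
    then have "y ^ 12 / C1 / y\<^sup>2 \<le> \<rho> / y\<^sup>2" by (rule divide_right_mono) simp
    then have "y ^ 12 / C1 / y\<^sup>2 \<le> T" by (simp add: T_def \<kappa>_def)
    moreover have "y ^ 12 / C1 / y\<^sup>2 = y ^ 10 / C1"
    proof -
      have e: "y ^ 12 = y ^ 10 * y\<^sup>2" by (simp flip: power_add)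
      show ?thesis unfolding e divide_divide_eq_left
        by (rule mult_divide_mult_cancel_right) (use y1 in simp)
    qed
    ultimately show ?thesis by simp
  qed
  have T1: "T \<ge> 1"
  proof -
    have "C1 \<le> y ^ 10" using yC1 ypow[of 10] by linarith
    then show ?thesis using T_large C1 by (smt (verit) le_divide_eq_1_pos)
  qed
  have ktr: "(\<Delta> / K) ^ (8 * k) \<le> ktr V A (8 * k)"
    using ktr_A_lower[OF dense \<open>V \<noteq> {}\<close>, of "4 * k"] K by simp
  have tiny: "2 * real (card V) ^ (4 * k) * (4096 * real l ^ 4 * real k ^ 2 * \<kappa>) ^ l < 1"
  proof -
    have p: "x ^ (8 * k) = x ^ (4 * k) * x ^ (4 * k)" by (simp flip: power_add)
    have "2 * C2 ^ l < x" using n_large by (simp add: x_def)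
    also have "x \<le> x ^ (4 * k)" using power_increasing[of 1 "4 * k" x] x1 k by simp
    finally have "2 * C2 ^ l < x ^ (4 * k)" .
    then have "x ^ (4 * k) * (2 * C2 ^ l) < x ^ (8 * k)" unfolding p using x1 by simp
    also have "\<dots> \<le> y ^ (2 * l)" using yl by (simp add: x_def)
    finally have "x ^ (4 * k) * (2 * C2 ^ l) < y ^ (2 * l)" .
    then have "x ^ (4 * k) * (2 * C2 ^ l) / y ^ (2 * l) < 1"
      by (subst divide_less_eq_1_pos) (use y1 in auto)
    moreover have "2 * x ^ (4 * k) * (C2 * \<kappa>) ^ l = x ^ (4 * k) * (2 * C2 ^ l) / y ^ (2 * l)"
      by (simp add: \<kappa>_def power_mult_distrib power_divide power_mult)
    ultimately have "2 * x ^ (4 * k) * (C2 * \<kappa>) ^ l < 1" by linarith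
    then show ?thesis by (simp add: C2_def x_def)
  qed
  show ?thesis
  proof (cases "32 * k * rich_weight T k \<le> ktr V A (8 * k)")
    case True
    show ?thesis
    proof (rule contains_H_if_not_rich[OF k l _ _ _ rho])
      show "0 < ktr V A (8 * k)" using ktr Delta_pos K by (smt (verit) divide_pos_pos zero_less_power)
      show "32 * k * rich_weight (\<kappa> * \<rho>) k \<le> ktr V A (8 * k)" using True by (simp add: T_def)
      have "\<Delta> ^ (8 * k) = \<Delta> ^ 3 * \<Delta> ^ (8 * k - 3)" using k by (simp flip: power_add)
      then have "16 * k * \<rho> * x * \<Delta> ^ (8 * k - 3) = 16 * k * \<Delta> ^ (8 * k) / C1"
        using x1 by (simp add: \<rho>_def)
      also have "\<dots> = (\<Delta> / K) ^ (8 * k)" unfolding C1_def using k1 by (simp add: power_divide)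
      finally show "16 * k * \<rho> * card V * \<Delta> ^ (8 * k - 3) \<le> ktr V A (8 * k)" using ktr by (simp add: x_def)
    qed (use kappa tiny in auto)
  next
    case False
    \<comment> \<open>\<open>C3\<close> makes \<open>(64 * k)\<^sup>2 * s / \<Delta>\<close> equal
      to \<open>1 / (2 * K\<^sup>2 * y)\<close>. Its \<open>4 * k\<close>-th power absorbs
      \<open>card V\<close>, and the 2 makes the inequality strict.\<close>
    define s where "s = \<Delta> / (C3 * y)"
    have s: "s > 0" using Delta_pos C3 y1 by (simp add: s_def)
    have "\<exists>v\<in>V. s\<^sup>2 \<le> real (card {p \<in> V \<times> V. adj v (fst p) \<and> adj v (snd p) \<and> real (codeg (fst p) (snd p)) > T})"
    proof (rule rich_neighbourhood[OF k dense \<open>V \<noteq> {}\<close> _ s])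
      have "(64 * real k)\<^sup>2 * s / \<Delta> = 1 / (2 * K\<^sup>2 * y)"
        using Delta_pos C3 y1 K k1 by (simp add: s_def C3_def field_simps)
      then have "((64 * real k)\<^sup>2 * s / \<Delta>) ^ (4 * k) * x = x / (2 ^ (4 * k) * (K\<^sup>2) ^ (4 * k) * y ^ (4 * k))"
        by (simp add: power_divide power_mult_distrib)
      also have "\<dots> \<le> 1 / (2 ^ (4 * k) * (K\<^sup>2) ^ (4 * k))"
        using yk y1 K unfolding x_def[symmetric] by (simp add: field_simps)
      also have "\<dots> < 1 / (1 * (K\<^sup>2) ^ (4 * k))"
        using K k by (intro divide_strict_left_mono mult_strict_right_mono) auto
      also have "\<dots> = (1 / K) ^ (8 * k)" by (simp add: power_divide flip: power_mult)
      finally show "((64 * real k)\<^sup>2 * s / \<Delta>) ^ (4 * k) * card V < (1 / K) ^ (8 * k)" by (simp add: x_def)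
      show "ktr V A (8 * k) < 32 * real k * rich_weight T k" using False by simp
    qed (use K in auto)
    then obtain v where v: "v \<in> V"
      "s\<^sup>2 \<le> real (card {p \<in> V \<times> V. adj v (fst p) \<and> adj v (snd p) \<and> real (codeg (fst p) (snd p)) > T})"
      by blast
    have "card V \<le> T * y ^ J"
    proof -
      have "1 * y ^ J \<le> T * y ^ J" using T1 y1 by (intro mult_right_mono) auto
      then show ?thesis using yJ by linarith
    qed
    from codeg_range[OF J this y1 _ v(2)] T1 obtain t where t: "t \<ge> T"
      and tq: "s\<^sup>2 / J \<le> real (card {p \<in> V \<times> V. adj v (fst p) \<and> adj v (snd p)
        \<and> t < real (codeg (fst p) (snd p)) \<and> real (codeg (fst p) (snd p)) \<le> t * y})" by auto
    have t_pos: "t > 0" using t T1 by linarith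
    interpret rs: rich_spot V adj \<Delta> VG EG v t "t * y"
      by unfold_locales (use v t_pos in auto)
    have set_eq: "{p \<in> rs.B \<times> rs.B. rs.Q (fst p) (snd p)} = {p \<in> V \<times> V. adj v (fst p) \<and> adj v (snd p)
        \<and> t < real (codeg (fst p) (snd p)) \<and> real (codeg (fst p) (snd p)) \<le> t * y}"
      by (auto simp: rs.B_def rs.Q_def)
    show ?thesis
    \<comment> \<open>Codegrees in the window reach \<open>t * y\<close>, so
      \<open>t * y ^ 3\<close> choices are exactly what a share of \<open>1 / y\<^sup>2\<close>
      demands.\<close>
    proof (rule rs.contains_H_in_spot[OF k l, where q = "s\<^sup>2 / J" and \<kappa> = \<kappa> and \<rho> = "t * y ^ 3"])
      show "s\<^sup>2 / J \<le> real (card {p \<in> rs.B \<times> rs.B. rs.Q (fst p) (snd p)})" using tq unfolding set_eq .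
      show "t * y \<le> \<kappa> * (t * y ^ 3)"
        using y1 by (simp add: \<kappa>_def power2_eq_square power3_eq_cube)
      have "16 * k * y\<^sup>2 \<le> t"
      proof -
        have "16 * real k * C1 \<le> y ^ 8" using y16 ypow[of 8] by (simp add: mult.commute)
        then have "16 * real k * C1 * y\<^sup>2 \<le> y ^ 8 * y\<^sup>2" using y1 by (intro mult_right_mono) auto
        also have "\<dots> = y ^ 10" by (simp flip: power_add)
        finally have "16 * real k * y\<^sup>2 \<le> y ^ 10 / C1" using C1 by (simp add: field_simps)
        then show ?thesis using T_large t by linarith
      qed
      then show "real (16 * k) \<le> \<kappa> * t" using y1 by (simp add: \<kappa>_def field_simps)
      show "(16 * k * (t * y ^ 3) * \<Delta>\<^sup>2) ^ (2 * k) * \<Delta> < (t * (s\<^sup>2 / J) / \<Delta>) ^ (4 * k)"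
      proof -
        \<comment> \<open>The single factor \<open>\<Delta>\<close> has to be absorbed into a
          \<open>2 * k\<close>-th power: it is at most \<open>K * card V\<close>, whose
          \<open>2 * k\<close>-th root is at most \<open>K * y\<^sup>2\<close>.\<close>
        have "(\<Sum>v\<in>V. real (card {y \<in> V. adj v y})) \<le> (\<Sum>v\<in>V. x)"
          unfolding x_def by (intro sum_mono of_nat_mono card_mono) (use finV in auto)
        then have "K * (\<Sum>v\<in>V. real (card {y \<in> V. adj v y})) \<le> K * (x * x)"
          using K by (intro mult_left_mono) (auto simp: x_def)
        then have "x * \<Delta> \<le> x * (K * x)" using dense by (simp add: x_def mult_ac)
        then have "\<Delta> \<le> K * x" using x1 by simp
        also have "\<dots> \<le> K ^ (2 * k) * y ^ (4 * k)"
          using yk x1 power_increasing[of 1 "2 * k" K] K k unfolding x_def[symmetric]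
          by (intro mult_mono) auto
        also have "\<dots> = (K * y\<^sup>2) ^ (2 * k)" by (simp add: power_mult_distrib flip: power_mult)
        finally have Dle: "\<Delta> \<le> (K * y\<^sup>2) ^ (2 * k)" .
        \<comment> \<open>Powers of \<open>y\<close>: 3 from the number of choices, 2 from the root
          of \<open>\<Delta>\<close>, 4 from \<open>s ^ 4\<close>. So \<open>t\<close> must exceed a
          constant times \<open>y ^ 9\<close>; one more power pays for the constants and two for
          \<open>\<kappa>\<close> in \<open>T\<close>, which explains the exponent 12 in the
          hypothesis on \<open>\<Delta>\<close>.\<close>
        have main: "16 * k * (t * y ^ 3) * \<Delta>\<^sup>2 * (K * y\<^sup>2) < (t * (s\<^sup>2 / J) / \<Delta>)\<^sup>2"
        proof -
          have "C1 * C4 * y ^ 9 < y * y ^ 9" using yC4 y1 by simp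
          also have "\<dots> = y ^ 10" by (simp flip: power_Suc)
          finally have "C4 * y ^ 9 < y ^ 10 / C1" using C1 by (simp add: field_simps)
          then have "C4 * y ^ 9 < t" using T_large t by linarith
          then have "16 * real k * K * (real J)\<^sup>2 * C3 ^ 4 * y ^ 9 * (t * \<Delta>\<^sup>2) < t * (t * \<Delta>\<^sup>2)"
            unfolding C4_def using t_pos Delta_pos by (intro mult_strict_right_mono) auto
          then have "16 * k * (t * y ^ 5) * \<Delta>\<^sup>2 * K * ((real J)\<^sup>2 * C3 ^ 4 * y ^ 4) < t\<^sup>2 * \<Delta>\<^sup>2"
            by (simp add: power2_eq_square mult_ac flip: power_add power_Suc)
          moreover have pos: "(real J)\<^sup>2 * C3 ^ 4 * y ^ 4 > 0" using J C3 y1 by simp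
          ultimately have "16 * k * (t * y ^ 5) * \<Delta>\<^sup>2 * K < t\<^sup>2 * \<Delta>\<^sup>2 / ((real J)\<^sup>2 * C3 ^ 4 * y ^ 4)"
            using pos_less_divide_eq by blast
          moreover have "(t * (s\<^sup>2 / J) / \<Delta>)\<^sup>2 = t\<^sup>2 * \<Delta>\<^sup>2 / ((real J)\<^sup>2 * C3 ^ 4 * y ^ 4)"
            using Delta_pos C3 y1 J by (simp add: s_def field_simps power2_eq_square power4_eq_xxxx)
          moreover have "16 * k * (t * y ^ 3) * \<Delta>\<^sup>2 * (K * y\<^sup>2) = 16 * k * (t * y ^ 5) * \<Delta>\<^sup>2 * K"
            by (simp add: mult_ac flip: power_add)
          ultimately show ?thesis by argo
        qed
        have "(16 * k * (t * y ^ 3) * \<Delta>\<^sup>2) ^ (2 * k) * \<Delta> \<le> (16 * k * (t * y ^ 3) * \<Delta>\<^sup>2) ^ (2 * k) * (K * y\<^sup>2) ^ (2 * k)"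
          using Dle t_pos y1 by (intro mult_left_mono) auto
        also have "\<dots> = (16 * k * (t * y ^ 3) * \<Delta>\<^sup>2 * (K * y\<^sup>2)) ^ (2 * k)" by (simp only: power_mult_distrib)
        also have "\<dots> < ((t * (s\<^sup>2 / J) / \<Delta>)\<^sup>2) ^ (2 * k)"
          by (rule power_strict_mono[OF main]) (use t_pos y1 K k in auto)
        also have "\<dots> = (t * (s\<^sup>2 / J) / \<Delta>) ^ (4 * k)" by (simp flip: power_mult)
        finally show ?thesis .
      qed
    qed (use kappa tiny s J t_pos y1 in auto)
  qed
qed

end

section \<open>Passing to an almost regular subgraph\<close>

text \<open>Removing an element of least weight does not lower the average.\<close>

lemma exists_subset_above_average:
  fixes w :: "'a \<Rightarrow> real"
  assumes "finite S" "a \<le> card S"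
  shows "\<exists>Y\<subseteq>S. card Y = a \<and> real a * sum w S \<le> real (card S) * sum w Y"
  using assms
proof (induction "card S - a" arbitrary: S)
  case 0
  then show ?case by (intro exI[of _ S]) auto
next
  case (Suc n)
  then have lt: "a < card S" by simp
  then have "S \<noteq> {}" by auto
  then obtain m where m: "m \<in> S" "\<And>x. x \<in> S \<Longrightarrow> w m \<le> w x"
  proof -
    have "Min (w ` S) \<in> w ` S" using Suc.prems(1) \<open>S \<noteq> {}\<close> by (intro Min_in) auto
    then obtain m where "m \<in> S" "w m = Min (w ` S)" by auto
    then show ?thesis using that[of m] Suc.prems(1) by simp
  qed
  define S' where "S' = S - {m}"
  have card': "card S' = card S - 1" "real (card S') = real (card S) - 1"
    using m Suc.prems lt by (auto simp: S'_def)
  have "n = card S' - a" "finite S'" "a \<le> card S'" using Suc lt card' by (auto simp: S'_def)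
  from Suc.hyps(1)[OF this] obtain Y where Y: "Y \<subseteq> S'" "card Y = a" "real a * sum w S' \<le> real (card S') * sum w Y" by blast
  have sumS: "sum w S = w m + sum w S'" using m Suc.prems by (simp add: S'_def sum.remove)
  have "real (card S) * w m = (\<Sum>x\<in>S. w m)" by simp
  also have "\<dots> \<le> sum w S" by (intro sum_mono m)
  finally have "real (card S') * sum w S \<le> real (card S) * sum w S'"
    unfolding card'(2) sumS by (simp add: algebra_simps)
  then have "real a * (real (card S') * sum w S) \<le> real a * (real (card S) * sum w S')"
    by (rule mult_left_mono) simp
  also have "\<dots> = real (card S) * (real a * sum w S')" by simp
  also have "\<dots> \<le> real (card S) * (real (card S') * sum w Y)" by (intro mult_left_mono Y) simp
  finally have "real (card S') * (real a * sum w S) \<le> real (card S') * (real (card S) * sum w Y)"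
    by (simp only: mult_ac)
  moreover have "real a * sum w S \<le> real (card S) * sum w Y" if "card S' = 0"
  proof -
    have "a = 0" using \<open>a \<le> card S'\<close> that by simp
    then have "Y = {}" using Y \<open>finite S'\<close> finite_subset[of Y S'] by auto
    then show ?thesis using \<open>a = 0\<close> by simp
  qed
  ultimately have "real a * sum w S \<le> real (card S) * sum w Y"
    by (cases "card S' = 0") auto
  then show ?case using Y S'_def by (intro exI[of _ Y]) auto
qed

text \<open>Otherwise \<^term>\<open>X\<close>, together with the equally many vertices receiving most edges from \<^term>\<open>X\<close>, would span too
  many edges for the maximality of \<^term>\<open>S\<close>.\<close>

lemma few_edges_at_large_degrees:
  fixes S :: "'a set" and \<beta> M :: real
  assumes fin: "finite S" and ne: "S \<noteq> {}" and beta: "4/3 \<le> \<beta>" "\<beta> \<le> 2" and M: "M > 0"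
    and e_S: "real (card {p \<in> S \<times> S. adj (fst p) (snd p)}) = M * real (card S) powr \<beta>"
    and max: "\<And>T. T \<subseteq> S \<Longrightarrow> T \<noteq> {} \<Longrightarrow> real (card {p \<in> T \<times> T. adj (fst p) (snd p)}) \<le> M * real (card T) powr \<beta>"
    and X: "X = {x \<in> S. real (card {y \<in> S. adj x y}) > 1024 * M * real (card S) powr (\<beta> - 1)}"
  shows "(\<Sum>x\<in>X. real (card {y \<in> S. adj x y})) \<le> M * real (card S) powr \<beta> / 4"
proof (cases "X = {}")
  case True
  then show ?thesis using M by simp
next
  case False
  have XS: "X \<subseteq> S" "finite X" using X fin by auto
  define a where "a = real (card X)"
  define N where "N = real (card S)"
  have a: "a \<ge> 1" unfolding a_def using False XS by (simp add: Suc_leI card_gt_0_iff)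
  have aN: "a \<le> N" unfolding a_def N_def using card_mono[OF fin XS(1)] by simp
  define e where "e = (\<Sum>x\<in>X. real (card {y \<in> S. adj x y}))"
  have swap: "(\<Sum>x\<in>X. real (card {y \<in> Y. adj x y})) = (\<Sum>y\<in>Y. real (card {x \<in> X. adj x y}))" if "finite Y" for Y
    using XS that by (simp only: sum_of_bool[symmetric]) (rule sum.swap)
  \<comment> \<open>\<open>Y\<close> receives at least the proportion \<open>a / N\<close> of the
    edges counted by \<open>e\<close>.\<close>
  obtain Y where Y: "Y \<subseteq> S" "card Y = card X"
    "a * (\<Sum>y\<in>S. real (card {x \<in> X. adj x y})) \<le> N * (\<Sum>y\<in>Y. real (card {x \<in> X. adj x y}))"
    using exists_subset_above_average[OF fin card_mono[OF fin XS(1)], of "\<lambda>y. real (card {x \<in> X. adj x y})"]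
    unfolding a_def N_def by blast
  have finY: "finite Y" using Y fin finite_subset by blast
  have "(\<Sum>y\<in>Y. real (card {x \<in> X. adj x y})) = (\<Sum>x\<in>X. real (card {y \<in> Y. adj x y}))" using swap[OF finY] by simp
  also have "\<dots> = real (card (SIGMA x:X. {y \<in> Y. adj x y}))" using XS finY by simp
  also have "\<dots> \<le> real (card {p \<in> (X \<union> Y) \<times> (X \<union> Y). adj (fst p) (snd p)})"
    by (intro of_nat_mono card_mono) (use XS finY in auto)
  also have "\<dots> \<le> M * real (card (X \<union> Y)) powr \<beta>" by (rule max) (use XS Y False in auto)
  also have "\<dots> \<le> M * (2 * a) powr \<beta>"
    by (intro mult_left_mono powr_mono2) (use card_Un_le[of X Y] Y(2) M beta in \<open>auto simp: a_def\<close>)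
  also have "(2 * a) powr \<beta> = 2 powr \<beta> * a powr \<beta>" using a by (simp add: powr_mult)
  also have "M * (2 powr \<beta> * a powr \<beta>) \<le> M * (4 * a powr \<beta>)"
    using powr_mono[of \<beta> 2 "2::real"] beta M by (intro mult_left_mono mult_right_mono) auto
  finally have "a * e \<le> N * (M * (4 * a powr \<beta>))"
    using Y(3) aN a swap[OF fin] unfolding e_def by (smt (verit) mult_left_mono)
  moreover have "a powr \<beta> = a * a powr (\<beta> - 1)" using a by (simp add: powr_mult_base)
  ultimately have "a * e \<le> a * (4 * M * N * a powr (\<beta> - 1))" by (simp add: mult_ac)
  then have e_le: "e \<le> 4 * M * N * a powr (\<beta> - 1)" using a by simp
  \<comment> \<open>Lower bound for \<open>e\<close> from the degrees in \<open>X\<close>; against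
    the upper bound just found it forces \<open>X\<close> to be a small fraction of
    \<open>S\<close>.\<close>
  have "a * (1024 * M * N powr (\<beta> - 1)) = (\<Sum>x\<in>X. 1024 * M * N powr (\<beta> - 1))" by (simp add: a_def)
  also have "\<dots> \<le> e" unfolding e_def by (intro sum_mono) (auto simp: X N_def)
  finally have "M * (1024 * a * N powr (\<beta> - 1)) \<le> M * (4 * N * a powr (\<beta> - 1))" using e_le by (simp add: mult_ac)
  then have key: "256 * (a * N powr (\<beta> - 1)) \<le> N * a powr (\<beta> - 1)" using M by simp
  define z where "z = a / N"
  have z: "0 < z" "z \<le> 1" using a aN by (auto simp: z_def)
  have az: "a = z * N" using a aN by (simp add: z_def)
  have apow: "a powr (\<beta> - 1) = z powr (\<beta> - 1) * N powr (\<beta> - 1)"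
    unfolding az by (rule powr_mult)
  have "256 * z \<le> z powr (\<beta> - 1)"
  proof -
    have "(256 * z) * (N * N powr (\<beta> - 1)) \<le> z powr (\<beta> - 1) * (N * N powr (\<beta> - 1))"
      using key unfolding apow unfolding az by (simp add: mult_ac)
    then show ?thesis using a aN by simp
  qed
  then have "256 * (z * z powr (1 - \<beta>)) \<le> z powr (\<beta> - 1) * z powr (1 - \<beta>)"
    using mult_right_mono[of "256 * z" "z powr (\<beta> - 1)" "z powr (1 - \<beta>)"] by (simp add: mult.assoc)
  then have "256 * z powr (2 - \<beta>) \<le> 1"
    using z by (simp add: powr_mult_base flip: powr_add)
  \<comment> \<open>Since \<open>\<beta>\<close> is at least 4/3, \<open>2 * \<beta> - 2\<close> is
    at least \<open>2 - \<beta>\<close>, and the bound 1/256 becomes 1/16 for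
    \<open>z powr (\<beta> - 1)\<close>.\<close>
  moreover have "(z powr (\<beta> - 1))\<^sup>2 \<le> z powr (2 - \<beta>)"
  proof -
    have "(z powr (\<beta> - 1))\<^sup>2 = z powr (2 * \<beta> - 2)" using z by (simp add: power2_eq_square flip: powr_add)
    also have "\<dots> \<le> z powr (2 - \<beta>)" by (rule powr_mono') (use beta z in auto)
    finally show ?thesis .
  qed
  ultimately have "(16 * z powr (\<beta> - 1))\<^sup>2 \<le> 1\<^sup>2" by (simp add: power_mult_distrib)
  then have z16: "16 * z powr (\<beta> - 1) \<le> 1" by (rule power2_le_imp_le) simp
  have "e \<le> 4 * M * N * (z powr (\<beta> - 1) * N powr (\<beta> - 1))" using e_le unfolding apow .
  also have "\<dots> = (M * (N * N powr (\<beta> - 1)) / 4) * (16 * z powr (\<beta> - 1))" by simp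
  also have "\<dots> \<le> (M * (N * N powr (\<beta> - 1)) / 4) * 1"
    by (intro mult_left_mono z16) (use M a aN in auto)
  also have "N * N powr (\<beta> - 1) = N powr \<beta>" using a aN by (simp add: powr_mult_base)
  finally show ?thesis unfolding e_def N_def by simp
qed

text \<open>The subgraph is a vertex set maximising the number of edges divided by
  \<open>card S powr \<beta>\<close>. Its value \<open>M\<close> exceeds \<open>C\<close> and is at
  most \<open>N\<close>, so a large constant \<open>C\<close> guarantees that the set itself is
  large.\<close>

theorem many_edges_contain_H:
  fixes \<epsilon> :: real and k l :: nat
  assumes eps: "0 < \<epsilon>" "\<epsilon> < 1/6" and k: "k \<ge> 1" and l: "l \<ge> 1"
    and k_eps: "real k \<ge> 1 / \<epsilon>" and l_eps: "real l \<ge> 16 * real k / \<epsilon>"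
  shows "\<exists>C>0. \<forall>n\<ge>1. \<forall>E\<subseteq>all_edges n. real (card E) > C * real n powr (4/3 + \<epsilon>)
    \<longrightarrow> contains_copy (H_verts k l) (H_edges k l) {0..<n} E"
proof -
  define \<beta> where "\<beta> = 4/3 + \<epsilon>"
  define J where "J = nat \<lceil>4 / \<epsilon>\<rceil>"
  \<comment> \<open>Twice the 1024 of the degree bound, since deleting the edges at vertices of
    large degree costs at most half of the edges.\<close>
  define K :: real where "K = 2048"
  define C1 where "C1 = 16 * real k * K ^ (8 * k)"
  define C2 where "C2 = 4096 * real l ^ 4 * real k ^ 2"
  define C3 where "C3 = 2 * (64 * real k)\<^sup>2 * K\<^sup>2"
  define C4 where "C4 = 16 * real k * K * (real J)\<^sup>2 * C3 ^ 4"
  define Y0 where "Y0 = 128 * real k ^ 2 + C1 * (C4 + 16 * real k) + 1"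
  \<comment> \<open>Through \<open>C < M \<le> N\<close> the three summands ensure that
    \<open>M\<close> is at least 1, that \<open>N\<close> exceeds \<open>2 * C2 ^ l\<close>, and
    that \<open>N powr (\<epsilon> / 4)\<close> is at least \<open>Y0\<close>.\<close>
  define C where "C = 1 + 2 * C2 ^ l + Y0 powr (4 / \<epsilon>)"
  have J: "real J \<ge> 4 / \<epsilon>" unfolding J_def by (simp add: real_nat_ceiling_ge)
  then have J1: "J \<ge> 1" using eps by (metis divide_pos_pos less_one linorder_not_less not_numeral_le_zero of_nat_0 zero_less_numeral)
  have Y0: "Y0 \<ge> 1" unfolding Y0_def C1_def C4_def C3_def K_def by simp
  have C2: "C2 \<ge> 0" by (simp add: C2_def)
  have C: "C \<ge> 1" using C2 by (simp add: C_def)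
  have "contains_copy (H_verts k l) (H_edges k l) {0..<n} E"
    if n: "n \<ge> 1" and E: "E \<subseteq> all_edges n" and big: "real (card E) > C * real n powr \<beta>" for n E
  proof -
    define adj where "adj x y \<longleftrightarrow> {x, y} \<in> E" for x y :: nat
    \<comment> \<open>Ordered pairs are counted, so each edge contributes twice. The empty set,
      where the denominator vanishes, is left out of the maximisation.\<close>
    define f where "f S = real (card {p \<in> S \<times> S. adj (fst p) (snd p)}) / real (card S) powr \<beta>" for S
    have adj_n: "x < n \<and> y < n \<and> x \<noteq> y" if "adj x y" for x y
      using that E unfolding adj_def all_edges_def by (auto simp: doubleton_eq_iff)
    let ?F = "Pow {0..<n} - {{}}"
    have "f ` ?F \<noteq> {}" using n by auto
    then have "Max (f ` ?F) \<in> f ` ?F" by (intro Max_in) auto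
    then obtain S where S: "S \<in> ?F" "f S = Max (f ` ?F)" by (metis imageE)
    have f_max: "f T \<le> f S" if "T \<in> ?F" for T using that unfolding S(2) by (intro Max_ge) auto
    have Sfin: "finite S" "S \<noteq> {}" "S \<subseteq> {0..<n}" using S(1) finite_subset by auto
    define M where "M = f S"
    define N where "N = real (card S)"
    have N1: "N \<ge> 1" unfolding N_def using Sfin by (simp add: Suc_leI card_gt_0_iff)
    have MC: "M > C"
    proof -
      have "E \<subseteq> (\<lambda>p. {fst p, snd p}) ` {p \<in> {0..<n} \<times> {0..<n}. adj (fst p) (snd p)}"
      proof
        fix e assume e: "e \<in> E"
        then obtain u v where uv: "e = {u, v}" "u < n" "v < n" using E unfolding all_edges_def by blast
        then have "(u, v) \<in> {p \<in> {0..<n} \<times> {0..<n}. adj (fst p) (snd p)}" using e by (simp add: adj_def)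
        then show "e \<in> (\<lambda>p. {fst p, snd p}) ` {p \<in> {0..<n} \<times> {0..<n}. adj (fst p) (snd p)}"
          using uv(1) by force
      qed
      then have "card E \<le> card {p \<in> {0..<n} \<times> {0..<n}. adj (fst p) (snd p)}"
        by (rule surj_card_le[rotated]) simp
      then have "C * real n powr \<beta> < real (card {p \<in> {0..<n} \<times> {0..<n}. adj (fst p) (snd p)})"
        using big by linarith
      then have "C < f {0..<n}" unfolding f_def using n by (simp add: pos_less_divide_eq)
      also have "\<dots> \<le> M" unfolding M_def by (rule f_max) (use n in auto)
      finally show ?thesis .
    qed
    have M: "M \<ge> 1" "M > 0" using MC C by auto
    have e_S: "real (card {p \<in> S \<times> S. adj (fst p) (snd p)}) = M * N powr \<beta>"
      using N1 by (simp add: M_def f_def N_def)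
    have MN: "M \<le> N"
    proof -
      have "card {p \<in> S \<times> S. adj (fst p) (snd p)} \<le> card (S \<times> S)" by (rule card_mono) (use Sfin in auto)
      then have "M * N powr \<beta> \<le> real (card (S \<times> S))" unfolding e_S[symmetric] by simp
      also have "\<dots> = N * N" by (simp add: N_def card_cartesian_product)
      also have "\<dots> \<le> N * N powr \<beta>"
        using powr_mono[of 1 \<beta> N] N1 eps by (intro mult_left_mono) (auto simp: \<beta>_def)
      finally show ?thesis using N1 by simp
    qed
    define X where "X = {x \<in> S. real (card {y \<in> S. adj x y}) > 1024 * M * N powr (\<beta> - 1)}"
    have edges_X: "(\<Sum>x\<in>X. real (card {y \<in> S. adj x y})) \<le> M * N powr \<beta> / 4"
      unfolding N_def
    proof (rule few_edges_at_large_degrees[OF Sfin(1,2) _ _ M(2)])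
      show "real (card {p \<in> T \<times> T. adj (fst p) (snd p)}) \<le> M * real (card T) powr \<beta>" if "T \<subseteq> S" "T \<noteq> {}" for T
      proof -
        have "finite T" using that Sfin finite_subset by blast
        then have "real (card T) powr \<beta> > 0" using that by (simp add: card_gt_0_iff)
        moreover have "f T \<le> M" unfolding M_def by (rule f_max) (use that Sfin in auto)
        ultimately show ?thesis unfolding f_def by (simp add: pos_divide_le_eq)
      qed
    qed (use e_S eps in \<open>auto simp: N_def X_def \<beta>_def\<close>)
    \<comment> \<open>Edges at \<open>X\<close> are deleted but the vertices stay, so that
      \<open>N\<close> is unchanged.\<close>
    define adj' where "adj' x y \<longleftrightarrow> adj x y \<and> x \<in> S - X \<and> y \<in> S - X" for x y
    define \<Delta> where "\<Delta> = 1024 * M * N powr (\<beta> - 1)"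
    have Delta_pos: "\<Delta> > 0" using M N1 by (simp add: \<Delta>_def)
    interpret bg: bounded_graph S adj' \<Delta> "{0..<n}" E
    proof
      show "\<not> adj' x x" for x using adj_n[of x x] by (auto simp: adj'_def)
      show "real (card {y \<in> S. adj' x y}) \<le> \<Delta>" if "x \<in> S" for x
      proof (cases "x \<in> X")
        case True
        then show ?thesis using Delta_pos by (simp add: adj'_def)
      next
        case False
        have "card {y \<in> S. adj' x y} \<le> card {y \<in> S. adj x y}"
          by (rule card_mono) (use Sfin in \<open>auto simp: adj'_def\<close>)
        then show ?thesis using False that by (simp add: X_def \<Delta>_def)
      qed
    qed (use Sfin Delta_pos adj_n in \<open>auto simp: adj'_def adj_def insert_commute\<close>)
    \<comment> \<open>The divisor 4 makes \<open>N * y ^ 12\<close> equal to the cube of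
      \<open>N powr (\<beta> - 1)\<close>.\<close>
    define y where "y = N powr (\<epsilon> / 4)"
    have y1: "y \<ge> 1" using N1 eps by (simp add: y_def ge_one_powr_ge_zero)
    have ypow: "y ^ m = N powr (\<epsilon> / 4 * m)" for m
      using N1 by (simp add: y_def powr_powr flip: powr_realpow)
    show ?thesis
    proof (rule bg.contains_H_if_almost_regular[where K = K and J = J and y = y, OF k l J1])
      show "1 \<le> K" by (simp add: K_def)
      show "S \<noteq> {}" by (rule Sfin)
      show "card S * \<Delta> \<le> K * (\<Sum>x\<in>S. real (card {y \<in> S. adj' x y}))"
      proof -
        have "card S * \<Delta> = 1024 * (M * N powr \<beta>)"
          using N1 by (simp add: \<Delta>_def powr_mult_base flip: N_def)
        moreover have "M * N powr \<beta> / 2 \<le> (\<Sum>x\<in>S. real (card {y \<in> S. adj' x y}))"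
        proof -
          have cnt: "(\<Sum>x\<in>S. real (card {y \<in> S. Q x y})) = real (card {p \<in> S \<times> S. Q (fst p) (snd p)})" for Q
          proof -
            have "(\<Sum>x\<in>S. real (card {y \<in> S. Q x y})) = real (card (SIGMA x:S. {y \<in> S. Q x y}))"
              using Sfin by simp
            also have "(SIGMA x:S. {y \<in> S. Q x y}) = {p \<in> S \<times> S. Q (fst p) (snd p)}" by auto
            finally show ?thesis .
          qed
          have sym: "(\<Sum>x\<in>S. \<Sum>y\<in>S. of_bool (adj x y \<and> y \<in> X) :: real) = (\<Sum>x\<in>S. \<Sum>y\<in>S. of_bool (adj x y \<and> x \<in> X))"
            by (subst sum.swap) (simp add: adj_def insert_commute)
          have X_sum: "(\<Sum>x\<in>S. \<Sum>y\<in>S. of_bool (adj x y \<and> x \<in> X)) = (\<Sum>x\<in>X. real (card {y \<in> S. adj x y}))"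
          proof -
            have "(\<Sum>x\<in>S. \<Sum>y\<in>S. of_bool (adj x y \<and> x \<in> X) :: real) = (\<Sum>x\<in>X. \<Sum>y\<in>S. of_bool (adj x y))"
              by (intro sum.mono_neutral_cong_right) (use Sfin in \<open>auto simp: X_def\<close>)
            then show ?thesis by (simp only: sum_of_bool[OF Sfin(1)])
          qed
          \<comment> \<open>A deleted pair has its first or its second entry in \<open>X\<close>; by
            symmetry both kinds have the same count, at most a quarter of all pairs.\<close>
          have "M * N powr \<beta> = (\<Sum>x\<in>S. \<Sum>y\<in>S. of_bool (adj x y))"
            unfolding e_S[symmetric] cnt[symmetric] by (simp only: sum_of_bool[OF Sfin(1)])
          also have "\<dots> \<le> (\<Sum>x\<in>S. \<Sum>y\<in>S. of_bool (adj' x y) + of_bool (adj x y \<and> x \<in> X) + of_bool (adj x y \<and> y \<in> X))"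
            by (intro sum_mono) (auto simp: adj'_def)
          also have "\<dots> = (\<Sum>x\<in>S. \<Sum>y\<in>S. of_bool (adj' x y)) + 2 * (\<Sum>x\<in>X. real (card {y \<in> S. adj x y}))"
            unfolding sum.distrib sym X_sum by simp
          also have "(\<Sum>x\<in>S. \<Sum>y\<in>S. of_bool (adj' x y)) = (\<Sum>x\<in>S. real (card {y \<in> S. adj' x y}))"
            by (simp only: sum_of_bool[OF Sfin(1)])
          finally show ?thesis using edges_X by linarith
        qed
        ultimately show ?thesis by (simp add: K_def)
      qed
      have "Y0 powr (4 / \<epsilon>) \<le> N" using MC MN zero_le_power[OF C2, of l] unfolding C_def by linarith
      then have "(Y0 powr (4 / \<epsilon>)) powr (\<epsilon> / 4) \<le> N powr (\<epsilon> / 4)"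
        using eps by (intro powr_mono2) auto
      then have "Y0 \<le> y" using eps Y0 by (simp add: powr_powr y_def)
      then show "128 * real k ^ 2 + 16 * real k * K ^ (8 * k) * (16 * real k * K * (real J)\<^sup>2 * (2 * (64 * real k)\<^sup>2 * K\<^sup>2) ^ 4 + 16 * real k) + 1 \<le> y"
        unfolding Y0_def C1_def C4_def C3_def .
      have "2 * C2 ^ l < N" using MC MN powr_ge_zero[of Y0 "4 / \<epsilon>"] unfolding C_def by linarith
      then show "2 * (4096 * real l ^ 4 * real k ^ 2) ^ l < card S" by (simp add: C2_def N_def)
      have exp_mono: "N powr b \<le> N powr c" if "b \<le> c" for b c using that N1 by (rule powr_mono)
      have N_pow: "N = N powr 1" using N1 by simp
      have ek: "1 \<le> \<epsilon> * k" using k_eps eps by (simp add: field_simps)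
      have el: "16 * k \<le> \<epsilon> * l" using l_eps eps by (simp add: field_simps)
      have "N \<le> y ^ (4 * k)" unfolding ypow by (subst N_pow) (rule exp_mono, use ek in simp)
      then show "card S \<le> y ^ (4 * k)" by (simp add: N_def)
      have "N ^ (8 * k) = N powr (8 * k)" using N1 by (simp flip: powr_realpow)
      also have "\<dots> \<le> y ^ (2 * l)" unfolding ypow by (rule exp_mono) (use el in simp)
      finally show "real (card S) ^ (8 * k) \<le> y ^ (2 * l)" by (simp add: N_def)
      have "N \<le> y ^ J" unfolding ypow by (subst N_pow) (rule exp_mono, use J eps in \<open>simp add: field_simps\<close>)
      then show "card S \<le> y ^ J" by (simp add: N_def)
      have "N * y ^ 12 = N powr (1 + 3 * \<epsilon>)" using N1 unfolding ypow by (simp add: powr_add)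
      also have "\<dots> = (N powr (\<beta> - 1)) ^ 3"
        using N1 by (simp add: \<beta>_def powr_powr algebra_simps flip: powr_realpow)
      also have "\<dots> \<le> \<Delta> ^ 3"
      proof (rule power_mono)
        have "1 * N powr (\<beta> - 1) \<le> 1024 * M * N powr (\<beta> - 1)" using M by (intro mult_right_mono) auto
        then show "N powr (\<beta> - 1) \<le> \<Delta>" by (simp add: \<Delta>_def)
      qed simp
      finally show "card S * y ^ 12 \<le> \<Delta> ^ 3" by (simp add: N_def)
    qed
  qed
  then show ?thesis using C unfolding \<beta>_def by (intro exI[of _ C]) auto
qed

theorem theorem1p6:
  fixes \<epsilon> :: real and k l :: nat
  assumes "0 < \<epsilon>" "\<epsilon> < 1/6"
    and "k \<ge> 1" "l \<ge> 1"
    and "real k \<ge> 1 / \<epsilon>" and "real l \<ge> 16 * real k / \<epsilon>"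
  shows "(\<lambda>n. real (ex_num n (H_verts k l) (H_edges k l))) \<in> O(\<lambda>n. real n powr (4/3 + \<epsilon>))"
proof -
  obtain C where "C > 0" and C: "\<And>n E. n \<ge> 1 \<Longrightarrow> E \<subseteq> all_edges n \<Longrightarrow> real (card E) > C * real n powr (4/3 + \<epsilon>)
    \<Longrightarrow> contains_copy (H_verts k l) (H_edges k l) {0..<n} E"
    using many_edges_contain_H[OF assms] by blast
  show ?thesis
  proof (rule bigoI[of _ C])
    show "\<forall>\<^sub>F n in at_top. norm (real (ex_num n (H_verts k l) (H_edges k l))) \<le> C * norm (real n powr (4/3 + \<epsilon>))"
      using eventually_ge_at_top[of 1]
    proof eventually_elim
      case (elim n)
      let ?S = "{card E | E. E \<subseteq> all_edges n \<and> \<not> contains_copy (H_verts k l) (H_edges k l) {0..<n} E}"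
      have "all_edges n \<subseteq> Pow {0..<n}" by (auto simp: all_edges_def)
      then have "finite (all_edges n)" by (rule finite_subset) simp
      then have "finite (Pow (all_edges n))" by simp
      then have "finite (card ` Pow (all_edges n))" by (rule finite_imageI)
      then have fin: "finite ?S" by (rule finite_subset[rotated]) auto
      \<comment> \<open>The target graph has an edge, so the empty graph avoids it and the maximum
        in \<open>ex_num\<close> is taken over a nonempty set.\<close>
      have "{(1, 1), (2, 1)} \<in> H_edges k l"
        unfolding H_edges_def using assms(3,4) by (intro UnI1 CollectI exI[of _ 1]) auto
      then have "\<not> contains_copy (H_verts k l) (H_edges k l) {0..<n} {}"
        by (auto simp: contains_copy_def)
      then have "?S \<noteq> {}" by blast
      then have "ex_num n (H_verts k l) (H_edges k l) \<in> ?S" unfolding ex_num_def by (rule Max_in[OF fin])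
      then obtain E where "ex_num n (H_verts k l) (H_edges k l) = card E" "E \<subseteq> all_edges n"
        "\<not> contains_copy (H_verts k l) (H_edges k l) {0..<n} E" by blast
      then show ?case using C[OF elim, of E] by force
    qed
  qed
qed

end
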